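(* Let $(A,[\cdot,\cdot],\rho)$ be a Lie algebroid over a smooth manifold $M$, let $\pi\in\Gamma(\bigwedge^2A)$ be a Poisson bivector and let $\omega\in\Gamma(\bigwedge^2A^* )$ be a 2-form. Put $N=\pi^\sharp\circ\omega^\flat$ and $\omega_N=\omega(N\cdot,\cdot)$. Then the quadruple $(\pi,N,d\omega_N,-d\omega)$ is a Poisson quasi-Nijenhuis structure with background on $A$.
   Context: Conventions. $(A,[\cdot,\cdot],\rho)$ is a Lie algebroid with differential $d$ on $\Gamma(\bigwedge^\bullet A^* )$ and Lie derivative $\mathcal L_X=i_Xd+di_X$. For $\pi\in\Gamma(\bigwedge^2A)$, $\pi^\sharp(\alpha)=\pi(\alpha,\cdot)$, i.e. $\beta(\pi^\sharp\alpha)=\pi(\alpha,\beta)$; for a 2-form $\omega$, $\omega^\flat(X)=\omega(X,\cdot)$. ${}^tN:A^*\to A^*$ is the transpose of $N:A\to A$. For 3-forms, $i_{X\wedge Y}:=i_X\circ i_Y$, i.e. $(i_{X\wedge Y}H)(Z)=H(Y,X,Z)$. Deformations. $[X,Y]_N=[NX,Y]+[X,NY]-N[X,Y]$. $i_N$ is the degree $0$ derivation of $\Gamma(\bigwedge^\bullet A^* )$ vanishing on functions with $i_N\alpha={}^tN\alpha$ on 1-forms, so $(i_N\eta)(X_1,\dots,X_k)=\sum_j\eta(X_1,\dots,NX_j,\dots,X_k)$. $d_N=i_N\circ d-d\circ i_N$. $\mathcal L^N_X=i_Xd_N+d_Ni_X$. $T_N(X,Y)=[NX,NY]-N([X,Y]_N)$.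 On $\Gamma(A^* )$: $[\alpha,\beta]_\pi=\mathcal L_{\pi^\sharp\alpha}\beta-\mathcal L_{\pi^\sharp\beta}\alpha-d(\pi(\alpha,\beta))$. A bivector $\pi$ is Poisson if its Schouten-Nijenhuis bracket with itself vanishes. Define $$C_{\pi,N}(\alpha,\beta)=\Big(\mathcal L^N_{\pi^\sharp\alpha}\beta-\mathcal L^N_{\pi^\sharp\beta}\alpha-d_N(\pi(\alpha,\beta))\Big)-\Big([{}^tN\alpha,\beta]_\pi+[\alpha,{}^tN\beta]_\pi-{}^tN[\alpha,\beta]_\pi\Big).$$ Poisson quasi-Nijenhuis structure with background on $A$: a quadruple $(\pi,N,\psi,H)$ with $\pi\in\Gamma(\bigwedge^2A)$, $N\in\Gamma(A\otimes A^* )$, $\psi,H\in\Gamma(\bigwedge^3A^* )$ such that $N\circ\pi^\sharp=\pi^\sharp\circ{}^tN$, $d\psi=0$, $dH=0$, and for all $X,Y\in\Gamma(A)$, $\alpha,\beta\in\Gamma(A^* )$: (1) $\pi$ is a Poisson bivector; (2) $C_{\pi,N}(\alpha,\beta)=-2\,i_{\pi^\sharp\alpha\wedge\pi^\sharp\beta}H$ (that is, $=2H(\pi^\sharp\alpha,\pi^\sharp\beta,\cdot)$); (3) $T_N(X,Y)=\pi^\sharp\big(i_{NX\wedge Y}H-i_{NY\wedge X}H+i_{X\wedge Y}\psi\big)$; (4) $d_N\psi=d\mathcal H$, where $\mathcal H(X,Y,Z)=H(NX,NY,Z)+H(NY,NZ,X)+H(NZ,NX,Y)$. *)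

theory Defs
  imports "HOL-Analysis.Analysis" "HOL-Library.Function_Algebras"
begin

section \<open>Smooth manifolds\<close>

text \<open>The coordinate space of dimension \<open>n\<close> (\<open>n = 0\<close> included) is \<^const>\<open>Euclidean_space\<close>
  \<open>n\<close>, whose points are the sequences that vanish from index \<open>n\<close> on.  A function is smooth on an
  open set when all its iterated partial derivatives exist and are continuous.\<close>

definition partial :: "nat \<Rightarrow> ((nat \<Rightarrow> real) \<Rightarrow> real) \<Rightarrow> (nat \<Rightarrow> real) \<Rightarrow> real" where
  "partial i f = (\<lambda>x. deriv (\<lambda>t. f (x(i := t))) (x i))"

primrec Ck_on :: "nat \<Rightarrow> nat \<Rightarrow> (nat \<Rightarrow> real) set \<Rightarrow> ((nat \<Rightarrow> real) \<Rightarrow> real) \<Rightarrow> bool" where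
  "Ck_on n 0 S f \<longleftrightarrow> continuous_map (subtopology (Euclidean_space n) S) euclideanreal f"
| "Ck_on n (Suc k) S f \<longleftrightarrow>
     continuous_map (subtopology (Euclidean_space n) S) euclideanreal f \<and>
     (\<forall>i<n. (\<forall>x\<in>S. (\<lambda>t. f (x(i := t))) differentiable at (x i)) \<and> Ck_on n k S (partial i f))"

definition Cinf_on :: "nat \<Rightarrow> (nat \<Rightarrow> real) set \<Rightarrow> ((nat \<Rightarrow> real) \<Rightarrow> real) \<Rightarrow> bool" where
  "Cinf_on n S f \<longleftrightarrow> (\<forall>k. Ck_on n k S f)"

text \<open>The underlying topological space of the manifold is the type \<open>'m\<close>.  A chart is a pair of an
  open domain and a coordinate map, which is only meaningful on that domain.\<close>

record 'm manifold_data =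
  mdim :: nat
  charts :: "('m set \<times> ('m \<Rightarrow> nat \<Rightarrow> real)) set"

definition smooth_manifold ::
    "('m::{t2_space,second_countable_topology}, 'z) manifold_data_scheme \<Rightarrow> bool" where
  "smooth_manifold M \<longleftrightarrow>
     (\<Union>(U, \<phi>)\<in>charts M. U) = UNIV \<and>
     (\<forall>(U, \<phi>)\<in>charts M.
        open U \<and> openin (Euclidean_space (mdim M)) (\<phi> ` U) \<and>
        homeomorphic_map (top_of_set U) (subtopology (Euclidean_space (mdim M)) (\<phi> ` U)) \<phi>) \<and>
     (\<forall>(U, \<phi>)\<in>charts M. \<forall>(V, \<psi>)\<in>charts M. \<forall>i<mdim M.
        Cinf_on (mdim M) (\<psi> ` (U \<inter> V)) (\<lambda>y. \<phi> (inv_into V \<psi> y) i))"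

definition smooth_fun_on ::
    "('m::topological_space, 'z) manifold_data_scheme \<Rightarrow> 'm set \<Rightarrow> ('m \<Rightarrow> real) \<Rightarrow> bool" where
  "smooth_fun_on M W f \<longleftrightarrow>
     (\<forall>(U, \<phi>)\<in>charts M. Cinf_on (mdim M) (\<phi> ` (U \<inter> W)) (\<lambda>y. f (inv_into U \<phi> y)))"

definition smooth_funs ::
    "('m::topological_space, 'z) manifold_data_scheme \<Rightarrow> ('m \<Rightarrow> real) set" where
  "smooth_funs M = {f. smooth_fun_on M UNIV f}"

text \<open>Tangent vectors at \<open>x\<close> are the derivations at \<open>x\<close> of the algebra of smooth functions.\<close>

definition tangent_space ::
    "('m::topological_space, 'z) manifold_data_scheme \<Rightarrow> 'm \<Rightarrow> (('m \<Rightarrow> real) \<Rightarrow> real) set" where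
  "tangent_space M x = {D. \<forall>f\<in>smooth_funs M. \<forall>g\<in>smooth_funs M.
     (\<forall>a b. D (\<lambda>y. a * f y + b * g y) = a * D f + b * D g) \<and>
     D (\<lambda>y. f y * g y) = f x * D g + g x * D f}"

section \<open>Vector bundles\<close>

text \<open>The fibres are arbitrary subspaces of a real vector space \<open>'v\<close>, which carries no topology: it
  only serves as a universe for the fibres.  The smooth structure of the bundle is given by local
  frames with smooth transition matrices; a local frame on \<open>U\<close> is the same thing as a local
  trivialisation of the bundle over \<open>U\<close>.\<close>

record ('m, 'v) bundle_data = "'m manifold_data" +
  vrank :: nat
  fibre :: "'m \<Rightarrow> 'v set"
  frames :: "('m set \<times> (nat \<Rightarrow> 'm \<Rightarrow> 'v)) set"

definition vector_bundle ::
    "('m::{t2_space,second_countable_topology}, 'v::real_vector, 'z) bundle_data_scheme \<Rightarrow> bool" where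
  "vector_bundle A \<longleftrightarrow>
     smooth_manifold A \<and>
     (\<forall>x. subspace (fibre A x)) \<and>
     (\<Union>(U, e)\<in>frames A. U) = UNIV \<and>
     (\<forall>(U, e)\<in>frames A. open U \<and>
        (\<forall>x\<in>U. inj_on (\<lambda>i. e i x) {..<vrank A} \<and> independent ((\<lambda>i. e i x) ` {..<vrank A}) \<and>
               span ((\<lambda>i. e i x) ` {..<vrank A}) = fibre A x)) \<and>
     (\<forall>(U, e)\<in>frames A. \<forall>(V, e')\<in>frames A.
        \<exists>g. (\<forall>i<vrank A. \<forall>j<vrank A. smooth_fun_on A (U \<inter> V) (g i j)) \<and>
            (\<forall>x\<in>U \<inter> V. \<forall>j<vrank A. e' j x = (\<Sum>i<vrank A. g i j x *\<^sub>R e i x)))"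

definition sections ::
    "('m::topological_space, 'v::real_vector, 'z) bundle_data_scheme \<Rightarrow> ('m \<Rightarrow> 'v) set" where
  "sections A = {X. (\<forall>x. X x \<in> fibre A x) \<and>
     (\<forall>(U, e)\<in>frames A. \<exists>c. (\<forall>i<vrank A. smooth_fun_on A U (c i)) \<and>
        (\<forall>x\<in>U. X x = (\<Sum>i<vrank A. c i x *\<^sub>R e i x)))}"

text \<open>Alternating \<open>k\<close>-forms on a subspace \<open>V\<close> are functions of the list of arguments.  They are
  extended by \<open>0\<close> to the lists of other lengths or with entries outside \<open>V\<close>, so that equality of
  forms is equality of functions.  A \<open>0\<close>-form is determined by its value on the empty list, and a
  covector \<open>a\<close> has the value \<open>a [v]\<close> on \<open>v\<close>.\<close>

definition alt_forms :: "nat \<Rightarrow> 'v::real_vector set \<Rightarrow> ('v list \<Rightarrow> real) set" where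
  "alt_forms k V = {f.
     (\<forall>vs. \<not> (length vs = k \<and> set vs \<subseteq> V) \<longrightarrow> f vs = 0) \<and>
     (\<forall>vs i v w a b. length vs = k \<and> set vs \<subseteq> V \<and> i < k \<and> v \<in> V \<and> w \<in> V \<longrightarrow>
        f (vs[i := a *\<^sub>R v + b *\<^sub>R w]) = a * f (vs[i := v]) + b * f (vs[i := w])) \<and>
     (\<forall>vs. length vs = k \<and> set vs \<subseteq> V \<and> \<not> distinct vs \<longrightarrow> f vs = 0)}"

abbreviation covectors :: "'v::real_vector set \<Rightarrow> ('v list \<Rightarrow> real) set" where
  "covectors \<equiv> alt_forms 1"

type_synonym ('m, 'v) form = "'m \<Rightarrow> 'v list \<Rightarrow> real"
type_synonym ('m, 'v) bivector = "'m \<Rightarrow> ('v list \<Rightarrow> real) \<Rightarrow> ('v list \<Rightarrow> real) \<Rightarrow> real"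
type_synonym ('m, 'v) trivector =
  "'m \<Rightarrow> ('v list \<Rightarrow> real) \<Rightarrow> ('v list \<Rightarrow> real) \<Rightarrow> ('v list \<Rightarrow> real) \<Rightarrow> real"

text \<open>Smooth sections of the \<open>k\<close>-th exterior power of the dual bundle, of the second exterior power
  of the bundle, and of its endomorphism bundle.  These are fibrewise objects; they are smooth when
  evaluating them on smooth sections gives something smooth.  The second exterior power of a fibre
  is identified with the alternating bilinear forms on its (finite-dimensional) dual; a bivector is
  only meaningful on covectors of the fibre, and an endomorphism on vectors of the fibre.\<close>

definition forms ::
    "('m::topological_space, 'v::real_vector, 'z) bundle_data_scheme \<Rightarrow> nat \<Rightarrow> ('m, 'v) form set" where
  "forms A k = {\<eta>. (\<forall>x. \<eta> x \<in> alt_forms k (fibre A x)) \<and>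
     (\<forall>Xs. length Xs = k \<and> set Xs \<subseteq> sections A \<longrightarrow>
        (\<lambda>x. \<eta> x (map (\<lambda>X. X x) Xs)) \<in> smooth_funs A)}"

definition bivector_fields ::
    "('m::topological_space, 'v::real_vector, 'z) bundle_data_scheme \<Rightarrow> ('m, 'v) bivector set" where
  "bivector_fields A = {P.
     (\<forall>x. \<forall>a\<in>covectors (fibre A x). \<forall>b\<in>covectors (fibre A x). \<forall>c\<in>covectors (fibre A x). \<forall>s t.
        P x (\<lambda>vs. s * a vs + t * b vs) c = s * P x a c + t * P x b c) \<and>
     (\<forall>x. \<forall>a\<in>covectors (fibre A x). \<forall>b\<in>covectors (fibre A x). P x a b = - P x b a) \<and>
     (\<forall>\<alpha>\<in>forms A 1. \<forall>\<beta>\<in>forms A 1. (\<lambda>x. P x (\<alpha> x) (\<beta> x)) \<in> smooth_funs A)}"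

definition on_sections :: "('m \<Rightarrow> 'v \<Rightarrow> 'v) \<Rightarrow> ('m \<Rightarrow> 'v) \<Rightarrow> 'm \<Rightarrow> 'v" where
  "on_sections N X = (\<lambda>x. N x (X x))"

definition endo_fields ::
    "('m::topological_space, 'v::real_vector, 'z) bundle_data_scheme \<Rightarrow> ('m \<Rightarrow> 'v \<Rightarrow> 'v) set" where
  "endo_fields A = {N.
     (\<forall>x. \<forall>v\<in>fibre A x. N x v \<in> fibre A x) \<and>
     (\<forall>x. \<forall>v\<in>fibre A x. \<forall>w\<in>fibre A x. \<forall>a b.
        N x (a *\<^sub>R v + b *\<^sub>R w) = a *\<^sub>R N x v + b *\<^sub>R N x w) \<and>
     (\<forall>X\<in>sections A. on_sections N X \<in> sections A)}"

text \<open>The vector \<open>sharp A P x a\<close> is characterised by \<open>b [sharp A P x a] = P x a b\<close>.\<close>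

definition sharp :: "('m, 'v::real_vector, 'z) bundle_data_scheme \<Rightarrow> ('m, 'v) bivector \<Rightarrow>
    'm \<Rightarrow> ('v list \<Rightarrow> real) \<Rightarrow> 'v" where
  "sharp A P x a = (THE v. v \<in> fibre A x \<and> (\<forall>b\<in>covectors (fibre A x). b [v] = P x a b))"

definition sharp_sec :: "('m, 'v::real_vector, 'z) bundle_data_scheme \<Rightarrow> ('m, 'v) bivector \<Rightarrow>
    ('m, 'v) form \<Rightarrow> 'm \<Rightarrow> 'v" where
  "sharp_sec A P \<alpha> = (\<lambda>x. sharp A P x (\<alpha> x))"

definition flat :: "('m, 'v) form \<Rightarrow> 'm \<Rightarrow> 'v \<Rightarrow> 'v list \<Rightarrow> real" where
  "flat \<omega> x v = (\<lambda>vs. \<omega> x (v # vs))"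

text \<open>Transpose of a fibre endomorphism.  This and several operations below restrict explicitly to
  arguments in the fibre, in order to produce forms in the sense of \<^const>\<open>alt_forms\<close>.\<close>

definition transp_at :: "('m, 'v, 'z) bundle_data_scheme \<Rightarrow> ('m \<Rightarrow> 'v \<Rightarrow> 'v) \<Rightarrow>
    'm \<Rightarrow> ('v list \<Rightarrow> real) \<Rightarrow> 'v list \<Rightarrow> real" where
  "transp_at A N x a = (\<lambda>vs. if set vs \<subseteq> fibre A x then a (map (N x) vs) else 0)"

definition transp :: "('m, 'v, 'z) bundle_data_scheme \<Rightarrow> ('m \<Rightarrow> 'v \<Rightarrow> 'v) \<Rightarrow>
    ('m, 'v) form \<Rightarrow> ('m, 'v) form" where
  "transp A N \<alpha> = (\<lambda>x. transp_at A N x (\<alpha> x))"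

text \<open>The form \<open>\<omega>(N\<cdot>,\<cdot>)\<close>.\<close>

definition twist :: "('m, 'v, 'z) bundle_data_scheme \<Rightarrow> ('m, 'v) form \<Rightarrow> ('m \<Rightarrow> 'v \<Rightarrow> 'v) \<Rightarrow>
    ('m, 'v) form" where
  "twist A \<omega> N = (\<lambda>x vs. case vs of
     [v, w] \<Rightarrow> (if v \<in> fibre A x \<and> w \<in> fibre A x then \<omega> x [N x v, w] else 0)
   | _ \<Rightarrow> 0)"

definition fun_form :: "('m \<Rightarrow> real) \<Rightarrow> ('m, 'v) form" where
  "fun_form f = (\<lambda>x vs. if vs = [] then f x else 0)"

section \<open>Lie algebroids\<close>

record ('m, 'v) lie_algebroid_data = "('m, 'v) bundle_data" +
  anchor :: "'m \<Rightarrow> 'v \<Rightarrow> ('m \<Rightarrow> real) \<Rightarrow> real"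
  bracket :: "('m \<Rightarrow> 'v) \<Rightarrow> ('m \<Rightarrow> 'v) \<Rightarrow> 'm \<Rightarrow> 'v"

definition anchor_sec :: "('m, 'v, 'z) lie_algebroid_data_scheme \<Rightarrow> ('m \<Rightarrow> 'v) \<Rightarrow>
    ('m \<Rightarrow> real) \<Rightarrow> 'm \<Rightarrow> real" where
  "anchor_sec A X f = (\<lambda>x. anchor A x (X x) f)"

definition lie_algebroid :: "('m::{t2_space,second_countable_topology}, 'v::real_vector, 'z)
    lie_algebroid_data_scheme \<Rightarrow> bool" where
  "lie_algebroid A \<longleftrightarrow>
     vector_bundle A \<and>
     \<comment> \<open>the anchor is a smooth bundle map to the tangent bundle\<close>
     (\<forall>x. \<forall>v\<in>fibre A x. anchor A x v \<in> tangent_space A x) \<and>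
     (\<forall>x. \<forall>v\<in>fibre A x. \<forall>w\<in>fibre A x. \<forall>a b. \<forall>f\<in>smooth_funs A.
        anchor A x (a *\<^sub>R v + b *\<^sub>R w) f = a * anchor A x v f + b * anchor A x w f) \<and>
     (\<forall>X\<in>sections A. \<forall>f\<in>smooth_funs A. anchor_sec A X f \<in> smooth_funs A) \<and>
     \<comment> \<open>the sections form a real Lie algebra\<close>
     (\<forall>X\<in>sections A. \<forall>Y\<in>sections A. bracket A X Y \<in> sections A) \<and>
     (\<forall>X\<in>sections A. \<forall>Y\<in>sections A. \<forall>Z\<in>sections A. \<forall>a b.
        bracket A (\<lambda>x. a *\<^sub>R X x + b *\<^sub>R Y x) Z =
          (\<lambda>x. a *\<^sub>R bracket A X Z x + b *\<^sub>R bracket A Y Z x)) \<and>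
     (\<forall>X\<in>sections A. \<forall>Y\<in>sections A. bracket A X Y = - bracket A Y X) \<and>
     (\<forall>X\<in>sections A. \<forall>Y\<in>sections A. \<forall>Z\<in>sections A.
        bracket A X (bracket A Y Z) + bracket A Y (bracket A Z X) + bracket A Z (bracket A X Y) = 0) \<and>
     \<comment> \<open>Leibniz rule, and compatibility of the anchor with brackets\<close>
     (\<forall>X\<in>sections A. \<forall>Y\<in>sections A. \<forall>f\<in>smooth_funs A.
        bracket A X (\<lambda>x. f x *\<^sub>R Y x) =
          (\<lambda>x. f x *\<^sub>R bracket A X Y x + anchor_sec A X f x *\<^sub>R Y x)) \<and>
     (\<forall>X\<in>sections A. \<forall>Y\<in>sections A. \<forall>f\<in>smooth_funs A.
        anchor_sec A (bracket A X Y) f =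
          anchor_sec A X (anchor_sec A Y f) - anchor_sec A Y (anchor_sec A X f))"

subsection \<open>Differential calculus\<close>

definition omit :: "nat \<Rightarrow> 'a list \<Rightarrow> 'a list" where
  "omit i xs = take i xs @ drop (Suc i) xs"

text \<open>The Koszul formula for the value of the differential on sections.  The form \<open>\<eta>\<close> is evaluated
  on lists of any length, so the degree need not be mentioned.\<close>

definition koszul :: "('m, 'v, 'z) lie_algebroid_data_scheme \<Rightarrow> ('m, 'v) form \<Rightarrow>
    ('m \<Rightarrow> 'v) list \<Rightarrow> 'm \<Rightarrow> real" where
  "koszul A \<eta> Xs x =
     (\<Sum>i<length Xs. (-1) ^ i *
        anchor_sec A (Xs ! i) (\<lambda>y. \<eta> y (map (\<lambda>X. X y) (omit i Xs))) x) +
     (\<Sum>j<length Xs. \<Sum>i<j. (-1) ^ (i + j) *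
        \<eta> x (map (\<lambda>X. X x) (bracket A (Xs ! i) (Xs ! j) # omit i (omit j Xs))))"

text \<open>The Koszul formula is tensorial: its value at \<open>x\<close> depends only on the values of the sections
  at \<open>x\<close>.  Hence any extensions of the given fibre vectors to global sections may be chosen.\<close>

definition ext_d :: "('m::topological_space, 'v::real_vector, 'z) lie_algebroid_data_scheme \<Rightarrow>
    ('m, 'v) form \<Rightarrow> ('m, 'v) form" where
  "ext_d A \<eta> = (\<lambda>x vs. if set vs \<subseteq> fibre A x
     then koszul A \<eta> (map (\<lambda>v. SOME X. X \<in> sections A \<and> X x = v) vs) x else 0)"

definition ins :: "('m \<Rightarrow> 'v) \<Rightarrow> ('m, 'v) form \<Rightarrow> ('m, 'v) form" where
  "ins X \<eta> = (\<lambda>x vs. \<eta> x (X x # vs))"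

definition lie_deriv :: "('m::topological_space, 'v::real_vector, 'z) lie_algebroid_data_scheme \<Rightarrow>
    ('m \<Rightarrow> 'v) \<Rightarrow> ('m, 'v) form \<Rightarrow> ('m, 'v) form" where
  "lie_deriv A X \<eta> = ins X (ext_d A \<eta>) + ext_d A (ins X \<eta>)"

definition i_endo :: "('m, 'v, 'z) bundle_data_scheme \<Rightarrow> ('m \<Rightarrow> 'v \<Rightarrow> 'v) \<Rightarrow>
    ('m, 'v) form \<Rightarrow> ('m, 'v) form" where
  "i_endo A N \<eta> = (\<lambda>x vs. if set vs \<subseteq> fibre A x
     then (\<Sum>j<length vs. \<eta> x (vs[j := N x (vs ! j)])) else 0)"

definition d_endo :: "('m::topological_space, 'v::real_vector, 'z) lie_algebroid_data_scheme \<Rightarrow>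
    ('m \<Rightarrow> 'v \<Rightarrow> 'v) \<Rightarrow> ('m, 'v) form \<Rightarrow> ('m, 'v) form" where
  "d_endo A N \<eta> = i_endo A N (ext_d A \<eta>) - ext_d A (i_endo A N \<eta>)"

definition lie_endo :: "('m::topological_space, 'v::real_vector, 'z) lie_algebroid_data_scheme \<Rightarrow>
    ('m \<Rightarrow> 'v \<Rightarrow> 'v) \<Rightarrow> ('m \<Rightarrow> 'v) \<Rightarrow> ('m, 'v) form \<Rightarrow> ('m, 'v) form" where
  "lie_endo A N X \<eta> = ins X (d_endo A N \<eta>) + d_endo A N (ins X \<eta>)"

definition bracket_endo :: "('m, 'v::real_vector, 'z) lie_algebroid_data_scheme \<Rightarrow>
    ('m \<Rightarrow> 'v \<Rightarrow> 'v) \<Rightarrow> ('m \<Rightarrow> 'v) \<Rightarrow> ('m \<Rightarrow> 'v) \<Rightarrow> 'm \<Rightarrow> 'v" where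
  "bracket_endo A N X Y =
     bracket A (on_sections N X) Y + bracket A X (on_sections N Y) - on_sections N (bracket A X Y)"

definition torsion :: "('m, 'v::real_vector, 'z) lie_algebroid_data_scheme \<Rightarrow>
    ('m \<Rightarrow> 'v \<Rightarrow> 'v) \<Rightarrow> ('m \<Rightarrow> 'v) \<Rightarrow> ('m \<Rightarrow> 'v) \<Rightarrow> 'm \<Rightarrow> 'v" where
  "torsion A N X Y =
     bracket A (on_sections N X) (on_sections N Y) - on_sections N (bracket_endo A N X Y)"

definition pairing :: "('m, 'v) bivector \<Rightarrow> ('m, 'v) form \<Rightarrow> ('m, 'v) form \<Rightarrow> ('m, 'v) form" where
  "pairing P \<alpha> \<beta> = fun_form (\<lambda>x. P x (\<alpha> x) (\<beta> x))"

definition bracket_bivector :: "('m::topological_space, 'v::real_vector, 'z)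
    lie_algebroid_data_scheme \<Rightarrow> ('m, 'v) bivector \<Rightarrow>
    ('m, 'v) form \<Rightarrow> ('m, 'v) form \<Rightarrow> ('m, 'v) form" where
  "bracket_bivector A P \<alpha> \<beta> =
     lie_deriv A (sharp_sec A P \<alpha>) \<beta> - lie_deriv A (sharp_sec A P \<beta>) \<alpha> - ext_d A (pairing P \<alpha> \<beta>)"

definition concomitant :: "('m::topological_space, 'v::real_vector, 'z)
    lie_algebroid_data_scheme \<Rightarrow> ('m, 'v) bivector \<Rightarrow> ('m \<Rightarrow> 'v \<Rightarrow> 'v) \<Rightarrow>
    ('m, 'v) form \<Rightarrow> ('m, 'v) form \<Rightarrow> ('m, 'v) form" where
  "concomitant A P N \<alpha> \<beta> =
     (lie_endo A N (sharp_sec A P \<alpha>) \<beta> - lie_endo A N (sharp_sec A P \<beta>) \<alpha>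
        - d_endo A N (pairing P \<alpha> \<beta>))
     - (bracket_bivector A P (transp A N \<alpha>) \<beta> + bracket_bivector A P \<alpha> (transp A N \<beta>)
        - transp A N (bracket_bivector A P \<alpha> \<beta>))"

subsection \<open>The Schouten-Nijenhuis bracket of bivectors\<close>

definition wedge2 :: "'v \<Rightarrow> 'v \<Rightarrow> ('v list \<Rightarrow> real) \<Rightarrow> ('v list \<Rightarrow> real) \<Rightarrow> real" where
  "wedge2 u v a b = a [u] * b [v] - a [v] * b [u]"

definition wedge3 :: "'v \<Rightarrow> 'v \<Rightarrow> 'v \<Rightarrow>
    ('v list \<Rightarrow> real) \<Rightarrow> ('v list \<Rightarrow> real) \<Rightarrow> ('v list \<Rightarrow> real) \<Rightarrow> real" where
  "wedge3 u v w a b c = a [u] * wedge2 v w b c - a [v] * wedge2 u w b c + a [w] * wedge2 u v b c"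

text \<open>\<open>[X\<^sub>1 \<and> X\<^sub>2, Y\<^sub>1 \<and> Y\<^sub>2] = \<Sum> (-1)\<^sup>i\<^sup>+\<^sup>j [X\<^sub>i, Y\<^sub>j] \<and> X\<^sub>k \<and> Y\<^sub>l\<close>, where \<open>{i, k} = {j, l} = {1, 2}\<close>.\<close>

definition schouten_wedge :: "('m, 'v, 'z) lie_algebroid_data_scheme \<Rightarrow>
    ('m \<Rightarrow> 'v) \<Rightarrow> ('m \<Rightarrow> 'v) \<Rightarrow> ('m \<Rightarrow> 'v) \<Rightarrow> ('m \<Rightarrow> 'v) \<Rightarrow> ('m, 'v) trivector" where
  "schouten_wedge A X1 X2 Y1 Y2 x a b c =
       wedge3 (bracket A X1 Y1 x) (X2 x) (Y2 x) a b c
     - wedge3 (bracket A X1 Y2 x) (X2 x) (Y1 x) a b c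
     - wedge3 (bracket A X2 Y1 x) (X1 x) (Y2 x) a b c
     + wedge3 (bracket A X2 Y2 x) (X1 x) (Y1 x) a b c"

text \<open>The bracket is local and biadditive.  Every bivector field is, near each point, a finite sum of
  wedge products of global sections, and the resulting trivector does not depend on the choice of
  such a sum.\<close>

definition sum_of_wedges_on :: "('m::topological_space, 'v::real_vector, 'z) bundle_data_scheme \<Rightarrow>
    'm set \<Rightarrow> ('m, 'v) bivector \<Rightarrow> nat \<Rightarrow> (nat \<Rightarrow> 'm \<Rightarrow> 'v) \<Rightarrow> (nat \<Rightarrow> 'm \<Rightarrow> 'v) \<Rightarrow> bool" where
  "sum_of_wedges_on A U P n X Y \<longleftrightarrow>
     (\<forall>k<n. X k \<in> sections A \<and> Y k \<in> sections A) \<and>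
     (\<forall>x\<in>U. \<forall>a\<in>covectors (fibre A x). \<forall>b\<in>covectors (fibre A x).
        P x a b = (\<Sum>k<n. wedge2 (X k x) (Y k x) a b))"

definition has_schouten_bracket :: "('m::topological_space, 'v::real_vector, 'z)
    lie_algebroid_data_scheme \<Rightarrow> ('m, 'v) bivector \<Rightarrow> ('m, 'v) bivector \<Rightarrow>
    ('m, 'v) trivector \<Rightarrow> bool" where
  "has_schouten_bracket A P Q T \<longleftrightarrow>
     (\<forall>x. \<exists>U n X1 X2 m Y1 Y2. open U \<and> x \<in> U \<and>
        sum_of_wedges_on A U P n X1 X2 \<and> sum_of_wedges_on A U Q m Y1 Y2 \<and>
        (\<forall>y\<in>U. \<forall>a\<in>covectors (fibre A y). \<forall>b\<in>covectors (fibre A y). \<forall>c\<in>covectors (fibre A y).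
           T y a b c = (\<Sum>k<n. \<Sum>l<m. schouten_wedge A (X1 k) (X2 k) (Y1 l) (Y2 l) y a b c)))"

definition poisson_bivector :: "('m::topological_space, 'v::real_vector, 'z)
    lie_algebroid_data_scheme \<Rightarrow> ('m, 'v) bivector \<Rightarrow> bool" where
  "poisson_bivector A P \<longleftrightarrow> P \<in> bivector_fields A \<and> has_schouten_bracket A P P (\<lambda>_ _ _ _. 0)"

subsection \<open>Poisson quasi-Nijenhuis structures with background\<close>

definition cyclic_twist :: "('m, 'v, 'z) bundle_data_scheme \<Rightarrow> ('m, 'v) form \<Rightarrow>
    ('m \<Rightarrow> 'v \<Rightarrow> 'v) \<Rightarrow> ('m, 'v) form" where
  "cyclic_twist A H N = (\<lambda>x vs. case vs of
     [u, v, w] \<Rightarrow>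
       (if u \<in> fibre A x \<and> v \<in> fibre A x \<and> w \<in> fibre A x
        then H x [N x u, N x v, w] + H x [N x v, N x w, u] + H x [N x w, N x u, v] else 0)
   | _ \<Rightarrow> 0)"

text \<open>In the contraction of a form with a wedge of two sections, the second section is inserted
  first: \<open>(ins2 X Y H)(Z) = H(Y, X, Z)\<close>.\<close>

definition ins2 :: "('m \<Rightarrow> 'v) \<Rightarrow> ('m \<Rightarrow> 'v) \<Rightarrow> ('m, 'v) form \<Rightarrow> ('m, 'v) form" where
  "ins2 X Y \<eta> = ins X (ins Y \<eta>)"

definition poisson_quasi_nijenhuis_background :: "('m::topological_space, 'v::real_vector, 'z)
    lie_algebroid_data_scheme \<Rightarrow> ('m, 'v) bivector \<Rightarrow> ('m \<Rightarrow> 'v \<Rightarrow> 'v) \<Rightarrow>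
    ('m, 'v) form \<Rightarrow> ('m, 'v) form \<Rightarrow> bool" where
  "poisson_quasi_nijenhuis_background A P N \<psi> H \<longleftrightarrow>
     P \<in> bivector_fields A \<and> N \<in> endo_fields A \<and> \<psi> \<in> forms A 3 \<and> H \<in> forms A 3 \<and>
     (\<forall>x. \<forall>a\<in>covectors (fibre A x). N x (sharp A P x a) = sharp A P x (transp_at A N x a)) \<and>
     ext_d A \<psi> = 0 \<and> ext_d A H = 0 \<and>
     poisson_bivector A P \<and>
     (\<forall>\<alpha>\<in>forms A 1. \<forall>\<beta>\<in>forms A 1.
        concomitant A P N \<alpha> \<beta> =
          (\<lambda>x vs. - 2 * ins2 (sharp_sec A P \<alpha>) (sharp_sec A P \<beta>) H x vs)) \<and>
     (\<forall>X\<in>sections A. \<forall>Y\<in>sections A.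
        torsion A N X Y =
          sharp_sec A P (ins2 (on_sections N X) Y H - ins2 (on_sections N Y) X H + ins2 X Y \<psi>)) \<and>
     d_endo A N \<psi> = ext_d A (cyclic_twist A H N)"

end

theory Submission
  imports Defs
begin

text \<open>Write \<open>n\<close> for the action of \<open>N = \<pi>\<^sup>\<sharp> \<circ> \<omega>\<^sup>\<flat>\<close> on sections.  Since \<open>\<pi>\<^sup>\<sharp>\<close> and \<open>\<omega>\<^sup>\<flat>\<close> are both skew,
  \<open>\<omega>(nX, Y) = \<omega>(X, nY)\<close>.  Hence \<open>\<omega>\<^sub>1 = \<omega>(N\<cdot>, \<cdot>)\<close> and \<open>\<omega>\<^sub>2 = \<omega>(N\<cdot>, N\<cdot>)\<close> are 2-forms, the transpose of
  \<open>N\<close> is \<open>\<omega>\<^sup>\<flat> \<circ> \<pi>\<^sup>\<sharp>\<close>, and \<open>N\<close> is compatible with \<open>\<pi>\<close>.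

  What the Poisson condition contributes is a single identity (\<open>poisson_identity\<close>): for 1-forms
  \<open>\<alpha>, \<beta>, \<gamma>\<close>, the cyclic sum of \<open>\<pi>\<^sup>\<sharp>\<alpha> \<cdot> \<gamma>(\<pi>\<^sup>\<sharp>\<beta>)\<close> equals the cyclic sum of \<open>\<gamma>([\<pi>\<^sup>\<sharp>\<alpha>, \<pi>\<^sup>\<sharp>\<beta>])\<close>.  Each of the
  three structure equations becomes, after evaluation on sections and expansion of all differentials
  by the Koszul formula, this identity for suitable 1-forms:
  the torsion formula for \<open>\<omega>\<^sup>\<flat>X, \<omega>\<^sup>\<flat>Y, \<gamma>\<close> with \<open>\<gamma>\<close> arbitrary (\<open>torsion_formula\<close>),
  the formula for the concomitant for \<open>\<alpha>, \<beta>, \<omega>\<^sup>\<flat>Z\<close> (\<open>concomitant_formula\<close>),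
  and the equation \<open>d\<^sub>N \<psi> = d \<H>\<close> for \<open>\<omega>\<^sup>\<flat>X, \<omega>\<^sup>\<flat>Y, \<omega>\<^sup>\<flat>Z\<close> (\<open>background_cocycle\<close>).  In the last case the
  identity says that \<open>\<H> + i\<^sub>N \<psi> = d\<omega>\<^sub>2\<close>; applying \<open>d\<close> gives \<open>d \<H> = - d (i\<^sub>N \<psi>)\<close>, which is \<open>d\<^sub>N \<psi>\<close>
  because \<open>\<psi> = d\<omega>\<^sub>1\<close> is closed.

  Two analytic facts make it legitimate to argue with global sections.  Fibre vectors and covectors
  extend to global sections and 1-forms, and maps that are linear over the smooth functions depend
  only on the values of their arguments at the point (\<open>tensorial\<close>); so the differential, which is
  defined through arbitrary extensions, satisfies the Koszul formula on all sections.  Anchor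
  and bracket are local, so the Schouten bracket, which is given by decompositions of the bivector
  near each point, yields the global identity above (\<open>jac_schouten\<close> compares the two).  Both facts
  rest on bump functions.\<close>

section \<open>Differentiability on open subsets of coordinate space\<close>

text \<open>The partial derivatives at a point of an open set see only the values of the function on that set.\<close>

lemma line_stays_in_open:
  assumes "openin (Euclidean_space n) S" "x \<in> S" "i < n"
  shows "\<forall>\<^sub>F t in nhds (x i). x(i := t) \<in> S"
proof -
  have x0: "\<forall>j\<ge>n. x j = 0"
    using assms openin_subset[OF assms(1)] by (auto simp: topspace_Euclidean_space)
  have "continuous_map euclideanreal euclideanreal (\<lambda>t. (x(i := t)) j)" for j
    by (cases "j = i") simp_all
  then have "continuous_map euclideanreal (Euclidean_space n) (\<lambda>t. x(i := t))"
    unfolding Euclidean_space_def continuous_map_in_subtopology continuous_map_componentwise_UNIV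
    using x0 \<open>i < n\<close> by (simp add: image_subset_iff)
  from openin_continuous_map_preimage[OF this assms(1)] have "open {t. x(i := t) \<in> S}"
    by simp
  then show ?thesis
    using \<open>x \<in> S\<close> by (auto simp: eventually_nhds)
qed

lemma partial_cong:
  assumes "openin (Euclidean_space n) S" "\<And>y. y \<in> S \<Longrightarrow> f y = g y" "x \<in> S" "i < n"
  shows "partial i f x = partial i g x"
    and "(\<lambda>t. f (x(i := t))) differentiable at (x i) \<longleftrightarrow> (\<lambda>t. g (x(i := t))) differentiable at (x i)"
proof -
  have ev: "\<forall>\<^sub>F t in nhds (x i). f (x(i := t)) = g (x(i := t))"
    using line_stays_in_open[OF assms(1,3,4)] by eventually_elim (use assms(2) in blast)
  show "partial i f x = partial i g x"
    unfolding partial_def by (rule deriv_cong_ev[OF ev refl])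
  have "((\<lambda>t. f (x(i := t))) has_real_derivative D) (at (x i)) \<longleftrightarrow>
        ((\<lambda>t. g (x(i := t))) has_real_derivative D) (at (x i))" for D
    by (rule DERIV_cong_ev[OF refl ev refl])
  then show "(\<lambda>t. f (x(i := t))) differentiable at (x i) \<longleftrightarrow> (\<lambda>t. g (x(i := t))) differentiable at (x i)"
    by (simp add: real_differentiable_def)
qed

lemma Ck_on_cong:
  assumes "openin (Euclidean_space n) S" "\<And>y. y \<in> S \<Longrightarrow> f y = g y"
  shows "Ck_on n k S f \<longleftrightarrow> Ck_on n k S g"
  using assms(2)
proof (induction k arbitrary: f g)
  case 0
  then show ?case
    by (auto intro: continuous_map_eq)
next
  case (Suc k)
  have "Ck_on n k S (partial i f) \<longleftrightarrow> Ck_on n k S (partial i g)" if "i < n" for i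
    using partial_cong(1)[OF assms(1) Suc.prems _ that] by (intro Suc.IH) auto
  moreover have "continuous_map (subtopology (Euclidean_space n) S) euclideanreal f \<longleftrightarrow>
      continuous_map (subtopology (Euclidean_space n) S) euclideanreal g"
    using Suc.prems by (auto intro: continuous_map_eq)
  ultimately show ?case
    using partial_cong(2)[of n S f g, OF assms(1) Suc.prems] by auto
qed

lemma Ck_on_imp_continuous:
  "Ck_on n k S f \<Longrightarrow> continuous_map (subtopology (Euclidean_space n) S) euclideanreal f"
  by (cases k) auto

lemma Ck_on_Suc_imp: "Ck_on n (Suc k) S f \<Longrightarrow> Ck_on n k S f"
  by (induction k arbitrary: f) (auto)

lemma Ck_on_mono: "Ck_on n k S f \<Longrightarrow> T \<subseteq> S \<Longrightarrow> Ck_on n k T f"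
  by (induction k arbitrary: f) (auto intro: continuous_map_from_subtopology_mono)

lemma Ck_on_local:
  assumes "openin (Euclidean_space n) S"
    and "\<And>x. x \<in> S \<Longrightarrow> \<exists>T. openin (Euclidean_space n) T \<and> x \<in> T \<and> T \<subseteq> S \<and> Ck_on n k T f"
  shows "Ck_on n k S f"
  using assms(2)
proof (induction k arbitrary: f)
  case (0 f)
  show ?case
    unfolding Ck_on.simps
  proof (rule pasting_lemma[where I = "{T. openin (Euclidean_space n) T \<and> T \<subseteq> S \<and> Ck_on n 0 T f}"
        and T = id and f = "\<lambda>_. f"], goal_cases)
    case (1 T) then show ?case
      using assms(1) by (auto simp: openin_open_subtopology)
  next
    case (2 T) then show ?case
      by (auto simp: subtopology_subtopology Int_absorb1)
  next
    case (4 x) then show ?case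
      using 0 by fastforce
  qed auto
next
  case (Suc k)
  have "Ck_on n 0 S f"
  proof (rule Suc.IH[where f = f, THEN Ck_on_imp_continuous, unfolded Ck_on.simps(1)[symmetric]])
    fix x assume "x \<in> S"
    from Suc.prems[OF this] show "\<exists>T. openin (Euclidean_space n) T \<and> x \<in> T \<and> T \<subseteq> S \<and> Ck_on n k T f"
      using Ck_on_Suc_imp by blast
  qed
  moreover have "Ck_on n k S (partial i f)" if "i < n" for i
  proof (rule Suc.IH)
    fix x assume "x \<in> S"
    from Suc.prems[OF this] that
    show "\<exists>T. openin (Euclidean_space n) T \<and> x \<in> T \<and> T \<subseteq> S \<and> Ck_on n k T (partial i f)"
      by auto
  qed
  moreover have "(\<lambda>t. f (x(i := t))) differentiable at (x i)" if "i < n" "x \<in> S" for i x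
    using Suc.prems[OF that(2)] that(1) by auto
  ultimately show ?case by simp
qed

lemma Ck_on_const: "Ck_on n k S (\<lambda>_. c)"
proof (induction k arbitrary: c)
  case (Suc k)
  have "partial i (\<lambda>_. c) = (\<lambda>_. 0)" for i by (simp add: partial_def)
  then show ?case using Suc by simp
qed auto

lemma has_partial:
  assumes "Ck_on n (Suc k) S f" "x \<in> S" "i < n"
  shows "((\<lambda>t. f (x(i := t))) has_real_derivative partial i f x) (at (x i))"
  using assms by (auto simp: partial_def DERIV_deriv_iff_real_differentiable)

lemma Ck_on_add:
  assumes S: "openin (Euclidean_space n) S" and "Ck_on n k S f" "Ck_on n k S g"
  shows "Ck_on n k S (\<lambda>x. f x + g x)"
  using assms(2,3)
proof (induction k arbitrary: f g)
  case (Suc k)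
  have *: "((\<lambda>t. f (x(i := t)) + g (x(i := t))) has_real_derivative partial i f x + partial i g x) (at (x i))"
    if "x \<in> S" "i < n" for x i
    by (intro DERIV_add has_partial[OF Suc.prems(1) that] has_partial[OF Suc.prems(2) that])
  have "Ck_on n k S (partial i (\<lambda>x. f x + g x))" if "i < n" for i
  proof (subst Ck_on_cong[OF S])
    show "Ck_on n k S (\<lambda>x. partial i f x + partial i g x)"
      using Suc that by simp
    show "partial i (\<lambda>x. f x + g x) x = partial i f x + partial i g x" if "x \<in> S" for x
      using DERIV_imp_deriv[OF *[OF that \<open>i < n\<close>]] by (simp add: partial_def)
  qed
  moreover have "continuous_map (subtopology (Euclidean_space n) S) euclideanreal (\<lambda>x. f x + g x)"
    using Suc.prems by (intro continuous_map_add) auto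
  ultimately show ?case
    using * by (auto simp: real_differentiable_def)
qed (auto intro: continuous_map_add)

lemma Ck_on_mult:
  assumes S: "openin (Euclidean_space n) S" and "Ck_on n k S f" "Ck_on n k S g"
  shows "Ck_on n k S (\<lambda>x. f x * g x)"
  using assms(2,3)
proof (induction k arbitrary: f g)
  case (Suc k)
  have *: "((\<lambda>t. f (x(i := t)) * g (x(i := t))) has_real_derivative
      partial i f x * g x + f x * partial i g x) (at (x i))"
    if "x \<in> S" "i < n" for x i
    by (rule DERIV_cong[OF DERIV_mult'[OF has_partial[OF Suc.prems(1) that] has_partial[OF Suc.prems(2) that]]])
      simp
  have "Ck_on n k S (partial i (\<lambda>x. f x * g x))" if "i < n" for i
  proof (subst Ck_on_cong[OF S])
    show "Ck_on n k S (\<lambda>x. partial i f x * g x + f x * partial i g x)"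
      using Suc that Suc.prems[THEN Ck_on_Suc_imp] by (intro Ck_on_add[OF S] Suc.IH) auto
    show "partial i (\<lambda>x. f x * g x) x = partial i f x * g x + f x * partial i g x" if "x \<in> S" for x
      using DERIV_imp_deriv[OF *[OF that \<open>i < n\<close>]] by (simp add: partial_def)
  qed
  moreover have "continuous_map (subtopology (Euclidean_space n) S) euclideanreal (\<lambda>x. f x * g x)"
    using Suc.prems by (intro continuous_map_real_mult) auto
  ultimately show ?case
    using * by (auto simp: real_differentiable_def)
qed (auto intro: continuous_map_real_mult)

lemma Ck_on_prod:
  assumes S: "openin (Euclidean_space n) S" and "finite I" "\<And>i. i \<in> I \<Longrightarrow> Ck_on n k S (f i)"
  shows "Ck_on n k S (\<lambda>x. \<Prod>i\<in>I. f i x)"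
  using assms(2,3) by (induction I) (auto intro: Ck_on_mult[OF S] Ck_on_const)

text \<open>The flat functions \<open>t\<^sup>-\<^sup>k exp (-1/t)\<close>.  The span of the family is closed under differentiation, so
  the smoothness of all of its members follows by one induction on the order of differentiability.\<close>

definition flat_exp :: "nat \<Rightarrow> real \<Rightarrow> real" where
  "flat_exp k t = (if t > 0 then inverse t ^ k * exp (- inverse t) else 0)"

lemma flat_exp_deriv:
  "(flat_exp k has_real_derivative flat_exp (k + 2) t - real k * flat_exp (k + 1) t) (at t)"
proof -
  consider "t > 0" | "t < 0" | "t = 0" by linarith
  then show ?thesis
  proof cases
    case 1
    have "((\<lambda>t. inverse t ^ k * exp (- inverse t)) has_real_derivative
        flat_exp (k + 2) t - real k * flat_exp (k + 1) t) (at t)"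
      using 1 by (auto intro!: derivative_eq_intros simp: flat_exp_def algebra_simps power2_eq_square)
        (cases k; simp add: algebra_simps)
    then show ?thesis
      by (rule has_field_derivative_transform_within_open[of _ _ _ "{0<..}"])
        (use 1 in \<open>auto simp: flat_exp_def\<close>)
  next
    case 2
    have "((\<lambda>t. 0) has_real_derivative flat_exp (k + 2) t - real k * flat_exp (k + 1) t) (at t)"
      using 2 by (simp add: flat_exp_def)
    then show ?thesis
      by (rule has_field_derivative_transform_within_open[of _ _ _ "{..<0}"])
        (use 2 in \<open>auto simp: flat_exp_def\<close>)
  next
    case 3
    have "((\<lambda>u::real. u ^ (k+1) / exp u) \<longlongrightarrow> 0) at_top"
      by (rule tendsto_power_div_exp_0)
    then have "((\<lambda>t::real. inverse t ^ (k+1) / exp (inverse t)) \<longlongrightarrow> 0) (at_right 0)"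
      by (rule filterlim_compose[OF _ filterlim_inverse_at_top_right])
    then have "((\<lambda>t. (flat_exp k t - flat_exp k 0) / (t - 0)) \<longlongrightarrow> 0) (at_right 0)"
      by (rule Lim_transform_eventually)
        (auto intro!: eventually_at_rightI[of 0 1] simp: flat_exp_def exp_minus field_simps)
    moreover have "((\<lambda>t. (flat_exp k t - flat_exp k 0) / (t - 0)) \<longlongrightarrow> 0) (at_left 0)"
      by (rule Lim_transform_eventually[OF tendsto_const])
        (auto intro!: eventually_at_leftI[of "-1" 0] simp: flat_exp_def)
    ultimately have "((\<lambda>t. (flat_exp k t - flat_exp k 0) / (t - 0)) \<longlongrightarrow> 0) (at 0)"
      by (simp add: filterlim_at_split)
    then show ?thesis
      using 3 by (simp add: has_field_derivative_iff flat_exp_def)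
  qed
qed

text \<open>A bump function can be built as a product of functions of one coordinate each, so this case of the
  chain rule is the one that is used below.\<close>

lemma Ck_on_flat_exp:
  assumes S: "openin (Euclidean_space n) S" and "Ck_on n k S g"
  shows "Ck_on n k S (\<lambda>x. flat_exp m (g x))"
  using assms(2)
proof (induction k arbitrary: m)
  case 0
  have "continuous_on UNIV (flat_exp m)"
    by (intro DERIV_continuous_on) (use flat_exp_deriv in \<open>auto intro: has_field_derivative_at_within\<close>)
  then show ?case
    using continuous_map_compose[of _ euclideanreal g euclideanreal "flat_exp m"] 0
    by (auto simp: comp_def)
next
  case (Suc k)
  have g: "Ck_on n k S g" by (rule Ck_on_Suc_imp) fact
  let ?d = "\<lambda>x i. (flat_exp (m + 2) (g x) + (- real m) * flat_exp (m + 1) (g x)) * partial i g x"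
  have *: "((\<lambda>t. flat_exp m (g (x(i := t)))) has_real_derivative ?d x i) (at (x i))"
    if "x \<in> S" "i < n" for x i
    by (rule DERIV_cong[OF DERIV_chain2[OF flat_exp_deriv has_partial[OF Suc.prems that]]]) simp
  have "Ck_on n k S (partial i (\<lambda>x. flat_exp m (g x)))" if "i < n" for i
  proof (subst Ck_on_cong[OF S])
    show "Ck_on n k S (\<lambda>x. ?d x i)"
      using Suc that g by (intro Ck_on_add[OF S] Ck_on_mult[OF S] Ck_on_const Suc.IH) auto
    show "partial i (\<lambda>x. flat_exp m (g x)) x = ?d x i" if "x \<in> S" for x
      using DERIV_imp_deriv[OF *[OF that \<open>i < n\<close>]] by (simp add: partial_def)
  qed
  moreover have "Ck_on n 0 S (\<lambda>x. flat_exp m (g x))"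
    using Suc.IH[OF g, THEN Ck_on_imp_continuous] by simp
  ultimately show ?case
    using * by (auto simp: real_differentiable_def)
qed

section \<open>Smooth functions and bump functions on a manifold\<close>

lemma chart_inj:
  assumes "smooth_manifold M" "(U, \<phi>) \<in> charts M"
  shows "inj_on \<phi> U"
proof -
  have "homeomorphic_map (top_of_set U) (subtopology (Euclidean_space (mdim M)) (\<phi> ` U)) \<phi>"
    using assms by (auto simp: smooth_manifold_def)
  from homeomorphic_imp_injective_map[OF this] show ?thesis by simp
qed

lemma chart_open:
  "smooth_manifold M \<Longrightarrow> (U, \<phi>) \<in> charts M \<Longrightarrow> open U"
  by (auto simp: smooth_manifold_def)

lemma chart_cover:
  assumes "smooth_manifold M"
  obtains U \<phi> where "(U, \<phi>) \<in> charts M" "p \<in> U"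
proof -
  have "p \<in> (\<Union>(U, \<phi>)\<in>charts M. U)"
    using assms by (simp add: smooth_manifold_def)
  then show ?thesis using that by blast
qed

lemma chart_transition:
  assumes "smooth_manifold M" "(U, \<phi>) \<in> charts M" "(V, \<psi>) \<in> charts M" "i < mdim M"
  shows "Cinf_on (mdim M) (\<psi> ` (U \<inter> V)) (\<lambda>y. \<phi> (inv_into V \<psi> y) i)"
proof -
  have "\<forall>(U, \<phi>)\<in>charts M. \<forall>(V, \<psi>)\<in>charts M. \<forall>i<mdim M.
      Cinf_on (mdim M) (\<psi> ` (U \<inter> V)) (\<lambda>y. \<phi> (inv_into V \<psi> y) i)"
    using assms(1) unfolding smooth_manifold_def by blast
  from bspec[OF bspec[OF this assms(2), simplified] assms(3)] show ?thesis
    using assms(4) by simp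
qed

lemma chart_image_open:
  assumes "smooth_manifold M" "(U, \<phi>) \<in> charts M" "open W"
  shows "openin (Euclidean_space (mdim M)) (\<phi> ` (U \<inter> W))"
proof -
  have h: "homeomorphic_map (top_of_set U) (subtopology (Euclidean_space (mdim M)) (\<phi> ` U)) \<phi>"
    and o: "openin (Euclidean_space (mdim M)) (\<phi> ` U)"
    using assms(1,2) by (auto simp: smooth_manifold_def)
  have "openin (top_of_set U) (U \<inter> W)"
    using assms(3) by (simp add: openin_open_Int)
  then have "openin (subtopology (Euclidean_space (mdim M)) (\<phi> ` U)) (\<phi> ` (U \<inter> W))"
    using homeomorphic_map_openness_eq[OF h] by blast
  then show ?thesis
    using o openin_trans_full by blast
qed

lemma chart_inverse:
  assumes "smooth_manifold M" "(U, \<phi>) \<in> charts M" "y \<in> \<phi> ` (U \<inter> W)"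
  shows "inv_into U \<phi> y \<in> U \<inter> W"
  using assms chart_inj[OF assms(1,2)] by auto

text \<open>A chart is injective on its domain, so its inverse maps the image of \<open>W\<close> back into \<open>W\<close>.\<close>

lemma smooth_fun_on_cong:
  assumes "smooth_manifold M" "open W" "\<And>q. q \<in> W \<Longrightarrow> f q = g q"
  shows "smooth_fun_on M W f \<longleftrightarrow> smooth_fun_on M W g"
proof -
  have "Cinf_on (mdim M) (\<phi> ` (U \<inter> W)) (\<lambda>y. f (inv_into U \<phi> y)) \<longleftrightarrow>
    Cinf_on (mdim M) (\<phi> ` (U \<inter> W)) (\<lambda>y. g (inv_into U \<phi> y))" if "(U, \<phi>) \<in> charts M" for U \<phi>
    unfolding Cinf_on_def
    using chart_inverse[OF assms(1) that] assms(3)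
    by (intro all_cong1 Ck_on_cong chart_image_open[OF assms(1) that assms(2)]) auto
  then show ?thesis
    unfolding smooth_fun_on_def by auto
qed

lemma smooth_fun_on_const: "smooth_fun_on M W (\<lambda>_. c)"
  by (auto simp: smooth_fun_on_def Cinf_on_def intro: Ck_on_const)

lemma smooth_fun_on_add:
  assumes "smooth_manifold M" "open W" "smooth_fun_on M W f" "smooth_fun_on M W g"
  shows "smooth_fun_on M W (\<lambda>x. f x + g x)"
  using assms(3,4) unfolding smooth_fun_on_def Cinf_on_def
  by (auto intro!: Ck_on_add chart_image_open[OF assms(1) _ assms(2)])

lemma smooth_fun_on_mult:
  assumes "smooth_manifold M" "open W" "smooth_fun_on M W f" "smooth_fun_on M W g"
  shows "smooth_fun_on M W (\<lambda>x. f x * g x)"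
  using assms(3,4) unfolding smooth_fun_on_def Cinf_on_def
  by (auto intro!: Ck_on_mult chart_image_open[OF assms(1) _ assms(2)])

lemma smooth_fun_on_sum:
  assumes "smooth_manifold M" "open W" "\<And>i. i \<in> I \<Longrightarrow> smooth_fun_on M W (f i)"
  shows "smooth_fun_on M W (\<lambda>x. \<Sum>i\<in>I. f i x)"
  using assms(3)
  by (induction I rule: infinite_finite_induct)
    (auto intro: smooth_fun_on_add[OF assms(1,2)] smooth_fun_on_const)

lemma smooth_fun_on_mono:
  assumes "smooth_fun_on M W f" "T \<subseteq> W"
  shows "smooth_fun_on M T f"
  using assms unfolding smooth_fun_on_def Cinf_on_def
  by clarify (rule Ck_on_mono, auto)

lemma smooth_fun_on_local:
  assumes "smooth_manifold M" "open W"
    and "\<And>p. p \<in> W \<Longrightarrow> \<exists>T. open T \<and> p \<in> T \<and> smooth_fun_on M (T \<inter> W) f"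
  shows "smooth_fun_on M W f"
  unfolding smooth_fun_on_def Cinf_on_def
proof clarify
  fix U \<phi> k assume c: "(U, \<phi>) \<in> charts M"
  show "Ck_on (mdim M) k (\<phi> ` (U \<inter> W)) (\<lambda>y. f (inv_into U \<phi> y))"
  proof (rule Ck_on_local[OF chart_image_open[OF assms(1) c assms(2)]])
    fix y assume "y \<in> \<phi> ` (U \<inter> W)"
    then obtain q where q: "y = \<phi> q" "q \<in> U" "q \<in> W" by auto
    obtain T where T: "open T" "q \<in> T" "smooth_fun_on M (T \<inter> W) f"
      using assms(3)[OF q(3)] by auto
    show "\<exists>T. openin (Euclidean_space (mdim M)) T \<and> y \<in> T \<and> T \<subseteq> \<phi> ` (U \<inter> W) \<and>
        Ck_on (mdim M) k T (\<lambda>y. f (inv_into U \<phi> y))"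
      using T q c assms(2)
      by (intro exI[of _ "\<phi> ` (U \<inter> (T \<inter> W))"] conjI chart_image_open[OF assms(1) c])
        (auto simp: smooth_fun_on_def Cinf_on_def)
  qed
qed

lemma smooth_funs_local:
  assumes "smooth_manifold M" "\<And>p. \<exists>T. open T \<and> p \<in> T \<and> smooth_fun_on M T f"
  shows "f \<in> smooth_funs M"
  using smooth_fun_on_local[of M UNIV f] assms by (auto simp: smooth_funs_def)

lemma open_contains_box:
  assumes "openin (Euclidean_space n) S" "a \<in> S"
  obtains \<delta> :: real where "\<delta> > 0"
    "{x \<in> topspace (Euclidean_space n). \<forall>i<n. \<bar>x i - a i\<bar> \<le> \<delta>} \<subseteq> S"
proof -
  obtain V where V: "openin (powertop_real UNIV) V" "S = V \<inter> {x. \<forall>i\<ge>n. x i = 0}"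
    using assms(1) by (auto simp: Euclidean_space_def openin_subtopology)
  have a: "\<forall>i\<ge>n. a i = 0" and aV: "a \<in> V" using assms(2) V by auto
  obtain X where X: "a \<in> Pi\<^sub>E UNIV X" "\<And>i. open (X i)" "Pi\<^sub>E UNIV X \<subseteq> V"
    using product_topology_open_contains_basis[OF V(1) aV] by auto
  have "\<exists>e>0. cball (a i) e \<subseteq> X i" for i
    using X(1) X(2)[of i] open_contains_cball[of "X i"] by (auto simp: PiE_iff)
  then obtain e where e: "\<And>i. e i > 0" "\<And>i. cball (a i) (e i) \<subseteq> X i" by metis
  define \<delta> where "\<delta> = Min (insert 1 (e ` {..<n}))"
  have "\<delta> > 0" and \<delta>: "\<And>i. i < n \<Longrightarrow> \<delta> \<le> e i"
    using e(1) by (auto simp: \<delta>_def)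
  moreover have "x \<in> S" if x: "\<forall>i\<ge>n. x i = 0" "\<forall>i<n. \<bar>x i - a i\<bar> \<le> \<delta>" for x
  proof -
    have "x i \<in> X i" for i
    proof (cases "i < n")
      case True
      then have "x i \<in> cball (a i) (e i)"
        using x(2) \<delta>[of i] by (fastforce simp: dist_real_def abs_minus_commute)
      then show ?thesis using e(2) by blast
    next
      case False
      then show ?thesis using x(1) a X(1) by (metis PiE_mem UNIV_I not_le)
    qed
    then show ?thesis using X(3) V(2) x(1) by (auto simp: PiE_iff)
  qed
  ultimately show ?thesis
    by (intro that[of \<delta>]) (auto simp: topspace_Euclidean_space)
qed

text \<open>In a chart \<open>\<phi>\<close> with \<open>\<phi> p = a\<close>, the product over the coordinates of the flat functions of
  \<open>\<delta>\<^sup>2 - (y\<^sub>i - a\<^sub>i)\<^sup>2\<close> is smooth and vanishes off a closed box.  The box is compact and the manifold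
  is Hausdorff, so the part \<open>K\<close> of the manifold over the box is closed, and the extension by
  zero is smooth on the complement of \<open>K\<close> as well.\<close>

lemma bump_function:
  assumes M: "smooth_manifold M" and "open W" "p \<in> W"
  obtains \<rho> K where "\<rho> \<in> smooth_funs M" "closed K" "K \<subseteq> W" "\<And>q. q \<notin> K \<Longrightarrow> \<rho> q = 0" "\<rho> p = 1"
proof -
  let ?n = "mdim M"
  obtain U \<phi> where c: "(U, \<phi>) \<in> charts M" and "p \<in> U"
    using chart_cover[OF M] by blast
  have inj: "inj_on \<phi> U" by (rule chart_inj[OF M c])
  have "open U" by (rule chart_open[OF M c])
  have h: "homeomorphic_map (top_of_set U) (subtopology (Euclidean_space ?n) (\<phi> ` U)) \<phi>"
    using M c by (auto simp: smooth_manifold_def)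
  define a where "a = \<phi> p"
  obtain \<delta> where "\<delta> > 0"
    and \<delta>: "{x \<in> topspace (Euclidean_space ?n). \<forall>i<?n. \<bar>x i - a i\<bar> \<le> \<delta>} \<subseteq> \<phi> ` (U \<inter> W)"
    using open_contains_box[OF chart_image_open[OF M c \<open>open W\<close>], of a] \<open>p \<in> U\<close> \<open>p \<in> W\<close>
    by (auto simp: a_def)
  define B where "B = Pi\<^sub>E UNIV (\<lambda>i. if i < ?n then {a i - \<delta>..a i + \<delta>} else {0})"
  have B_iff: "x \<in> B \<longleftrightarrow> x \<in> topspace (Euclidean_space ?n) \<and> (\<forall>i<?n. \<bar>x i - a i\<bar> \<le> \<delta>)" for x
  proof -
    have "x \<in> B \<longleftrightarrow> (\<forall>i. (i < ?n \<longrightarrow> \<bar>x i - a i\<bar> \<le> \<delta>) \<and> (i \<ge> ?n \<longrightarrow> x i = 0))"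
    proof -
      have "x i \<in> (if i < ?n then {a i - \<delta>..a i + \<delta>} else {0}) \<longleftrightarrow>
          (i < ?n \<longrightarrow> \<bar>x i - a i\<bar> \<le> \<delta>) \<and> (i \<ge> ?n \<longrightarrow> x i = 0)" for i
        by (auto simp: abs_le_iff)
      then show ?thesis by (simp add: B_def PiE_iff)
    qed
    then show ?thesis by (auto simp: topspace_Euclidean_space)
  qed
  have B_sub: "B \<subseteq> \<phi> ` (U \<inter> W)" using \<delta> B_iff by blast
  have "compactin (powertop_real UNIV) B"
    unfolding B_def by (auto simp: compactin_PiE)
  moreover have "B \<subseteq> {x. \<forall>i\<ge>?n. x i = 0}"
    using B_iff by (auto simp: topspace_Euclidean_space)
  ultimately have "compactin (Euclidean_space ?n) B"
    by (simp add: Euclidean_space_def compactin_subtopology)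
  then have Bc: "compactin (subtopology (Euclidean_space ?n) (\<phi> ` U)) B"
    using B_sub by (auto simp: compactin_subtopology)
  define K where "K = {q \<in> U. \<phi> q \<in> B}"
  have "\<phi> ` K = B" using B_sub by (auto simp: K_def)
  then have "compactin (top_of_set U) K"
    using homeomorphic_map_compactness[OF h, of K] Bc by (auto simp: K_def)
  then have "compact K"
    by (auto simp: compactin_subtopology)
  then have "closed K" by (rule compact_imp_closed)
  have "K \<subseteq> W" using inj B_sub by (auto simp: K_def inj_on_def dest!: subsetD)
  define f where "f = (\<lambda>q. if q \<in> U then \<Prod>i<?n. flat_exp 0 (\<delta>\<^sup>2 + (-1) * ((\<phi> q i + - a i) * (\<phi> q i + - a i))) else 0)"
  have f0: "f q = 0" if "q \<notin> K" for q
  proof (cases "q \<in> U")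
    case True
    then have "\<phi> q \<in> topspace (Euclidean_space ?n)"
      using openin_subset[OF chart_image_open[OF M c open_UNIV]] by auto
    moreover have "\<phi> q \<notin> B"
      using that True by (simp add: K_def)
    ultimately obtain i where i: "i < ?n" "\<bar>\<phi> q i - a i\<bar> > \<delta>"
      using B_iff not_le by blast
    then have "(\<phi> q i - a i)\<^sup>2 > \<delta>\<^sup>2"
      using \<open>\<delta> > 0\<close> by (metis abs_of_pos power2_abs power_strict_mono less_imp_le zero_less_numeral)
    then have "flat_exp 0 (\<delta>\<^sup>2 + (-1) * ((\<phi> q i + - a i) * (\<phi> q i + - a i))) = 0"
      by (simp add: flat_exp_def power2_eq_square)
    then show ?thesis using i by (auto simp: f_def)
  qed (simp add: f_def)
  have "smooth_fun_on M U f"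
    unfolding smooth_fun_on_def Cinf_on_def
  proof clarify
    fix V \<psi> k assume d: "(V, \<psi>) \<in> charts M"
    note o = chart_image_open[OF M d \<open>open U\<close>]
    have t: "Ck_on ?n k (\<psi> ` (V \<inter> U)) (\<lambda>y. \<phi> (inv_into V \<psi> y) i)" if "i < ?n" for i
      using chart_transition[OF M c d that] by (simp add: Cinf_on_def Int_commute)
    show "Ck_on ?n k (\<psi> ` (V \<inter> U)) (\<lambda>y. f (inv_into V \<psi> y))"
    proof (subst Ck_on_cong[OF o])
      show "Ck_on ?n k (\<psi> ` (V \<inter> U)) (\<lambda>y. \<Prod>i<?n. flat_exp 0
          (\<delta>\<^sup>2 + (-1) * ((\<phi> (inv_into V \<psi> y) i + - a i) * (\<phi> (inv_into V \<psi> y) i + - a i))))"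
        by (intro Ck_on_prod[OF o] Ck_on_flat_exp[OF o] Ck_on_add[OF o] Ck_on_mult[OF o] Ck_on_const)
          (auto intro: t)
    qed (use chart_inverse[OF M d] in \<open>auto simp: f_def\<close>)
  qed
  moreover have "smooth_fun_on M (- K) f"
    using smooth_fun_on_cong[OF M, of "- K" f "\<lambda>_. 0"] \<open>closed K\<close> f0 smooth_fun_on_const[of M "- K" 0]
    by (auto simp: open_Compl)
  ultimately have f: "f \<in> smooth_funs M"
    using \<open>open U\<close> \<open>closed K\<close>
    by (intro smooth_funs_local[OF M]) (metis ComplI K_def mem_Collect_eq open_Compl)
  have fp: "f p \<noteq> 0"
    using \<open>p \<in> U\<close> \<open>\<delta> > 0\<close> by (simp add: f_def a_def flat_exp_def)
  show ?thesis
  proof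
    show "(\<lambda>q. inverse (f p) * f q) \<in> smooth_funs M"
      using f smooth_fun_on_mult[OF M open_UNIV smooth_fun_on_const] by (auto simp: smooth_funs_def)
    show "inverse (f p) * f p = 1" using fp by simp
    show "inverse (f p) * f q = 0" if "q \<notin> K" for q using f0[OF that] by simp
  qed fact+
qed

text \<open>On \<open>V\<close> the product is smooth near the points of \<open>W\<close> and zero off the closed set \<open>K \<subseteq> W\<close>.\<close>

lemma bump_times_local:
  assumes M: "smooth_manifold M" and "open W" "open V" "smooth_fun_on M (W \<inter> V) f" "\<rho> \<in> smooth_funs M"
    "closed K" "K \<subseteq> W" "\<And>q. q \<notin> K \<Longrightarrow> \<rho> q = 0"
  shows "smooth_fun_on M V (\<lambda>q. \<rho> q * f q)"
proof (rule smooth_fun_on_local[OF M \<open>open V\<close>])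
  fix p assume "p \<in> V"
  have "smooth_fun_on M (W \<inter> V) (\<lambda>q. \<rho> q * f q)"
    using assms(2-5) by (intro smooth_fun_on_mult[OF M])
      (auto simp: smooth_funs_def intro: smooth_fun_on_mono)
  moreover have "smooth_fun_on M (- K \<inter> V) (\<lambda>q. \<rho> q * f q)"
    using smooth_fun_on_cong[OF M, of "- K \<inter> V" "\<lambda>q. \<rho> q * f q" "\<lambda>_. 0"] assms(3,6,8)
      smooth_fun_on_const[of M "- K \<inter> V" 0] by (auto simp: open_Compl)
  ultimately show "\<exists>T. open T \<and> p \<in> T \<and> smooth_fun_on M (T \<inter> V) (\<lambda>q. \<rho> q * f q)"
    using assms(2,6,7) by (cases "p \<in> K") (auto simp: open_Compl)
qed

section \<open>Sections and covectors of a vector bundle\<close>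

lemma sum_apply: "(\<Sum>i\<in>I. f i) x = (\<Sum>i\<in>I. f i x)"
  for f :: "'i \<Rightarrow> 'a \<Rightarrow> 'b::comm_monoid_add"
  by (induction I rule: infinite_finite_induct) auto

lemma alt_forms_cases:
  "\<eta> \<in> alt_forms k V \<Longrightarrow> \<not> (length vs = k \<and> set vs \<subseteq> V) \<Longrightarrow> \<eta> vs = 0"
  by (auto simp: alt_forms_def)

lemma alt_forms_linear:
  assumes "\<eta> \<in> alt_forms k V" "length vs = k" "set vs \<subseteq> V" "i < k" "v \<in> V" "w \<in> V"
  shows "\<eta> (vs[i := a *\<^sub>R v + b *\<^sub>R w]) = a * \<eta> (vs[i := v]) + b * \<eta> (vs[i := w])"
  using assms unfolding alt_forms_def by blast

lemma covector_linear:
  assumes "a \<in> covectors V" "v \<in> V" "w \<in> V"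
  shows "a [s *\<^sub>R v + t *\<^sub>R w] = s * a [v] + t * a [w]"
  using alt_forms_linear[of a 1 V "[v]" 0 v w s t] assms by simp

lemma covectorI:
  assumes "\<And>vs. \<not> (length vs = 1 \<and> set vs \<subseteq> V) \<Longrightarrow> f vs = 0"
    and "\<And>v w s t. v \<in> V \<Longrightarrow> w \<in> V \<Longrightarrow> f [s *\<^sub>R v + t *\<^sub>R w] = s * f [v] + t * f [w]"
  shows "f \<in> covectors V"
  unfolding alt_forms_def
proof (intro CollectI conjI allI impI)
  fix vs :: "'a list" and i :: nat and v w a b
  assume "length vs = 1 \<and> set vs \<subseteq> V \<and> i < 1 \<and> v \<in> V \<and> w \<in> V"
  then show "f (vs[i := a *\<^sub>R v + b *\<^sub>R w]) = a * f (vs[i := v]) + b * f (vs[i := w])"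
    using assms(2) by (cases vs) auto
next
  fix vs :: "'a list"
  assume "length vs = 1 \<and> set vs \<subseteq> V \<and> \<not> distinct vs"
  then show "f vs = 0" by (cases vs) auto
qed (use assms(1) in blast)

lemma covector_sum:
  assumes "a \<in> covectors V" "subspace V" "finite I" "\<And>i. i \<in> I \<Longrightarrow> v i \<in> V"
  shows "a [\<Sum>i\<in>I. s i *\<^sub>R v i] = (\<Sum>i\<in>I. s i * a [v i])"
  using assms(3,4)
proof (induction I)
  case empty
  show ?case
    using covector_linear[OF assms(1) subspace_0[OF assms(2)] subspace_0[OF assms(2)], of 0 0] by simp
next
  case (insert j I)
  have "(\<Sum>i\<in>I. s i *\<^sub>R v i) \<in> V"
    using insert.prems by (intro subspace_sum[OF assms(2)] subspace_scale[OF assms(2)]) auto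
  then show ?case
    using covector_linear[OF assms(1), of "v j" "\<Sum>i\<in>I. s i *\<^sub>R v i" "s j" 1] insert by simp
qed

locale smooth_bundle =
  fixes A :: "('m::{t2_space,second_countable_topology}, 'v::real_vector, 'z) bundle_data_scheme"
  assumes vector_bundle: "vector_bundle A"
begin

lemma manifold: "smooth_manifold A"
  using vector_bundle by (simp add: vector_bundle_def)

lemma fibre_subspace: "subspace (fibre A x)"
  using vector_bundle by (simp add: vector_bundle_def)

lemma frame_cover:
  obtains U e where "(U, e) \<in> frames A" "p \<in> U"
proof -
  have "p \<in> (\<Union>(U, e)\<in>frames A. U)"
    using vector_bundle by (simp add: vector_bundle_def)
  then show ?thesis using that by blast
qed

lemma
  assumes "(U, e) \<in> frames A"
  shows frame_open: "open U"
    and frame_inj: "x \<in> U \<Longrightarrow> inj_on (\<lambda>i. e i x) {..<vrank A}"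
    and frame_independent: "x \<in> U \<Longrightarrow> independent ((\<lambda>i. e i x) ` {..<vrank A})"
    and frame_span: "x \<in> U \<Longrightarrow> span ((\<lambda>i. e i x) ` {..<vrank A}) = fibre A x"
proof -
  have "\<forall>(U, e)\<in>frames A. open U \<and>
        (\<forall>x\<in>U. inj_on (\<lambda>i. e i x) {..<vrank A} \<and> independent ((\<lambda>i. e i x) ` {..<vrank A}) \<and>
               span ((\<lambda>i. e i x) ` {..<vrank A}) = fibre A x)"
    using vector_bundle by (simp add: vector_bundle_def)
  note F = bspec[OF this assms, unfolded case_prod_conv]
  show "open U" using F by (rule conjunct1)
  note F' = F[THEN conjunct2, rule_format]
  show "x \<in> U \<Longrightarrow> inj_on (\<lambda>i. e i x) {..<vrank A}"
    and "x \<in> U \<Longrightarrow> independent ((\<lambda>i. e i x) ` {..<vrank A})"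
    and "x \<in> U \<Longrightarrow> span ((\<lambda>i. e i x) ` {..<vrank A}) = fibre A x"
    by (rule F'[THEN conjunct1] F'[THEN conjunct2, THEN conjunct1] F'[THEN conjunct2, THEN conjunct2];
        assumption)+
qed

lemma frame_in_fibre:
  assumes "(U, e) \<in> frames A" "x \<in> U" "i < vrank A"
  shows "e i x \<in> fibre A x"
  unfolding frame_span[OF assms(1,2), symmetric] using assms(3) by (intro span_base imageI) simp

lemma frame_transition:
  assumes "(U, e) \<in> frames A" "(V, e') \<in> frames A"
  obtains g where "\<And>i j. i < vrank A \<Longrightarrow> j < vrank A \<Longrightarrow> smooth_fun_on A (U \<inter> V) (g i j)"
    "\<And>x j. x \<in> U \<inter> V \<Longrightarrow> j < vrank A \<Longrightarrow> e' j x = (\<Sum>i<vrank A. g i j x *\<^sub>R e i x)"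
proof -
  have "\<forall>(U, e)\<in>frames A. \<forall>(V, e')\<in>frames A.
        \<exists>g. (\<forall>i<vrank A. \<forall>j<vrank A. smooth_fun_on A (U \<inter> V) (g i j)) \<and>
            (\<forall>x\<in>U \<inter> V. \<forall>j<vrank A. e' j x = (\<Sum>i<vrank A. g i j x *\<^sub>R e i x))"
    using vector_bundle by (simp add: vector_bundle_def)
  from bspec[OF bspec[OF this assms(1), unfolded case_prod_conv] assms(2), unfolded case_prod_conv]
  obtain g where g: "(\<forall>i<vrank A. \<forall>j<vrank A. smooth_fun_on A (U \<inter> V) (g i j)) \<and>
    (\<forall>x\<in>U \<inter> V. \<forall>j<vrank A. e' j x = (\<Sum>i<vrank A. g i j x *\<^sub>R e i x))" ..
  show ?thesis
  proof (rule that[of g])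
    show "smooth_fun_on A (U \<inter> V) (g i j)" if "i < vrank A" "j < vrank A" for i j
      using g[THEN conjunct1] that by blast
    show "e' j x = (\<Sum>i<vrank A. g i j x *\<^sub>R e i x)" if "x \<in> U \<inter> V" "j < vrank A" for x j
      by (rule g[THEN conjunct2, THEN bspec, THEN spec, THEN mp, OF that])
  qed
qed

text \<open>Defined from the basis of the single fibre over \<open>x\<close>, so that it is a linear function of \<open>v\<close>; its
  smooth dependence on \<open>x\<close> along a section is \<open>section_coeff_smooth\<close>.\<close>

definition frame_coeff :: "(nat \<Rightarrow> 'm \<Rightarrow> 'v) \<Rightarrow> 'm \<Rightarrow> 'v \<Rightarrow> nat \<Rightarrow> real" where
  "frame_coeff e x v i = representation ((\<lambda>i. e i x) ` {..<vrank A}) v (e i x)"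

lemma frame_coeff_unique:
  assumes "(U, e) \<in> frames A" "x \<in> U" "i < vrank A" "v = (\<Sum>j<vrank A. c j *\<^sub>R e j x)"
  shows "frame_coeff e x v i = c i"
proof -
  let ?B = "(\<lambda>i. e i x) ` {..<vrank A}"
  note ind = frame_independent[OF assms(1,2)]
  have b: "e j x \<in> ?B" if "j < vrank A" for j using that by blast
  have "frame_coeff e x v i = (\<Sum>j<vrank A. representation ?B (c j *\<^sub>R e j x) (e i x))"
    unfolding frame_coeff_def assms(4)
    by (subst representation_sum[OF ind]) (auto intro: span_scale span_base b)
  also have "\<dots> = (\<Sum>j<vrank A. c j * representation ?B (e j x) (e i x))"
    by (intro sum.cong refl, subst representation_scale[OF ind]) (auto intro: span_base b)
  also have "\<dots> = (\<Sum>j<vrank A. if j = i then c j else 0)"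
    using frame_inj[OF assms(1,2)] assms(3)
    by (intro sum.cong refl) (auto simp: representation_basis[OF ind b] inj_on_def)
  also have "\<dots> = c i" using assms(3) by simp
  finally show ?thesis .
qed

lemma frame_coeff_expand:
  assumes "(U, e) \<in> frames A" "x \<in> U" "v \<in> fibre A x"
  shows "v = (\<Sum>i<vrank A. frame_coeff e x v i *\<^sub>R e i x)"
proof -
  let ?B = "(\<lambda>i. e i x) ` {..<vrank A}"
  have "v = (\<Sum>b\<in>?B. representation ?B v b *\<^sub>R b)"
    using sum_representation_eq[OF frame_independent[OF assms(1,2)], of v ?B] assms(3)
      frame_span[OF assms(1,2)] by simp
  also have "\<dots> = (\<Sum>i<vrank A. frame_coeff e x v i *\<^sub>R e i x)"
    using frame_inj[OF assms(1,2)] by (simp add: sum.reindex frame_coeff_def)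
  finally show ?thesis .
qed

lemma frame_coeff_linear:
  assumes "(U, e) \<in> frames A" "x \<in> U" "v \<in> fibre A x" "w \<in> fibre A x"
  shows "frame_coeff e x (s *\<^sub>R v + t *\<^sub>R w) i = s * frame_coeff e x v i + t * frame_coeff e x w i"
  using assms(3,4) unfolding frame_coeff_def frame_span[OF assms(1,2), symmetric]
  by (simp add: representation_add representation_scale frame_independent[OF assms(1,2)] span_scale)

text \<open>The coefficients of a section in a frame are unique, so the smooth coefficients that exist by
  definition are those given by \<^const>\<open>frame_coeff\<close>.\<close>

lemma sections_iff:
  "X \<in> sections A \<longleftrightarrow> (\<forall>x. X x \<in> fibre A x) \<and>
     (\<forall>(U, e)\<in>frames A. \<forall>i<vrank A. smooth_fun_on A U (\<lambda>x. frame_coeff e x (X x) i))"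
proof (intro iffI conjI ballI)
  assume X: "X \<in> sections A"
  then show "\<forall>x. X x \<in> fibre A x" by (simp add: sections_def)
  fix F assume F: "F \<in> frames A"
  obtain U e where Ue: "F = (U, e)" by (cases F)
  have f: "(U, e) \<in> frames A" using F Ue by simp
  have "\<forall>(U, e)\<in>frames A. \<exists>c. (\<forall>i<vrank A. smooth_fun_on A U (c i)) \<and>
        (\<forall>x\<in>U. X x = (\<Sum>i<vrank A. c i x *\<^sub>R e i x))"
    using X by (simp add: sections_def)
  from bspec[OF this f] obtain c where c: "\<And>i. i < vrank A \<Longrightarrow> smooth_fun_on A U (c i)"
      "\<And>x. x \<in> U \<Longrightarrow> X x = (\<Sum>i<vrank A. c i x *\<^sub>R e i x)"
    by auto
  have "smooth_fun_on A U (\<lambda>x. frame_coeff e x (X x) i)" if "i < vrank A" for i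
    using smooth_fun_on_cong[OF manifold frame_open[OF f], of "\<lambda>x. frame_coeff e x (X x) i" "c i"]
      frame_coeff_unique[OF f _ that c(2)] c(1)[OF that] by simp
  then show "case F of (U, e) \<Rightarrow> \<forall>i<vrank A. smooth_fun_on A U (\<lambda>x. frame_coeff e x (X x) i)"
    by (simp add: Ue)
next
  assume X: "(\<forall>x. X x \<in> fibre A x) \<and>
     (\<forall>(U, e)\<in>frames A. \<forall>i<vrank A. smooth_fun_on A U (\<lambda>x. frame_coeff e x (X x) i))"
  have "\<exists>c. (\<forall>i<vrank A. smooth_fun_on A U (c i)) \<and> (\<forall>x\<in>U. X x = (\<Sum>i<vrank A. c i x *\<^sub>R e i x))"
    if "(U, e) \<in> frames A" for U e
    using X that frame_coeff_expand[OF that]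
    by (intro exI[of _ "\<lambda>i x. frame_coeff e x (X x) i"] conjI ballI) (blast, metis)
  then show "X \<in> sections A"
    using X unfolding sections_def by blast
qed

lemma section_fibre [simp]: "X \<in> sections A \<Longrightarrow> X x \<in> fibre A x"
  by (simp add: sections_iff)

lemma section_coeff_smooth:
  "X \<in> sections A \<Longrightarrow> (U, e) \<in> frames A \<Longrightarrow> i < vrank A \<Longrightarrow>
    smooth_fun_on A U (\<lambda>x. frame_coeff e x (X x) i)"
  by (auto simp: sections_iff)

lemma smooth_const [simp]: "(\<lambda>_. c) \<in> smooth_funs A"
  by (simp add: smooth_funs_def smooth_fun_on_const)

lemma smooth_zero [simp]: "0 \<in> smooth_funs A"
  unfolding zero_fun_def by simp

lemma smooth_add [simp]: "f \<in> smooth_funs A \<Longrightarrow> g \<in> smooth_funs A \<Longrightarrow> f + g \<in> smooth_funs A"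
  by (auto simp: smooth_funs_def plus_fun_def intro: smooth_fun_on_add[OF manifold])

lemma smooth_mult [simp]: "f \<in> smooth_funs A \<Longrightarrow> g \<in> smooth_funs A \<Longrightarrow> f * g \<in> smooth_funs A"
  by (auto simp: smooth_funs_def times_fun_def intro: smooth_fun_on_mult[OF manifold])

lemma smooth_minus [simp]: "f \<in> smooth_funs A \<Longrightarrow> - f \<in> smooth_funs A"
  using smooth_mult[OF smooth_const[of "-1"], of f] by (simp add: times_fun_def fun_Compl_def)

lemma smooth_diff [simp]: "f \<in> smooth_funs A \<Longrightarrow> g \<in> smooth_funs A \<Longrightarrow> f - g \<in> smooth_funs A"
  using smooth_add[OF _ smooth_minus] by (metis add_uminus_conv_diff)

lemma smooth_on_UNIV: "f \<in> smooth_funs A \<Longrightarrow> smooth_fun_on A U f"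
  by (auto simp: smooth_funs_def intro: smooth_fun_on_mono)

definition fscale :: "('m \<Rightarrow> real) \<Rightarrow> ('m \<Rightarrow> 'v) \<Rightarrow> 'm \<Rightarrow> 'v" where
  "fscale f X = (\<lambda>x. f x *\<^sub>R X x)"

lemma sections_fscale [simp]:
  assumes "f \<in> smooth_funs A" "X \<in> sections A"
  shows "fscale f X \<in> sections A"
  unfolding sections_iff fscale_def
proof (intro conjI allI ballI, goal_cases)
  case (1 x) show ?case using assms(2) by (simp add: subspace_scale[OF fibre_subspace])
next
  case (2 F)
  have "smooth_fun_on A U (\<lambda>x. frame_coeff e x (f x *\<^sub>R X x) i)"
    if F: "(U, e) \<in> frames A" and "i < vrank A" for U e i
  proof (subst smooth_fun_on_cong[OF manifold frame_open[OF F]])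
    show "smooth_fun_on A U (\<lambda>x. f x * frame_coeff e x (X x) i)"
      using assms that
      by (intro smooth_fun_on_mult[OF manifold frame_open[OF F]] smooth_on_UNIV section_coeff_smooth)
    show "frame_coeff e x (f x *\<^sub>R X x) i = f x * frame_coeff e x (X x) i" if "x \<in> U" for x
      using frame_coeff_linear[OF F that, of "X x" "X x" "f x" 0 i] assms(2) by simp
  qed
  then show ?case using 2 by (cases F) auto
qed

lemma sections_add [simp]:
  assumes "X \<in> sections A" "Y \<in> sections A"
  shows "X + Y \<in> sections A"
  unfolding sections_iff plus_fun_def
proof (intro conjI allI ballI, goal_cases)
  case (1 x) show ?case using assms by (simp add: subspace_add[OF fibre_subspace])
next
  case (2 F)
  have "smooth_fun_on A U (\<lambda>x. frame_coeff e x (X x + Y x) i)"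
    if F: "(U, e) \<in> frames A" and "i < vrank A" for U e i
  proof (subst smooth_fun_on_cong[OF manifold frame_open[OF F]])
    show "smooth_fun_on A U (\<lambda>x. frame_coeff e x (X x) i + frame_coeff e x (Y x) i)"
      using assms that
      by (intro smooth_fun_on_add[OF manifold frame_open[OF F]] section_coeff_smooth)
    show "frame_coeff e x (X x + Y x) i = frame_coeff e x (X x) i + frame_coeff e x (Y x) i"
      if "x \<in> U" for x
      using frame_coeff_linear[OF F that, of "X x" "Y x" 1 1 i] assms by simp
  qed
  then show ?case using 2 by (cases F) auto
qed

lemma sections_minus [simp]: "X \<in> sections A \<Longrightarrow> - X \<in> sections A"
  using sections_fscale[OF smooth_const[of "-1"], of X] by (simp add: fscale_def fun_Compl_def)

lemma sections_diff [simp]: "X \<in> sections A \<Longrightarrow> Y \<in> sections A \<Longrightarrow> X - Y \<in> sections A"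
  using sections_add[OF _ sections_minus] by (metis add_uminus_conv_diff)

lemma sections_zero [simp]: "0 \<in> sections A"
proof -
  have "(0::'m \<Rightarrow> 'v) x \<in> fibre A x" for x
    using subspace_0[OF fibre_subspace] by simp
  moreover have "smooth_fun_on A U (\<lambda>x. frame_coeff e x ((0::'m \<Rightarrow> 'v) x) i)"
    if F: "(U, e) \<in> frames A" and "i < vrank A" for U e i
  proof (subst smooth_fun_on_cong[OF manifold frame_open[OF F]])
    show "smooth_fun_on A U (\<lambda>x. 0)" by (rule smooth_fun_on_const)
    show "frame_coeff e x ((0::'m \<Rightarrow> 'v) x) i = 0" if "x \<in> U" for x
      using frame_coeff_unique[OF F that \<open>i < vrank A\<close>, of 0 "\<lambda>_. 0"] by simp
  qed
  ultimately show ?thesis unfolding sections_iff by blast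
qed

lemma sections_sum [simp]:
  "(\<And>i. i \<in> I \<Longrightarrow> X i \<in> sections A) \<Longrightarrow> (\<Sum>i\<in>I. X i) \<in> sections A"
  by (induction I rule: infinite_finite_induct) auto

lemma sections_local:
  assumes "\<And>x. X x \<in> fibre A x"
    and "\<And>p. \<exists>T Z. open T \<and> p \<in> T \<and> Z \<in> sections A \<and> (\<forall>q\<in>T. X q = Z q)"
  shows "X \<in> sections A"
proof -
  have "smooth_fun_on A U (\<lambda>x. frame_coeff e x (X x) i)"
    if F: "(U, e) \<in> frames A" and i: "i < vrank A" for U e i
  proof (rule smooth_fun_on_local[OF manifold frame_open[OF F]])
    fix p assume "p \<in> U"
    obtain T Z where T: "open T" "p \<in> T" "Z \<in> sections A" "\<And>q. q \<in> T \<Longrightarrow> X q = Z q"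
      using assms(2)[of p] by blast
    have "smooth_fun_on A (T \<inter> U) (\<lambda>x. frame_coeff e x (Z x) i)"
      using section_coeff_smooth[OF T(3) F i] by (rule smooth_fun_on_mono) auto
    then have "smooth_fun_on A (T \<inter> U) (\<lambda>x. frame_coeff e x (X x) i)"
      using smooth_fun_on_cong[OF manifold, of "T \<inter> U" "\<lambda>x. frame_coeff e x (X x) i"
          "\<lambda>x. frame_coeff e x (Z x) i"] T frame_open[OF F] by auto
    then show "\<exists>T. open T \<and> p \<in> T \<and> smooth_fun_on A (T \<inter> U) (\<lambda>x. frame_coeff e x (X x) i)"
      using T by blast
  qed
  then show ?thesis using assms(1) unfolding sections_iff by blast
qed

text \<open>The frame has arbitrary values off \<open>U\<close>, where the factor \<open>\<rho>\<close> vanishes.  In another frame over \<open>V\<close>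
  the coefficients are \<open>\<rho>\<close> times transition functions that are smooth on \<open>U \<inter> V\<close>.\<close>

lemma bump_frame_section:
  assumes F: "(U, e) \<in> frames A" and i: "i < vrank A"
    and \<rho>: "\<rho> \<in> smooth_funs A" "closed K" "K \<subseteq> U" "\<And>q. q \<notin> K \<Longrightarrow> \<rho> q = 0"
  shows "fscale \<rho> (e i) \<in> sections A"
  unfolding sections_iff
proof (intro conjI allI ballI, goal_cases)
  case (1 x) show ?case
    using frame_in_fibre[OF F _ i, of x] fibre_subspace[of x] \<rho>(3,4)
    by (cases "x \<in> K") (auto simp: fscale_def subspace_scale subspace_0)
next
  case (2 F')
  have "smooth_fun_on A V (\<lambda>x. frame_coeff e' x (fscale \<rho> (e i) x) j)"
    if F': "(V, e') \<in> frames A" and j: "j < vrank A" for V e' j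
  proof -
    obtain g where g: "\<And>i j. i < vrank A \<Longrightarrow> j < vrank A \<Longrightarrow> smooth_fun_on A (V \<inter> U) (g i j)"
      "\<And>x j. x \<in> V \<inter> U \<Longrightarrow> j < vrank A \<Longrightarrow> e j x = (\<Sum>i<vrank A. g i j x *\<^sub>R e' i x)"
      using frame_transition[OF F' F] by blast
    show ?thesis
    proof (subst smooth_fun_on_cong[OF manifold frame_open[OF F']])
      show "smooth_fun_on A V (\<lambda>x. \<rho> x * g j i x)"
        using g(1)[OF j i] frame_open[OF F] frame_open[OF F'] \<rho>
        by (intro bump_times_local[OF manifold, of U V _ _ K]) (auto simp: Int_commute)
      \<comment> \<open>off \<open>U\<close> the values of \<open>g\<close> are arbitrary, but \<open>\<rho>\<close> vanishes there\<close>
      show "frame_coeff e' x (fscale \<rho> (e i) x) j = \<rho> x * g j i x" if "x \<in> V" for x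
      proof (cases "x \<in> U")
        case True
        then show ?thesis
          using g(2)[OF _ i, of x] that
          by (intro frame_coeff_unique[OF F' that j])
            (simp add: fscale_def scaleR_sum_right)
      next
        case False
        then have "\<rho> x = 0" using \<rho> by auto
        then show ?thesis
          using frame_coeff_unique[OF F' that j, of 0 "\<lambda>_. 0"] by (simp add: fscale_def)
      qed
    qed
  qed
  then show ?case using 2 by (cases F') auto
qed

lemma section_through:
  assumes "v \<in> fibre A p"
  obtains X where "X \<in> sections A" "X p = v"
proof -
  obtain U e where F: "(U, e) \<in> frames A" "p \<in> U" by (rule frame_cover)
  obtain \<rho> K where \<rho>: "\<rho> \<in> smooth_funs A" "closed K" "K \<subseteq> U" "\<And>q. q \<notin> K \<Longrightarrow> \<rho> q = 0" "\<rho> p = 1"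
    using bump_function[OF manifold frame_open[OF F(1)] F(2)] by blast
  let ?X = "\<Sum>i<vrank A. fscale (\<lambda>_. frame_coeff e p v i) (fscale \<rho> (e i))"
  have "?X \<in> sections A"
    using bump_frame_section[OF F(1) _ \<rho>(1-4)]
    by (intro sections_sum, intro sections_fscale[OF smooth_const]) auto
  moreover have "?X p = v"
    using frame_coeff_expand[OF F assms] \<rho>(5) by (simp add: fscale_def sum_apply)
  ultimately show ?thesis using that by blast
qed

text \<open>If \<open>X = \<Sum> c\<^sub>i e\<^sub>i\<close> in a frame near \<open>p\<close> and \<open>\<rho>\<close> is a bump function at \<open>p\<close>, then
  \<open>\<rho>\<^sup>2 X = \<Sum> (\<rho> c\<^sub>i) (\<rho> e\<^sub>i)\<close> holds globally.\<close>

lemma vanishing_section_decomposition: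
  assumes X: "X \<in> sections A" "X p = 0"
  obtains \<rho> f E where "\<rho> \<in> smooth_funs A" "\<rho> p = 1"
    "\<forall>i<vrank A. f i \<in> smooth_funs A \<and> f i p = 0 \<and> E i \<in> sections A"
    "fscale \<rho> X = (\<Sum>i<vrank A. fscale (f i) (E i))"
proof -
  obtain U e where F: "(U, e) \<in> frames A" "p \<in> U" by (rule frame_cover)
  obtain \<rho> K where \<rho>: "\<rho> \<in> smooth_funs A" "closed K" "K \<subseteq> U" "\<And>q. q \<notin> K \<Longrightarrow> \<rho> q = 0" "\<rho> p = 1"
    using bump_function[OF manifold frame_open[OF F(1)] F(2)] by blast
  show ?thesis
  proof
    let ?f = "\<lambda>i q. \<rho> q * frame_coeff e q (X q) i" and ?E = "\<lambda>i. fscale \<rho> (e i)"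
    \<comment> \<open>one factor cuts off the coefficients, the other one the frame\<close>
    show "\<rho> * \<rho> \<in> smooth_funs A" using \<rho>(1) by simp
    show "(\<rho> * \<rho>) p = 1" using \<rho>(5) by simp
    have "?f i \<in> smooth_funs A" if "i < vrank A" for i
      using bump_times_local[OF manifold frame_open[OF F(1)] open_UNIV, of _ \<rho> K]
        section_coeff_smooth[OF X(1) F(1) that] \<rho> by (auto simp: smooth_funs_def)
    moreover have "?f i p = 0" if "i < vrank A" for i
      using frame_coeff_unique[OF F that, of 0 "\<lambda>_. 0"] X(2) by simp
    moreover have "?E i \<in> sections A" if "i < vrank A" for i
      by (rule bump_frame_section[OF F(1) that \<rho>(1-4)])
    ultimately show "\<forall>i<vrank A. ?f i \<in> smooth_funs A \<and> ?f i p = 0 \<and> ?E i \<in> sections A"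
      by simp
    have "fscale (\<rho> * \<rho>) X q = (\<Sum>i<vrank A. fscale (?f i) (?E i)) q" for q
    proof (cases "q \<in> U")
      case True
      have "fscale (\<rho> * \<rho>) X q = (\<rho> q * \<rho> q) *\<^sub>R (\<Sum>i<vrank A. frame_coeff e q (X q) i *\<^sub>R e i q)"
        using frame_coeff_expand[OF F(1) True, of "X q"] X(1) by (simp add: fscale_def)
      then show ?thesis by (simp add: fscale_def sum_apply scaleR_sum_right mult_ac)
    next
      case False
      then have "\<rho> q = 0" using \<rho>(3,4) by auto
      then show ?thesis by (simp add: fscale_def sum_apply)
    qed
    then show "fscale (\<rho> * \<rho>) X = (\<Sum>i<vrank A. fscale (?f i) (?E i))" by blast
  qed
qed

text \<open>By linearity \<open>X - Y\<close> vanishes at \<open>p\<close>.  Multiplication by a suitable function with value \<open>1\<close> at \<open>p\<close>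
  does not change the value of \<open>\<Phi>\<close> on \<open>X - Y\<close>, and makes it a combination of global sections whose
  coefficients vanish at \<open>p\<close>.\<close>

lemma tensorial:
  fixes \<Phi> :: "('m \<Rightarrow> 'v) \<Rightarrow> real"
  assumes add: "\<And>X Y. X \<in> sections A \<Longrightarrow> Y \<in> sections A \<Longrightarrow> \<Phi> (X + Y) = \<Phi> X + \<Phi> Y"
    and fscale: "\<And>f X. f \<in> smooth_funs A \<Longrightarrow> X \<in> sections A \<Longrightarrow> \<Phi> (fscale f X) = f p * \<Phi> X"
    and X: "X \<in> sections A" "Y \<in> sections A" "X p = Y p"
  shows "\<Phi> X = \<Phi> Y"
proof -
  have zero: "\<Phi> 0 = 0" using add[of 0 0] by simp
  have sum: "\<Phi> (\<Sum>i\<in>I. E i) = (\<Sum>i\<in>I. \<Phi> (E i))" if "finite I" "\<And>i. i \<in> I \<Longrightarrow> E i \<in> sections A"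
    for I :: "nat set" and E
    using that by (induction I) (auto simp: zero add)
  have "X - Y \<in> sections A" "(X - Y) p = 0" using X by auto
  then obtain \<rho> f E where *: "\<rho> \<in> smooth_funs A" "\<rho> p = 1"
    "\<forall>i<vrank A. f i \<in> smooth_funs A \<and> f i p = 0 \<and> E i \<in> sections A"
    "fscale \<rho> (X - Y) = (\<Sum>i<vrank A. fscale (f i) (E i))"
    by (rule vanishing_section_decomposition)
  have "\<Phi> (X - Y) = \<Phi> (fscale \<rho> (X - Y))"
    using fscale[OF *(1) \<open>X - Y \<in> sections A\<close>] *(2) by simp
  also have "\<dots> = (\<Sum>i<vrank A. \<Phi> (fscale (f i) (E i)))"
    unfolding *(4) using * by (intro sum) auto
  also have "\<dots> = 0" using * by (intro sum.neutral) (auto simp: fscale)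
  finally show ?thesis using add[OF \<open>X - Y \<in> sections A\<close> X(2)] by simp
qed

text \<open>The frame coefficients of a vector at a point are the values of covectors.\<close>

lemma covectors_separate:
  assumes "v \<in> fibre A p" "w \<in> fibre A p" "\<And>b. b \<in> covectors (fibre A p) \<Longrightarrow> b [v] = b [w]"
  shows "v = w"
proof -
  obtain U e where F: "(U, e) \<in> frames A" "p \<in> U" by (rule frame_cover)
  have "frame_coeff e p v i = frame_coeff e p w i" for i
  proof -
    define b where "b = (\<lambda>vs. if length vs = 1 \<and> set vs \<subseteq> fibre A p then frame_coeff e p (hd vs) i else 0)"
    have "b \<in> covectors (fibre A p)"
      using fibre_subspace[of p]
      by (intro covectorI) (auto simp: b_def frame_coeff_linear[OF F] subspace_add subspace_scale)
    from assms(3)[OF this] show ?thesis using assms(1,2) by (simp add: b_def)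
  qed
  then show ?thesis
    using frame_coeff_expand[OF F assms(1)] frame_coeff_expand[OF F assms(2)] by simp
qed

lemma forms_1I:
  assumes "\<And>x. \<alpha> x \<in> covectors (fibre A x)"
    and "\<And>X. X \<in> sections A \<Longrightarrow> (\<lambda>x. \<alpha> x [X x]) \<in> smooth_funs A"
  shows "\<alpha> \<in> forms A 1"
proof -
  have "(\<lambda>x. \<alpha> x (map (\<lambda>X. X x) Xs)) \<in> smooth_funs A" if "length Xs = 1" "set Xs \<subseteq> sections A" for Xs
    using that assms(2) by (cases Xs) auto
  then show ?thesis using assms(1) by (simp add: forms_def)
qed

text \<open>Combine the covectors dual to a frame with constant coefficients, and cut off with a bump function.\<close>

lemma form_through:
  assumes c: "c \<in> covectors (fibre A p)"
  obtains \<gamma> where "\<gamma> \<in> forms A 1" "\<gamma> p = c"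
proof -
  obtain U e where F: "(U, e) \<in> frames A" "p \<in> U" by (rule frame_cover)
  obtain \<rho> K where \<rho>: "\<rho> \<in> smooth_funs A" "closed K" "K \<subseteq> U" "\<And>q. q \<notin> K \<Longrightarrow> \<rho> q = 0" "\<rho> p = 1"
    using bump_function[OF manifold frame_open[OF F(1)] F(2)] by blast
  define \<gamma> where "\<gamma> = (\<lambda>y vs. if length vs = 1 \<and> set vs \<subseteq> fibre A y
    then \<rho> y * (\<Sum>i<vrank A. c [e i p] * frame_coeff e y (hd vs) i) else 0)"
  have cov: "\<gamma> y \<in> covectors (fibre A y)" for y
  proof (rule covectorI)
    fix v w s t assume vw: "v \<in> fibre A y" "w \<in> fibre A y"
    then have m: "s *\<^sub>R v + t *\<^sub>R w \<in> fibre A y"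
      using fibre_subspace[of y] by (simp add: subspace_add subspace_scale)
    show "\<gamma> y [s *\<^sub>R v + t *\<^sub>R w] = s * \<gamma> y [v] + t * \<gamma> y [w]"
    proof (cases "y \<in> U")
      case True
      then show ?thesis
        using vw m by (simp add: \<gamma>_def frame_coeff_linear[OF F(1)] sum.distrib sum_distrib_left algebra_simps)
    next
      case False
      then have "\<rho> y = 0" using \<rho>(3,4) by auto
      then show ?thesis by (simp add: \<gamma>_def)
    qed
  qed (auto simp: \<gamma>_def)
  moreover have "(\<lambda>x. \<gamma> x [X x]) \<in> smooth_funs A" if X: "X \<in> sections A" for X
  proof -
    have "smooth_fun_on A U (\<lambda>y. \<Sum>i<vrank A. c [e i p] * frame_coeff e y (X y) i)"
      using section_coeff_smooth[OF X F(1)]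
      by (intro smooth_fun_on_sum[OF manifold] smooth_fun_on_mult[OF manifold] frame_open[OF F(1)]
          smooth_fun_on_const) auto
    then show ?thesis
      using bump_times_local[OF manifold frame_open[OF F(1)] open_UNIV _ \<rho>(1-4)] X
      by (simp add: smooth_funs_def \<gamma>_def)
  qed
  ultimately have "\<gamma> \<in> forms A 1" by (rule forms_1I)
  moreover have "\<gamma> p = c"
  proof
    fix vs
    show "\<gamma> p vs = c vs"
    proof (cases "length vs = 1 \<and> set vs \<subseteq> fibre A p")
      case True
      then obtain v where v: "vs = [v]" "v \<in> fibre A p" by (cases vs) auto
      have "c [v] = c [\<Sum>i<vrank A. frame_coeff e p v i *\<^sub>R e i p]"
        using frame_coeff_expand[OF F v(2)] by simp
      also have "\<dots> = (\<Sum>i<vrank A. frame_coeff e p v i * c [e i p])"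
        using frame_in_fibre[OF F] by (intro covector_sum[OF c fibre_subspace]) auto
      finally show ?thesis using v \<rho>(5) by (simp add: \<gamma>_def mult_ac)
    qed (use alt_forms_cases[OF c] in \<open>auto simp: \<gamma>_def\<close>)
  qed
  ultimately show ?thesis using that by blast
qed

end

section \<open>Alternating forms on a vector bundle\<close>

text \<open>Covectors and 1-forms are written with the degree \<open>1\<close>; rewriting it to \<open>Suc 0\<close> would prevent
  the rules about them from matching.\<close>
declare One_nat_def [simp del]

definition ev1 :: "('m, 'v) form \<Rightarrow> ('m \<Rightarrow> 'v) \<Rightarrow> 'm \<Rightarrow> real" where
  "ev1 \<alpha> X = (\<lambda>x. \<alpha> x [X x])"

definition ev2 :: "('m, 'v) form \<Rightarrow> ('m \<Rightarrow> 'v) \<Rightarrow> ('m \<Rightarrow> 'v) \<Rightarrow> 'm \<Rightarrow> real" where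
  "ev2 \<omega> X Y = (\<lambda>x. \<omega> x [X x, Y x])"

definition ev3 :: "('m, 'v) form \<Rightarrow> ('m \<Rightarrow> 'v) \<Rightarrow> ('m \<Rightarrow> 'v) \<Rightarrow> ('m \<Rightarrow> 'v) \<Rightarrow> 'm \<Rightarrow> real" where
  "ev3 \<eta> X Y Z = (\<lambda>x. \<eta> x [X x, Y x, Z x])"

lemma length_2_cases: "length xs = 2 \<longleftrightarrow> (\<exists>a b. xs = [a, b])"
  by (auto simp: numeral_2_eq_2 length_Suc_conv)

lemma length_3_cases: "length xs = 3 \<longleftrightarrow> (\<exists>a b c. xs = [a, b, c])"
  by (auto simp: numeral_3_eq_3 length_Suc_conv)

lemma alt_form_2_linear:
  assumes "\<eta> \<in> alt_forms 2 V" "v \<in> V" "w \<in> V" "u \<in> V"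
  shows "\<eta> [s *\<^sub>R v + t *\<^sub>R w, u] = s * \<eta> [v, u] + t * \<eta> [w, u]"
    and "\<eta> [u, s *\<^sub>R v + t *\<^sub>R w] = s * \<eta> [u, v] + t * \<eta> [u, w]"
  using alt_forms_linear[OF assms(1), of "[v, u]" 0 v w s t] alt_forms_linear[OF assms(1), of "[u, v]" 1 v w s t] assms
  by (auto simp: One_nat_def)

lemma alt_form_2_swap:
  assumes \<eta>: "\<eta> \<in> alt_forms 2 V" and V: "subspace V" "v \<in> V" "w \<in> V"
  shows "\<eta> [w, v] = - \<eta> [v, w]"
proof -
  have alt: "\<eta> [u, u] = 0" if "u \<in> V" for u
    using \<eta> that unfolding alt_forms_def by auto
  have s: "v + w \<in> V" using V by (simp add: subspace_add)
  have "0 = \<eta> [v + w, v + w]" using alt[OF s] by simp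
  also have "\<dots> = \<eta> [v, w] + \<eta> [w, v]"
    using alt_form_2_linear[OF \<eta>, of v w "v + w" 1 1] alt_form_2_linear(2)[OF \<eta>, of v w v 1 1]
      alt_form_2_linear(2)[OF \<eta>, of v w w 1 1] alt V s by simp
  finally show ?thesis by simp
qed

lemma alt_form_2I:
  assumes "subspace V" "\<And>vs. \<not> (length vs = 2 \<and> set vs \<subseteq> V) \<Longrightarrow> f vs = 0"
    and lin: "\<And>v w u s t. v \<in> V \<Longrightarrow> w \<in> V \<Longrightarrow> u \<in> V \<Longrightarrow> f [s *\<^sub>R v + t *\<^sub>R w, u] = s * f [v, u] + t * f [w, u]"
    and swap: "\<And>v w. v \<in> V \<Longrightarrow> w \<in> V \<Longrightarrow> f [w, v] = - f [v, w]"
  shows "f \<in> alt_forms 2 V"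
  unfolding alt_forms_def
proof (intro CollectI conjI allI impI)
  fix vs and i :: nat and v w a b
  assume h: "length vs = 2 \<and> set vs \<subseteq> V \<and> i < 2 \<and> v \<in> V \<and> w \<in> V"
  then have m: "a *\<^sub>R v + b *\<^sub>R w \<in> V"
    using assms(1) by (simp add: subspace_add subspace_scale)
  obtain x y where vs: "vs = [x, y]" "x \<in> V" "y \<in> V" using h by (auto simp: length_2_cases)
  have "f [x, a *\<^sub>R v + b *\<^sub>R w] = a * f [x, v] + b * f [x, w]"
    using swap[OF m vs(2)] swap[of v x] swap[of w x] lin[of v w x a b] h vs by simp
  moreover have "i = 0 \<or> i = 1" using h by auto
  ultimately show "f (vs[i := a *\<^sub>R v + b *\<^sub>R w]) = a * f (vs[i := v]) + b * f (vs[i := w])"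
    using lin[of v w y a b] h vs by (auto simp: One_nat_def)
next
  fix vs assume h: "length vs = 2 \<and> set vs \<subseteq> V \<and> \<not> distinct vs"
  then obtain x where "vs = [x, x]" "x \<in> V" by (auto simp: length_2_cases)
  then show "f vs = 0" using swap[of x x] by simp
qed (use assms(2) in blast)

lemma alt_form_3I:
  assumes "subspace V" "\<And>vs. \<not> (length vs = 3 \<and> set vs \<subseteq> V) \<Longrightarrow> f vs = 0"
    and lin: "\<And>v w y z s t. v \<in> V \<Longrightarrow> w \<in> V \<Longrightarrow> y \<in> V \<Longrightarrow> z \<in> V \<Longrightarrow>
      f [s *\<^sub>R v + t *\<^sub>R w, y, z] = s * f [v, y, z] + t * f [w, y, z]"
    and swap12: "\<And>u v w. u \<in> V \<Longrightarrow> v \<in> V \<Longrightarrow> w \<in> V \<Longrightarrow> f [v, u, w] = - f [u, v, w]"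
    and swap23: "\<And>u v w. u \<in> V \<Longrightarrow> v \<in> V \<Longrightarrow> w \<in> V \<Longrightarrow> f [u, w, v] = - f [u, v, w]"
  shows "f \<in> alt_forms 3 V"
  unfolding alt_forms_def
proof (intro CollectI conjI allI impI)
  fix vs and i :: nat and v w a b
  assume h: "length vs = 3 \<and> set vs \<subseteq> V \<and> i < 3 \<and> v \<in> V \<and> w \<in> V"
  then have m: "a *\<^sub>R v + b *\<^sub>R w \<in> V"
    using assms(1) by (simp add: subspace_add subspace_scale)
  obtain x y z where vs: "vs = [x, y, z]" "x \<in> V" "y \<in> V" "z \<in> V"
    using h by (auto simp: length_3_cases)
  have 2: "f [x, a *\<^sub>R v + b *\<^sub>R w, z] = a * f [x, v, z] + b * f [x, w, z]"
    if "x \<in> V" "z \<in> V" for x z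
    using swap12[OF m that] swap12[OF _ that, of v] swap12[OF _ that, of w] lin[OF _ _ that, of v w a b] h
    by simp
  then have "f [x, y, a *\<^sub>R v + b *\<^sub>R w] = a * f [x, y, v] + b * f [x, y, w]"
    using swap23[OF vs(2) m vs(3)] swap23[OF vs(2) _ vs(3), of v] swap23[OF vs(2) _ vs(3), of w] h vs
    by simp
  moreover have "i = 0 \<or> i = 1 \<or> i = 2" using h by auto
  ultimately show "f (vs[i := a *\<^sub>R v + b *\<^sub>R w]) = a * f (vs[i := v]) + b * f (vs[i := w])"
    using lin[of v w y z a b] 2 h vs by (auto simp: One_nat_def numeral_2_eq_2)
next
  fix vs assume h: "length vs = 3 \<and> set vs \<subseteq> V \<and> \<not> distinct vs"
  then obtain x y z where vs: "vs = [x, y, z]" "x \<in> V" "y \<in> V" "z \<in> V" "x = y \<or> y = z \<or> x = z"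
    by (auto simp: length_3_cases)
  have 1: "f [u, u, v] = 0" if "u \<in> V" "v \<in> V" for u v using swap12[of u u v] that by simp
  have "f [x, y, y] = 0" using swap23[of x y y] vs by simp
  moreover have "f [x, y, x] = 0" using swap23[of x x y] 1[of x y] vs by simp
  ultimately show "f vs = 0" using 1[of x z] vs by auto
qed (use assms(2) in blast)

lemma alt_forms_add:
  assumes "\<eta> \<in> alt_forms k V" "\<theta> \<in> alt_forms k V"
  shows "\<eta> + \<theta> \<in> alt_forms k V"
  using assms unfolding alt_forms_def by (auto simp: algebra_simps)

context smooth_bundle
begin

lemma fscale_apply [simp]: "fscale f X x = f x *\<^sub>R X x"
  by (simp add: fscale_def)

text \<open>What remains of being a form when only the vanishing on meaningless arguments is kept.  Together
  with the values on global sections it determines the function, and unlike multilinearity it is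
  visibly preserved by all operations of the calculus.\<close>

definition supported :: "nat \<Rightarrow> ('m, 'v) form \<Rightarrow> bool" where
  "supported k \<eta> \<longleftrightarrow> (\<forall>x vs. \<not> (length vs = k \<and> set vs \<subseteq> fibre A x) \<longrightarrow> \<eta> x vs = 0)"

lemma forms_supported: "\<eta> \<in> forms A k \<Longrightarrow> supported k \<eta>"
  unfolding supported_def forms_def by (auto intro: alt_forms_cases)

lemma supportedD: "supported k \<eta> \<Longrightarrow> \<not> (length vs = k \<and> set vs \<subseteq> fibre A x) \<Longrightarrow> \<eta> x vs = 0"
  unfolding supported_def by blast

lemma supported_combine:
  "supported k \<eta> \<Longrightarrow> supported k \<theta> \<Longrightarrow> supported k (\<eta> + \<theta>)"
  "supported k \<eta> \<Longrightarrow> supported k \<theta> \<Longrightarrow> supported k (\<eta> - \<theta>)"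
  "supported k \<eta> \<Longrightarrow> supported k (- \<eta>)"
  unfolding supported_def by auto

lemma supported_ins:
  assumes "supported (Suc k) \<eta>" "X \<in> sections A"
  shows "supported k (ins X \<eta>)"
  using assms(1) unfolding supported_def ins_def by auto

text \<open>Every list of fibre vectors is the list of values of global sections.\<close>

lemma supported_ext_1:
  assumes "supported 1 \<eta>" "supported 1 \<theta>" "\<And>X. X \<in> sections A \<Longrightarrow> ev1 \<eta> X = ev1 \<theta> X"
  shows "\<eta> = \<theta>"
proof (intro ext)
  fix x vs
  show "\<eta> x vs = \<theta> x vs"
  proof (cases "length vs = 1 \<and> set vs \<subseteq> fibre A x")
    case True
    then obtain v where v: "vs = [v]" "v \<in> fibre A x" by (cases vs) (auto simp: One_nat_def)
    obtain X where "X \<in> sections A" "X x = v" using section_through[OF v(2)] by blast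
    then show ?thesis using fun_cong[OF assms(3), of X x] v by (simp add: ev1_def)
  qed (use assms(1,2)[THEN supportedD] in simp)
qed

lemma supported_ext_3:
  assumes "supported 3 \<eta>" "supported 3 \<theta>"
    and "\<And>X Y Z. X \<in> sections A \<Longrightarrow> Y \<in> sections A \<Longrightarrow> Z \<in> sections A \<Longrightarrow> ev3 \<eta> X Y Z = ev3 \<theta> X Y Z"
  shows "\<eta> = \<theta>"
proof (intro ext)
  fix x vs
  show "\<eta> x vs = \<theta> x vs"
  proof (cases "length vs = 3 \<and> set vs \<subseteq> fibre A x")
    case True
    then obtain u v w where v: "vs = [u, v, w]" "u \<in> fibre A x" "v \<in> fibre A x" "w \<in> fibre A x"
      by (auto simp: length_3_cases)
    obtain X Y Z where "X \<in> sections A" "X x = u" "Y \<in> sections A" "Y x = v" "Z \<in> sections A" "Z x = w"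
      using v(2-4)[THEN section_through] by metis
    then show ?thesis using fun_cong[OF assms(3), of X Y Z x] v by (simp add: ev3_def)
  qed (use assms(1,2)[THEN supportedD] in simp)
qed

lemma form_at: "\<eta> \<in> forms A k \<Longrightarrow> \<eta> x \<in> alt_forms k (fibre A x)"
  by (simp add: forms_def)

lemma ev1_smooth [simp]: "\<alpha> \<in> forms A 1 \<Longrightarrow> X \<in> sections A \<Longrightarrow> ev1 \<alpha> X \<in> smooth_funs A"
  by (auto simp: forms_def ev1_def One_nat_def dest!: conjunct2 spec[of _ "[X]"])

lemma ev2_smooth [simp]:
  "\<omega> \<in> forms A 2 \<Longrightarrow> X \<in> sections A \<Longrightarrow> Y \<in> sections A \<Longrightarrow> ev2 \<omega> X Y \<in> smooth_funs A"
  by (auto simp: forms_def ev2_def dest!: conjunct2 spec[of _ "[X, Y]"])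

lemma ev3_smooth [simp]:
  "\<eta> \<in> forms A 3 \<Longrightarrow> X \<in> sections A \<Longrightarrow> Y \<in> sections A \<Longrightarrow> Z \<in> sections A \<Longrightarrow>
    ev3 \<eta> X Y Z \<in> smooth_funs A"
  by (auto simp: forms_def ev3_def dest!: conjunct2 spec[of _ "[X, Y, Z]"])

lemma ev1_linear [simp]:
  assumes "\<alpha> \<in> forms A 1" "X \<in> sections A"
  shows "Y \<in> sections A \<Longrightarrow> ev1 \<alpha> (X + Y) = ev1 \<alpha> X + ev1 \<alpha> Y"
    and "Y \<in> sections A \<Longrightarrow> ev1 \<alpha> (X - Y) = ev1 \<alpha> X - ev1 \<alpha> Y"
    and "ev1 \<alpha> (- X) = - ev1 \<alpha> X"
    and "ev1 \<alpha> (fscale f X) = f * ev1 \<alpha> X"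
proof -
  have l: "\<alpha> x [s *\<^sub>R X x + t *\<^sub>R Y x] = s * \<alpha> x [X x] + t * \<alpha> x [Y x]" if "Y \<in> sections A" for s t x Y
    using assms that by (intro covector_linear[OF form_at]) auto
  show "ev1 \<alpha> (X + Y) = ev1 \<alpha> X + ev1 \<alpha> Y" "ev1 \<alpha> (X - Y) = ev1 \<alpha> X - ev1 \<alpha> Y" if "Y \<in> sections A"
    using l[OF that, of _ 1 1] l[OF that, of _ 1 "-1"] by (auto simp: ev1_def fun_eq_iff)
  show "ev1 \<alpha> (- X) = - ev1 \<alpha> X" "ev1 \<alpha> (fscale f X) = f * ev1 \<alpha> X"
    using l[OF assms(2), of _ "-1" 0] l[OF assms(2), of _ "f _" 0] by (auto simp: ev1_def fun_eq_iff fscale_def)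
qed

lemma ev2_swap:
  "\<omega> \<in> forms A 2 \<Longrightarrow> X \<in> sections A \<Longrightarrow> Y \<in> sections A \<Longrightarrow> ev2 \<omega> Y X = - ev2 \<omega> X Y"
  by (auto simp: ev2_def fun_eq_iff intro!: alt_form_2_swap[OF form_at fibre_subspace])

lemma ev2_linear [simp]:
  assumes "\<omega> \<in> forms A 2" "X \<in> sections A" "Z \<in> sections A"
  shows "Y \<in> sections A \<Longrightarrow> ev2 \<omega> (X + Y) Z = ev2 \<omega> X Z + ev2 \<omega> Y Z"
    and "Y \<in> sections A \<Longrightarrow> ev2 \<omega> (X - Y) Z = ev2 \<omega> X Z - ev2 \<omega> Y Z"
    and "ev2 \<omega> (- X) Z = - ev2 \<omega> X Z"
    and "ev2 \<omega> (fscale f X) Z = f * ev2 \<omega> X Z"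
    and "Y \<in> sections A \<Longrightarrow> ev2 \<omega> Z (X + Y) = ev2 \<omega> Z X + ev2 \<omega> Z Y"
    and "Y \<in> sections A \<Longrightarrow> ev2 \<omega> Z (X - Y) = ev2 \<omega> Z X - ev2 \<omega> Z Y"
    and "ev2 \<omega> Z (- X) = - ev2 \<omega> Z X"
    and "ev2 \<omega> Z (fscale f X) = f * ev2 \<omega> Z X"
proof -
  have l: "\<omega> x [s *\<^sub>R X x + t *\<^sub>R Y x, Z x] = s * \<omega> x [X x, Z x] + t * \<omega> x [Y x, Z x]"
    and r: "\<omega> x [Z x, s *\<^sub>R X x + t *\<^sub>R Y x] = s * \<omega> x [Z x, X x] + t * \<omega> x [Z x, Y x]"
    if "Y \<in> sections A" for s t x Y
    using assms that by (auto intro!: alt_form_2_linear[OF form_at])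
  show "ev2 \<omega> (X + Y) Z = ev2 \<omega> X Z + ev2 \<omega> Y Z" "ev2 \<omega> (X - Y) Z = ev2 \<omega> X Z - ev2 \<omega> Y Z"
    "ev2 \<omega> Z (X + Y) = ev2 \<omega> Z X + ev2 \<omega> Z Y" "ev2 \<omega> Z (X - Y) = ev2 \<omega> Z X - ev2 \<omega> Z Y" if "Y \<in> sections A"
    using l[OF that, of _ 1 1] l[OF that, of _ 1 "-1"] r[OF that, of _ 1 1] r[OF that, of _ 1 "-1"]
    by (auto simp: ev2_def fun_eq_iff)
  show "ev2 \<omega> (- X) Z = - ev2 \<omega> X Z" "ev2 \<omega> (fscale f X) Z = f * ev2 \<omega> X Z"
    "ev2 \<omega> Z (- X) = - ev2 \<omega> Z X" "ev2 \<omega> Z (fscale f X) = f * ev2 \<omega> Z X"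
    using l[OF assms(2), of _ "-1" 0] l[OF assms(2), of _ "f _" 0] r[OF assms(2), of _ "-1" 0] r[OF assms(2), of _ "f _" 0]
    by (auto simp: ev2_def fun_eq_iff fscale_def)
qed

lemma forms_2I:
  assumes "\<And>x. \<omega> x \<in> alt_forms 2 (fibre A x)"
    and "\<And>X Y. X \<in> sections A \<Longrightarrow> Y \<in> sections A \<Longrightarrow> ev2 \<omega> X Y \<in> smooth_funs A"
  shows "\<omega> \<in> forms A 2"
  using assms by (auto simp: forms_def ev2_def length_2_cases)

lemma forms_3I:
  assumes "\<And>x. \<eta> x \<in> alt_forms 3 (fibre A x)"
    and "\<And>X Y Z. X \<in> sections A \<Longrightarrow> Y \<in> sections A \<Longrightarrow> Z \<in> sections A \<Longrightarrow> ev3 \<eta> X Y Z \<in> smooth_funs A"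
  shows "\<eta> \<in> forms A 3"
  using assms by (auto simp: forms_def ev3_def length_3_cases)

lemma forms_uminus:
  assumes "\<eta> \<in> forms A k"
  shows "- \<eta> \<in> forms A k"
proof -
  have "(\<lambda>x. - \<eta> x (map (\<lambda>X. X x) Xs)) \<in> smooth_funs A" if "length Xs = k" "set Xs \<subseteq> sections A" for Xs
    using smooth_minus[of "\<lambda>x. \<eta> x (map (\<lambda>X. X x) Xs)"] assms that by (auto simp: forms_def fun_Compl_def)
  moreover have "- \<eta> x \<in> alt_forms k (fibre A x)" for x
    using form_at[OF assms, of x] by (simp add: alt_forms_def)
  ultimately show ?thesis by (simp add: forms_def)
qed

lemma ins_form_2:
  assumes "\<omega> \<in> forms A 2" "X \<in> sections A"
  shows "ins X \<omega> \<in> forms A 1"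
proof (rule forms_1I)
  show "ins X \<omega> x \<in> covectors (fibre A x)" for x
    using assms alt_form_2_linear(2)[OF form_at[OF assms(1)]] supportedD[OF forms_supported[OF assms(1)]]
    by (intro covectorI) (auto simp: ins_def)
  show "(\<lambda>x. ins X \<omega> x [Y x]) \<in> smooth_funs A" if "Y \<in> sections A" for Y
    using ev2_smooth[OF assms that] by (simp add: ins_def ev2_def)
qed

lemma ev1_ins [simp]: "ev1 (ins X \<omega>) Y = ev2 \<omega> X Y"
  by (simp add: ev1_def ev2_def ins_def)

lemma forms_add:
  assumes "\<eta> \<in> forms A k" "\<theta> \<in> forms A k"
  shows "\<eta> + \<theta> \<in> forms A k"
proof -
  have "(\<lambda>x. \<eta> x (map (\<lambda>X. X x) Xs) + \<theta> x (map (\<lambda>X. X x) Xs)) \<in> smooth_funs A"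
    if "length Xs = k" "set Xs \<subseteq> sections A" for Xs
    using smooth_add[of "\<lambda>x. \<eta> x (map (\<lambda>X. X x) Xs)" "\<lambda>x. \<theta> x (map (\<lambda>X. X x) Xs)"] assms that
    by (auto simp: forms_def plus_fun_def)
  then show ?thesis
    using assms by (simp add: forms_def alt_forms_add)
qed

lemma forms_diff: "\<eta> \<in> forms A k \<Longrightarrow> \<theta> \<in> forms A k \<Longrightarrow> \<eta> - \<theta> \<in> forms A k"
  using forms_add[OF _ forms_uminus] by (metis add_uminus_conv_diff)

lemma ins2_form_3:
  assumes \<eta>: "\<eta> \<in> forms A 3" and X: "X \<in> sections A" "Y \<in> sections A"
  shows "ins2 X Y \<eta> \<in> forms A 1"
proof (rule forms_1I)
  fix x
  show "ins2 X Y \<eta> x \<in> covectors (fibre A x)"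
  proof (rule covectorI)
    fix v w s t assume "v \<in> fibre A x" "w \<in> fibre A x"
    then show "ins2 X Y \<eta> x [s *\<^sub>R v + t *\<^sub>R w] = s * ins2 X Y \<eta> x [v] + t * ins2 X Y \<eta> x [w]"
      using alt_forms_linear[OF form_at[OF \<eta>], of "[Y x, X x, v]" x 2 v w s t] X
      by (simp add: ins2_def ins_def numeral_2_eq_2)
  next
    fix vs assume "\<not> (length vs = 1 \<and> set vs \<subseteq> fibre A x)"
    then show "ins2 X Y \<eta> x vs = 0"
      unfolding ins2_def ins_def by (intro supportedD[OF forms_supported[OF \<eta>]]) auto
  qed
next
  fix Z assume "Z \<in> sections A"
  then show "(\<lambda>x. ins2 X Y \<eta> x [Z x]) \<in> smooth_funs A"
    using ev3_smooth[OF \<eta> X(2,1)] by (simp add: ins2_def ins_def ev3_def)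
qed

lemma ev1_combine [simp]:
  "ev1 (\<eta> + \<theta>) X = ev1 \<eta> X + ev1 \<theta> X" "ev1 (\<eta> - \<theta>) X = ev1 \<eta> X - ev1 \<theta> X"
  "ev1 (ins2 X Y \<eta>) Z = ev3 \<eta> Y X Z"
  by (auto simp: ev1_def ev3_def ins2_def ins_def)

lemma ev2_combine [simp]:
  "ev2 (\<eta> + \<theta>) X Y = ev2 \<eta> X Y + ev2 \<theta> X Y" "ev2 (\<eta> - \<theta>) X Y = ev2 \<eta> X Y - ev2 \<theta> X Y"
  by (auto simp: ev2_def)

lemma ev3_combine [simp]:
  "ev3 (\<eta> + \<theta>) X Y Z = ev3 \<eta> X Y Z + ev3 \<theta> X Y Z" "ev3 (\<eta> - \<theta>) X Y Z = ev3 \<eta> X Y Z - ev3 \<theta> X Y Z"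
  "ev3 (- \<eta>) X Y Z = - ev3 \<eta> X Y Z"
  by (auto simp: ev3_def)

lemma sections_eqI:
  assumes "X \<in> sections A" "Y \<in> sections A" "\<And>\<gamma>. \<gamma> \<in> forms A 1 \<Longrightarrow> ev1 \<gamma> X = ev1 \<gamma> Y"
  shows "X = Y"
proof
  fix x
  show "X x = Y x"
  proof (rule covectors_separate[of _ x])
    fix b assume "b \<in> covectors (fibre A x)"
    then obtain \<gamma> where "\<gamma> \<in> forms A 1" "\<gamma> x = b" by (rule form_through)
    then show "b [X x] = b [Y x]" using fun_cong[OF assms(3), of \<gamma> x] by (simp add: ev1_def)
  qed (use assms in auto)
qed

context
  fixes N assumes N: "N \<in> endo_fields A"
begin

lemma endo_section [simp]: "X \<in> sections A \<Longrightarrow> on_sections N X \<in> sections A"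
  using N by (simp add: endo_fields_def)

lemma endo_fibre [simp]: "v \<in> fibre A x \<Longrightarrow> N x v \<in> fibre A x"
  using N by (simp add: endo_fields_def)

lemma endo_linear: "v \<in> fibre A x \<Longrightarrow> w \<in> fibre A x \<Longrightarrow> N x (a *\<^sub>R v + b *\<^sub>R w) = a *\<^sub>R N x v + b *\<^sub>R N x w"
  using N by (simp add: endo_fields_def)

lemma endo_uminus [simp]: "X \<in> sections A \<Longrightarrow> on_sections N (- X) = - on_sections N X"
proof -
  assume X: "X \<in> sections A"
  have "N x (- X x) = - N x (X x)" for x
    using endo_linear[of "X x" x "X x" "-1" 0] X by simp
  then show ?thesis by (simp add: on_sections_def fun_eq_iff)
qed

text \<open>Self-adjointness of \<open>N\<close> for \<open>\<theta>\<close> is what makes \<open>\<theta>(N\<cdot>, \<cdot>)\<close> alternating.\<close>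

lemma twist_form:
  assumes \<theta>: "\<theta> \<in> forms A 2"
    and adj: "\<And>X Y. X \<in> sections A \<Longrightarrow> Y \<in> sections A \<Longrightarrow> ev2 \<theta> (on_sections N X) Y = ev2 \<theta> X (on_sections N Y)"
  shows "twist A \<theta> N \<in> forms A 2"
    and "X \<in> sections A \<Longrightarrow> Y \<in> sections A \<Longrightarrow> ev2 (twist A \<theta> N) X Y = ev2 \<theta> (on_sections N X) Y"
proof -
  show ev: "ev2 (twist A \<theta> N) X Y = ev2 \<theta> (on_sections N X) Y" if "X \<in> sections A" "Y \<in> sections A" for X Y
    using that by (simp add: ev2_def twist_def on_sections_def)
  show "twist A \<theta> N \<in> forms A 2"
  proof (rule forms_2I)
    fix x
    show "twist A \<theta> N x \<in> alt_forms 2 (fibre A x)"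
    proof (rule alt_form_2I[OF fibre_subspace])
      show "twist A \<theta> N x vs = 0" if "\<not> (length vs = 2 \<and> set vs \<subseteq> fibre A x)" for vs
        using that by (auto simp: twist_def split: list.splits)
      show "twist A \<theta> N x [s *\<^sub>R v + t *\<^sub>R w, u] = s * twist A \<theta> N x [v, u] + t * twist A \<theta> N x [w, u]"
        if "v \<in> fibre A x" "w \<in> fibre A x" "u \<in> fibre A x" for v w u s t
        using that alt_form_2_linear(1)[OF form_at[OF \<theta>], of "N x v" x "N x w" u]
        by (simp add: twist_def endo_linear subspace_add[OF fibre_subspace] subspace_scale[OF fibre_subspace])
      fix v w assume vw: "v \<in> fibre A x" "w \<in> fibre A x"
      obtain X where X: "X \<in> sections A" "X x = v" using section_through[OF vw(1)] by blast
      obtain Y where Y: "Y \<in> sections A" "Y x = w" using section_through[OF vw(2)] by blast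
      have "ev2 (twist A \<theta> N) Y X = - ev2 (twist A \<theta> N) X Y"
        using X Y adj[of Y X] ev2_swap[OF \<theta>, of "on_sections N X" Y] by (simp add: ev)
      then show "twist A \<theta> N x [w, v] = - twist A \<theta> N x [v, w]"
        using X Y by (auto simp: ev2_def dest: fun_cong[of _ _ x])
    qed
  qed (use ev \<theta> in simp)
qed

lemma supported_transp: "supported 1 \<alpha> \<Longrightarrow> supported 1 (transp A N \<alpha>)"
  unfolding supported_def transp_def transp_at_def by simp

lemma supported_i_endo: "supported k \<eta> \<Longrightarrow> supported k (i_endo A N \<eta>)"
  unfolding supported_def i_endo_def by simp

lemma ev1_transp [simp]: "X \<in> sections A \<Longrightarrow> ev1 (transp A N \<alpha>) X = ev1 \<alpha> (on_sections N X)"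
  by (simp add: ev1_def transp_def transp_at_def on_sections_def)

lemma i_endo_ev:
  shows "X \<in> sections A \<Longrightarrow> ev1 (i_endo A N \<eta>) X = ev1 \<eta> (on_sections N X)"
    and "X \<in> sections A \<Longrightarrow> Y \<in> sections A \<Longrightarrow>
      ev2 (i_endo A N \<eta>) X Y = ev2 \<eta> (on_sections N X) Y + ev2 \<eta> X (on_sections N Y)"
    and "X \<in> sections A \<Longrightarrow> Y \<in> sections A \<Longrightarrow> Z \<in> sections A \<Longrightarrow>
      ev3 (i_endo A N \<eta>) X Y Z = ev3 \<eta> (on_sections N X) Y Z + ev3 \<eta> X (on_sections N Y) Z + ev3 \<eta> X Y (on_sections N Z)"
  by (simp_all add: ev1_def ev2_def ev3_def i_endo_def on_sections_def fun_eq_iff lessThan_Suc)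

lemma supported_cyclic_twist: "supported 3 (cyclic_twist A H N)"
  unfolding supported_def cyclic_twist_def by (auto split: list.splits)

lemma cyclic_twist_ev:
  "X \<in> sections A \<Longrightarrow> Y \<in> sections A \<Longrightarrow> Z \<in> sections A \<Longrightarrow>
    ev3 (cyclic_twist A H N) X Y Z = ev3 H (on_sections N X) (on_sections N Y) Z
      + ev3 H (on_sections N Y) (on_sections N Z) X + ev3 H (on_sections N Z) (on_sections N X) Y"
  by (simp add: ev3_def cyclic_twist_def on_sections_def fun_eq_iff)

end

end

section \<open>The differential of a Lie algebroid\<close>

locale algebroid =
  fixes A :: "('m::{t2_space,second_countable_topology}, 'v::real_vector, 'z) lie_algebroid_data_scheme"
  assumes lie_algebroid: "lie_algebroid A"
begin

sublocale smooth_bundle A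
  using lie_algebroid by unfold_locales (simp add: lie_algebroid_def)

abbreviation (input) D :: "('m \<Rightarrow> 'v) \<Rightarrow> ('m \<Rightarrow> real) \<Rightarrow> 'm \<Rightarrow> real" where "D \<equiv> anchor_sec A"
abbreviation (input) br :: "('m \<Rightarrow> 'v) \<Rightarrow> ('m \<Rightarrow> 'v) \<Rightarrow> 'm \<Rightarrow> 'v" where "br \<equiv> bracket A"

lemma anchor_tangent: "v \<in> fibre A x \<Longrightarrow> anchor A x v \<in> tangent_space A x"
  using lie_algebroid by (simp add: lie_algebroid_def)

lemma anchor_linear:
  "v \<in> fibre A x \<Longrightarrow> w \<in> fibre A x \<Longrightarrow> f \<in> smooth_funs A \<Longrightarrow>
    anchor A x (a *\<^sub>R v + b *\<^sub>R w) f = a * anchor A x v f + b * anchor A x w f"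
  using lie_algebroid by (simp add: lie_algebroid_def)

lemma D_smooth [simp]: "X \<in> sections A \<Longrightarrow> f \<in> smooth_funs A \<Longrightarrow> D X f \<in> smooth_funs A"
  using lie_algebroid by (simp add: lie_algebroid_def)

lemma D_linear [simp]:
  assumes "X \<in> sections A" "f \<in> smooth_funs A"
  shows "g \<in> smooth_funs A \<Longrightarrow> D X (f + g) = D X f + D X g"
    and "g \<in> smooth_funs A \<Longrightarrow> D X (f - g) = D X f - D X g"
    and "D X (- f) = - D X f"
    and "g \<in> smooth_funs A \<Longrightarrow> D X (f * g) = f * D X g + g * D X f"
proof -
  have l: "anchor A x (X x) (\<lambda>y. a * f y + b * g y) = a * anchor A x (X x) f + b * anchor A x (X x) g"
    if "g \<in> smooth_funs A" for a b g x
    using anchor_tangent[of "X x" x] assms that by (simp add: tangent_space_def)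
  show "D X (f + g) = D X f + D X g" "D X (f - g) = D X f - D X g" if "g \<in> smooth_funs A"
    using l[OF that, of _ 1 1] l[OF that, of _ 1 "-1"]
    by (simp_all add: anchor_sec_def fun_eq_iff plus_fun_def fun_diff_def)
  show "D X (- f) = - D X f"
    using l[OF assms(2), of _ "-1" 0] by (simp add: anchor_sec_def fun_eq_iff fun_Compl_def)
  show "D X (f * g) = f * D X g + g * D X f" if "g \<in> smooth_funs A"
    using anchor_tangent[of "X _"] assms that
    by (simp add: tangent_space_def anchor_sec_def fun_eq_iff times_fun_def)
qed

lemma D_zero [simp]: "X \<in> sections A \<Longrightarrow> D X 0 = 0"
  using D_linear(1)[of X 0 0] by simp

lemma D_section [simp]:
  assumes "X \<in> sections A" "f \<in> smooth_funs A"
  shows "Y \<in> sections A \<Longrightarrow> D (X + Y) f = D X f + D Y f"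
    and "Y \<in> sections A \<Longrightarrow> D (X - Y) f = D X f - D Y f"
    and "D (- X) f = - D X f"
    and "D (fscale g X) f = g * D X f"
proof -
  have l: "anchor A x (a *\<^sub>R X x + b *\<^sub>R Y x) f = a * anchor A x (X x) f + b * anchor A x (Y x) f"
    if "Y \<in> sections A" for a b x Y
    using assms that by (intro anchor_linear) auto
  show "D (X + Y) f = D X f + D Y f" "D (X - Y) f = D X f - D Y f" if "Y \<in> sections A"
    using l[OF that, of _ 1 1] l[OF that, of _ 1 "-1"] by (simp_all add: anchor_sec_def fun_eq_iff)
  show "D (- X) f = - D X f" "D (fscale g X) f = g * D X f"
    using l[OF assms(1), of _ "-1" 0] l[OF assms(1), of _ "g _" 0]
    by (simp_all add: anchor_sec_def fun_eq_iff fscale_def)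
qed

lemma br_section [simp]: "X \<in> sections A \<Longrightarrow> Y \<in> sections A \<Longrightarrow> br X Y \<in> sections A"
  using lie_algebroid unfolding lie_algebroid_def by blast

lemma br_skew: "X \<in> sections A \<Longrightarrow> Y \<in> sections A \<Longrightarrow> br X Y = - br Y X"
  using lie_algebroid unfolding lie_algebroid_def by blast

lemma br_linear [simp]:
  assumes "X \<in> sections A" "Y \<in> sections A" "Z \<in> sections A"
  shows "br (X + Y) Z = br X Z + br Y Z" "br (X - Y) Z = br X Z - br Y Z" "br (- X) Z = - br X Z"
    and "br Z (X + Y) = br Z X + br Z Y" "br Z (X - Y) = br Z X - br Z Y" "br Z (- X) = - br Z X"
proof -
  have l: "br (\<lambda>x. a *\<^sub>R X x + b *\<^sub>R Y x) Z = (\<lambda>x. a *\<^sub>R br X Z x + b *\<^sub>R br Y Z x)" for a b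
    using assms lie_algebroid unfolding lie_algebroid_def by blast
  show 1: "br (X + Y) Z = br X Z + br Y Z" "br (X - Y) Z = br X Z - br Y Z" "br (- X) Z = - br X Z"
    using l[of 1 1] l[of 1 "-1"] l[of "-1" 0]
    by (simp_all add: plus_fun_def fun_diff_def fun_Compl_def)
  show "br Z (X + Y) = br Z X + br Z Y" "br Z (X - Y) = br Z X - br Z Y" "br Z (- X) = - br Z X"
    using 1 br_skew[of Z "X + Y"] br_skew[of Z "X - Y"] br_skew[of Z "- X"] br_skew[of Z X] br_skew[of Z Y] assms
    by (simp_all only: sections_add sections_diff sections_minus) (simp_all add: algebra_simps)
qed

lemma br_zero [simp]: "X \<in> sections A \<Longrightarrow> br 0 X = 0" "X \<in> sections A \<Longrightarrow> br X 0 = 0"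
  using br_linear(1)[of 0 0 X] br_linear(4)[of 0 0 X] by simp_all

lemma br_fscale [simp]:
  assumes "X \<in> sections A" "Y \<in> sections A" "f \<in> smooth_funs A"
  shows "br X (fscale f Y) = fscale f (br X Y) + fscale (D X f) Y"
    and "br (fscale f Y) X = fscale f (br Y X) - fscale (D X f) Y"
proof -
  have "br X (\<lambda>x. f x *\<^sub>R Y x) = (\<lambda>x. f x *\<^sub>R br X Y x + D X f x *\<^sub>R Y x)"
    using assms lie_algebroid unfolding lie_algebroid_def by blast
  then show 1: "br X (fscale f Y) = fscale f (br X Y) + fscale (D X f) Y"
    by (simp add: fscale_def plus_fun_def)
  show "br (fscale f Y) X = fscale f (br Y X) - fscale (D X f) Y"
    using br_skew[OF sections_fscale[OF assms(3,2)] assms(1)] br_skew[OF assms(2,1)] 1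
    by (simp add: fun_eq_iff fscale_def)
qed

lemma jacobi:
  "X \<in> sections A \<Longrightarrow> Y \<in> sections A \<Longrightarrow> Z \<in> sections A \<Longrightarrow>
    br X (br Y Z) + br Y (br Z X) + br Z (br X Y) = 0"
  using lie_algebroid unfolding lie_algebroid_def by blast

lemma D_br:
  "X \<in> sections A \<Longrightarrow> Y \<in> sections A \<Longrightarrow> f \<in> smooth_funs A \<Longrightarrow>
    D (br X Y) f = D X (D Y f) - D Y (D X f)"
  using lie_algebroid unfolding lie_algebroid_def by blast

text \<open>If \<open>\<rho>\<close> is a bump function at \<open>p\<close> supported in \<open>T\<close>, then \<open>\<rho> (f - g) = 0\<close>; apply the Leibniz rule at \<open>p\<close>.\<close>

lemma D_local:
  assumes "X \<in> sections A" "f \<in> smooth_funs A" "g \<in> smooth_funs A" "open T" "p \<in> T"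
    and "\<And>q. q \<in> T \<Longrightarrow> f q = g q"
  shows "D X f p = D X g p"
proof -
  obtain \<rho> K where \<rho>: "\<rho> \<in> smooth_funs A" "closed K" "K \<subseteq> T" "\<And>q. q \<notin> K \<Longrightarrow> \<rho> q = 0" "\<rho> p = 1"
    using bump_function[OF manifold assms(4,5)] by blast
  have "\<rho> * (f - g) = 0"
    using \<rho>(3,4) assms(6) by (fastforce simp: fun_eq_iff)
  then have "0 = D X (\<rho> * (f - g)) p" using assms(1) by simp
  also have "\<dots> = \<rho> p * D X (f - g) p + (f p - g p) * D X \<rho> p"
    using assms(1-3) \<rho>(1) by simp
  finally show ?thesis using \<rho>(5) assms by simp
qed

text \<open>As for \<open>D_local\<close>, with the Leibniz rule of the bracket applied to \<open>\<rho> (Y - Z) = 0\<close>.\<close>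

lemma br_local:
  assumes "X \<in> sections A" "Y \<in> sections A" "Z \<in> sections A" "open T" "p \<in> T"
    and "\<And>q. q \<in> T \<Longrightarrow> Y q = Z q"
  shows "br X Y p = br X Z p" "br Y X p = br Z X p"
proof -
  obtain \<rho> K where \<rho>: "\<rho> \<in> smooth_funs A" "closed K" "K \<subseteq> T" "\<And>q. q \<notin> K \<Longrightarrow> \<rho> q = 0" "\<rho> p = 1"
    using bump_function[OF manifold assms(4,5)] by blast
  have "fscale \<rho> (Y - Z) = 0"
    using \<rho>(3,4) assms(6) by (fastforce simp: fun_eq_iff fscale_def)
  then have "0 = br X (fscale \<rho> (Y - Z)) p" using assms(1) by simp
  also have "\<dots> = br X (Y - Z) p + D X \<rho> p *\<^sub>R (Y p - Z p)"
    using assms(1-3) \<rho>(1,5) by simp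
  finally show "br X Y p = br X Z p" using assms by simp
  then show "br Y X p = br Z X p"
    using br_skew[of Y X] br_skew[of Z X] assms by simp
qed

text \<open>The Koszul formula on global sections in the degrees 1, 2 and 3.\<close>

definition d1 :: "('m, 'v) form \<Rightarrow> ('m \<Rightarrow> 'v) \<Rightarrow> ('m \<Rightarrow> 'v) \<Rightarrow> 'm \<Rightarrow> real" where
  "d1 \<alpha> X Y = D X (ev1 \<alpha> Y) - D Y (ev1 \<alpha> X) - ev1 \<alpha> (br X Y)"

definition d2 :: "('m, 'v) form \<Rightarrow> ('m \<Rightarrow> 'v) \<Rightarrow> ('m \<Rightarrow> 'v) \<Rightarrow> ('m \<Rightarrow> 'v) \<Rightarrow> 'm \<Rightarrow> real" where
  "d2 \<omega> X Y Z = D X (ev2 \<omega> Y Z) - D Y (ev2 \<omega> X Z) + D Z (ev2 \<omega> X Y)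
     - ev2 \<omega> (br X Y) Z + ev2 \<omega> (br X Z) Y - ev2 \<omega> (br Y Z) X"

definition d3 :: "('m, 'v) form \<Rightarrow> ('m \<Rightarrow> 'v) \<Rightarrow> ('m \<Rightarrow> 'v) \<Rightarrow> ('m \<Rightarrow> 'v) \<Rightarrow> ('m \<Rightarrow> 'v) \<Rightarrow> 'm \<Rightarrow> real" where
  "d3 \<eta> W X Y Z = D W (ev3 \<eta> X Y Z) - D X (ev3 \<eta> W Y Z) + D Y (ev3 \<eta> W X Z) - D Z (ev3 \<eta> W X Y)
     - ev3 \<eta> (br W X) Y Z + ev3 \<eta> (br W Y) X Z - ev3 \<eta> (br W Z) X Y
     - ev3 \<eta> (br X Y) W Z + ev3 \<eta> (br X Z) W Y - ev3 \<eta> (br Y Z) W X"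

lemma koszul_1: "koszul A \<eta> [X] x = D X (\<lambda>y. \<eta> y []) x"
  by (simp add: koszul_def omit_def)

lemma koszul_2: "koszul A \<eta> [X, Y] x = d1 \<eta> X Y x"
  by (simp add: koszul_def omit_def d1_def ev1_def One_nat_def lessThan_Suc numeral_2_eq_2)

lemma koszul_3: "koszul A \<eta> [X, Y, Z] x = d2 \<eta> X Y Z x"
  by (simp add: koszul_def omit_def d2_def ev2_def One_nat_def lessThan_Suc numeral_3_eq_3)

lemma koszul_4: "koszul A \<eta> [W, X, Y, Z] x = d3 \<eta> W X Y Z x"
  by (simp add: koszul_def omit_def d3_def ev3_def One_nat_def lessThan_Suc)

text \<open>The derivatives of \<open>f\<close> that come from the anchor cancel those that come from the bracket.\<close>

lemma d1_first:
  assumes "\<alpha> \<in> forms A 1" "X \<in> sections A" "Z \<in> sections A"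
  shows "Y \<in> sections A \<Longrightarrow> d1 \<alpha> (X + Y) Z = d1 \<alpha> X Z + d1 \<alpha> Y Z" "f \<in> smooth_funs A \<Longrightarrow> d1 \<alpha> (fscale f X) Z = f * d1 \<alpha> X Z"
  using assms by (simp_all add: d1_def algebra_simps)

lemma d1_swap:
  assumes "\<alpha> \<in> forms A 1" "X \<in> sections A" "Y \<in> sections A"
  shows "d1 \<alpha> Y X = - d1 \<alpha> X Y"
  using assms by (simp add: d1_def br_skew[of Y X])

lemma d1_pointwise:
  assumes "\<alpha> \<in> forms A 1" "X \<in> sections A" "Y \<in> sections A" "X' \<in> sections A" "Y' \<in> sections A"
    and "X x = X' x" "Y x = Y' x"
  shows "d1 \<alpha> X Y x = d1 \<alpha> X' Y' x"
proof -
  have 1: "d1 \<alpha> X Z x = d1 \<alpha> X' Z x" if "X \<in> sections A" "X' \<in> sections A" "Z \<in> sections A" "X x = X' x" for X X' Z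
    using assms(1) that by (intro tensorial[where \<Phi> = "\<lambda>X. d1 \<alpha> X Z x"]) (simp_all add: d1_first)
  show ?thesis
    using 1[of X X' Y] 1[of Y Y' X'] assms d1_swap[of \<alpha> X'] by simp
qed

lemma d2_first:
  assumes "\<omega> \<in> forms A 2" "X \<in> sections A" "Y \<in> sections A" "Z \<in> sections A"
  shows "W \<in> sections A \<Longrightarrow> d2 \<omega> (W + X) Y Z = d2 \<omega> W Y Z + d2 \<omega> X Y Z" "f \<in> smooth_funs A \<Longrightarrow> d2 \<omega> (fscale f X) Y Z = f * d2 \<omega> X Y Z"
  using assms by (simp_all add: d2_def algebra_simps)

lemma d2_swap:
  assumes "\<omega> \<in> forms A 2" "X \<in> sections A" "Y \<in> sections A" "Z \<in> sections A"
  shows "d2 \<omega> Y X Z = - d2 \<omega> X Y Z" "d2 \<omega> X Z Y = - d2 \<omega> X Y Z"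
  using assms ev2_swap[of \<omega> X Y] ev2_swap[of \<omega> Y Z]
  by (simp_all add: d2_def br_skew[of Y X] br_skew[of Z Y])

text \<open>Tensoriality in the first argument is moved to the others by antisymmetry.\<close>

lemma d2_pointwise:
  assumes "\<omega> \<in> forms A 2" "X \<in> sections A" "Y \<in> sections A" "Z \<in> sections A"
    "X' \<in> sections A" "Y' \<in> sections A" "Z' \<in> sections A"
    and "X x = X' x" "Y x = Y' x" "Z x = Z' x"
  shows "d2 \<omega> X Y Z x = d2 \<omega> X' Y' Z' x"
proof -
  have 1: "d2 \<omega> X Y Z x = d2 \<omega> X' Y Z x"
    if "X \<in> sections A" "X' \<in> sections A" "Y \<in> sections A" "Z \<in> sections A" "X x = X' x" for X X' Y Z
    using assms(1) that by (intro tensorial[where \<Phi> = "\<lambda>X. d2 \<omega> X Y Z x"]) (simp_all add: d2_first)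
  \<comment> \<open>replace the arguments one at a time, each after moving it to the first position\<close>
  have "d2 \<omega> X Y Z x = d2 \<omega> X' Y Z x" by (rule 1[OF assms(2,5,3,4,8)])
  also have "\<dots> = - d2 \<omega> Y X' Z x" using assms d2_swap(1)[of \<omega> X' Y Z] by simp
  also have "\<dots> = - d2 \<omega> Y' X' Z x" by (simp add: 1[OF assms(3,6,5,4,9)])
  also have "\<dots> = d2 \<omega> Z X' Y' x"
    using assms d2_swap(1)[of \<omega> X' Y' Z] d2_swap(2)[of \<omega> X' Z Y'] d2_swap(1)[of \<omega> X' Z Y'] by simp
  also have "\<dots> = d2 \<omega> Z' X' Y' x" by (simp add: 1[OF assms(4,7,5,6,10)])
  also have "\<dots> = d2 \<omega> X' Y' Z' x"
    using assms d2_swap(2)[of \<omega> X' Z' Y'] d2_swap(1)[of \<omega> X' Z' Y'] by simp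
  finally show ?thesis .
qed

text \<open>The choice of extensions that is made in the definition of \<^const>\<open>ext_d\<close>.\<close>

definition extension :: "'m \<Rightarrow> 'v \<Rightarrow> 'm \<Rightarrow> 'v" where
  "extension x v = (SOME X. X \<in> sections A \<and> X x = v)"

lemma extension:
  assumes "v \<in> fibre A x"
  shows "extension x v \<in> sections A" "extension x v x = v"
proof -
  have "\<exists>X. X \<in> sections A \<and> X x = v" using section_through[OF assms] by blast
  from someI_ex[OF this] show "extension x v \<in> sections A" "extension x v x = v"
    by (simp_all add: extension_def)
qed

lemma ext_d_extension:
  "ext_d A \<eta> x vs = (if set vs \<subseteq> fibre A x then koszul A \<eta> (map (extension x) vs) x else 0)"
  by (simp add: ext_d_def extension_def[abs_def])

lemma koszul_degree:
  assumes "supported k \<eta>" "set Xs \<subseteq> sections A" "length Xs \<noteq> Suc k"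
  shows "koszul A \<eta> Xs x = 0"
proof -
  have l: "length (omit i Xs) = length Xs - 1" if "i < length Xs" for i and Xs :: "('m \<Rightarrow> 'v) list"
    using that by (simp add: omit_def)
  have "anchor_sec A (Xs ! i) (\<lambda>y. \<eta> y (map (\<lambda>X. X y) (omit i Xs))) x = 0" if "i < length Xs" for i
  proof -
    have "length (omit i Xs) \<noteq> k" using l[OF that] assms(3) that by auto
    then have "(\<lambda>y. \<eta> y (map (\<lambda>X. X y) (omit i Xs))) = 0"
      using supportedD[OF assms(1)] by (simp add: fun_eq_iff)
    then show ?thesis using D_zero[of "Xs ! i"] assms(2) that by (simp add: subset_code(1))
  qed
  moreover have "\<eta> x (map (\<lambda>X. X x) (bracket A (Xs ! i) (Xs ! j) # omit i (omit j Xs))) = 0"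
    if "j < length Xs" "i < j" for i j
  proof -
    have "length (omit i (omit j Xs)) = length Xs - 2"
      using l[OF that(1)] l[of i "omit j Xs"] that by simp
    then have "Suc (length (omit i (omit j Xs))) \<noteq> k" using assms(3) that by simp
    then show ?thesis by (intro supportedD[OF assms(1)]) simp
  qed
  ultimately show ?thesis by (simp add: koszul_def)
qed

lemma supported_ext_d:
  assumes "supported k \<eta>"
  shows "supported (Suc k) (ext_d A \<eta>)"
  unfolding supported_def
proof (intro allI impI)
  fix x vs assume "\<not> (length vs = Suc k \<and> set vs \<subseteq> fibre A x)"
  then show "ext_d A \<eta> x vs = 0"
    using koszul_degree[OF assms, of "map (extension x) vs" x] extension(1)
    by (auto simp: ext_d_extension)
qed

lemma ev1_ext_d:
  "X \<in> sections A \<Longrightarrow> ev1 (ext_d A \<eta>) X = D X (\<lambda>y. \<eta> y [])"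
  using extension by (auto simp: ev1_def ext_d_extension koszul_1 anchor_sec_def)

lemma ev2_ext_d:
  "\<alpha> \<in> forms A 1 \<Longrightarrow> X \<in> sections A \<Longrightarrow> Y \<in> sections A \<Longrightarrow> ev2 (ext_d A \<alpha>) X Y = d1 \<alpha> X Y"
  using extension by (auto simp: ev2_def ext_d_extension koszul_2 intro!: d1_pointwise)

lemma ev3_ext_d:
  "\<omega> \<in> forms A 2 \<Longrightarrow> X \<in> sections A \<Longrightarrow> Y \<in> sections A \<Longrightarrow> Z \<in> sections A \<Longrightarrow>
    ev3 (ext_d A \<omega>) X Y Z = d2 \<omega> X Y Z"
  using extension by (auto simp: ev3_def ext_d_extension koszul_3 intro!: d2_pointwise)

lemma d2_smooth [simp]:
  "\<omega> \<in> forms A 2 \<Longrightarrow> X \<in> sections A \<Longrightarrow> Y \<in> sections A \<Longrightarrow> Z \<in> sections A \<Longrightarrow> d2 \<omega> X Y Z \<in> smooth_funs A"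
  by (simp add: d2_def)

lemma ext_d_forms_3:
  assumes "\<omega> \<in> forms A 2"
  shows "ext_d A \<omega> \<in> forms A 3"
proof (rule forms_3I)
  fix x
  have *: "ext_d A \<omega> x [u, v, w] = d2 \<omega> (extension x u) (extension x v) (extension x w) x"
    if "u \<in> fibre A x" "v \<in> fibre A x" "w \<in> fibre A x" for u v w
    using that by (simp add: ext_d_extension koszul_3)
  note sw = d2_swap[OF assms extension(1) extension(1) extension(1)]
  show "ext_d A \<omega> x \<in> alt_forms 3 (fibre A x)"
  proof (rule alt_form_3I[OF fibre_subspace])
    show "ext_d A \<omega> x vs = 0" if "\<not> (length vs = 3 \<and> set vs \<subseteq> fibre A x)" for vs
      using supportedD[OF supported_ext_d[OF forms_supported[OF assms]]] that by simp
    fix v w y z s t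
    assume h: "v \<in> fibre A x" "w \<in> fibre A x" "y \<in> fibre A x" "z \<in> fibre A x"
    let ?e = "extension x"
    have m: "s *\<^sub>R v + t *\<^sub>R w \<in> fibre A x"
      using h by (simp add: subspace_add[OF fibre_subspace] subspace_scale[OF fibre_subspace])
    have "d2 \<omega> (?e (s *\<^sub>R v + t *\<^sub>R w)) (?e y) (?e z) x =
        d2 \<omega> (fscale (\<lambda>_. s) (?e v) + fscale (\<lambda>_. t) (?e w)) (?e y) (?e z) x"
      using h m extension by (intro d2_pointwise[OF assms]) auto
    also have "\<dots> = s * d2 \<omega> (?e v) (?e y) (?e z) x + t * d2 \<omega> (?e w) (?e y) (?e z) x"
      using h extension(1) assms by (simp add: d2_first)
    finally show "ext_d A \<omega> x [s *\<^sub>R v + t *\<^sub>R w, y, z] = s * ext_d A \<omega> x [v, y, z] + t * ext_d A \<omega> x [w, y, z]"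
      using h m by (simp add: *)
  next
    fix u v w assume h: "u \<in> fibre A x" "v \<in> fibre A x" "w \<in> fibre A x"
    show "ext_d A \<omega> x [v, u, w] = - ext_d A \<omega> x [u, v, w]"
      using fun_cong[OF sw(1)[OF h], of x] h by (simp add: *)
    show "ext_d A \<omega> x [u, w, v] = - ext_d A \<omega> x [u, v, w]"
      using fun_cong[OF sw(2)[OF h], of x] h by (simp add: *)
  qed
  show "ev3 (ext_d A \<omega>) X Y Z \<in> smooth_funs A" if "X \<in> sections A" "Y \<in> sections A" "Z \<in> sections A" for X Y Z
    using that assms by (simp add: ev3_ext_d)
qed

text \<open>Second derivatives cancel because the anchor is compatible with brackets, the terms with two
  unnested brackets cancel in pairs by skewness, and those with nested brackets by the Jacobi identity.\<close>

lemma d_squared: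
  assumes "\<omega> \<in> forms A 2" "W \<in> sections A" "X \<in> sections A" "Y \<in> sections A" "Z \<in> sections A"
  shows "d3 (ext_d A \<omega>) W X Y Z = 0"
proof -
  have s: "ev2 \<omega> (br Y Z) (br W X) = - ev2 \<omega> (br W X) (br Y Z)"
    "ev2 \<omega> (br X Z) (br W Y) = - ev2 \<omega> (br W Y) (br X Z)"
    "ev2 \<omega> (br X Y) (br W Z) = - ev2 \<omega> (br W Z) (br X Y)"
    using assms by (auto intro!: ev2_swap)
  have j: "ev2 \<omega> (br (br P Q) R) S - ev2 \<omega> (br (br P R) Q) S + ev2 \<omega> (br (br Q R) P) S = 0"
    if "P \<in> sections A" "Q \<in> sections A" "R \<in> sections A" "S \<in> sections A" for P Q R S
  proof -
    have "br (br P Q) R - br (br P R) Q + br (br Q R) P = - (br P (br Q R) + br Q (br R P) + br R (br P Q))"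
      using that br_skew[of "br P Q" R] br_skew[of "br P R" Q] br_skew[of "br Q R" P] br_skew[of R P] by simp
    also have "\<dots> = 0" using jacobi[of P Q R] that by simp
    finally have "ev2 \<omega> (br (br P Q) R - br (br P R) Q + br (br Q R) P) S = 0"
      using ev2_linear(1)[OF assms(1) sections_zero that(4) sections_zero] by simp
    then show ?thesis using that assms(1) by simp
  qed
  have "d3 (ext_d A \<omega>) W X Y Z x = 0" for x
    using fun_cong[OF j[of W X Y Z], of x] fun_cong[OF j[of W X Z Y], of x] fun_cong[OF j[of W Y Z X], of x]
      fun_cong[OF j[of X Y Z W], of x] assms
    by (simp add: d3_def ev3_ext_d) (simp add: d2_def D_br s)
  then show ?thesis by (simp add: fun_eq_iff)
qed

text \<open>The value of \<open>d (d \<omega>)\<close> is a degree-3 Koszul formula for the chosen extensions, which are global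
  sections.\<close>

lemma ext_d_ext_d:
  assumes "\<omega> \<in> forms A 2"
  shows "ext_d A (ext_d A \<omega>) = 0"
proof (intro ext)
  fix x vs
  show "ext_d A (ext_d A \<omega>) x vs = 0 x vs"
  proof (cases "length vs = 4 \<and> set vs \<subseteq> fibre A x")
    case True
    then obtain a b c d where "vs = [a, b, c, d]"
      by (auto simp: numeral_eq_Suc length_Suc_conv)
    then show ?thesis
      using True d_squared[OF assms] extension(1) by (simp add: ext_d_extension koszul_4)
  next
    case False
    have "supported (Suc (Suc 2)) (ext_d A (ext_d A \<omega>))"
      by (intro supported_ext_d forms_supported assms)
    from supportedD[OF this, of vs x] False show ?thesis by simp
  qed
qed

lemma d3_diff:
  assumes "\<And>X Y Z. X \<in> sections A \<Longrightarrow> Y \<in> sections A \<Longrightarrow> Z \<in> sections A \<Longrightarrow> ev3 \<eta> X Y Z \<in> smooth_funs A"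
    and "\<And>X Y Z. X \<in> sections A \<Longrightarrow> Y \<in> sections A \<Longrightarrow> Z \<in> sections A \<Longrightarrow> ev3 \<theta> X Y Z \<in> smooth_funs A"
    and "W \<in> sections A" "X \<in> sections A" "Y \<in> sections A" "Z \<in> sections A"
  shows "d3 (\<eta> - \<theta>) W X Y Z = d3 \<eta> W X Y Z - d3 \<theta> W X Y Z"
  using assms by (simp add: d3_def algebra_simps)

lemma ext_d_diff_3:
  assumes "supported 3 \<eta>" "supported 3 \<theta>"
    and "\<And>X Y Z. X \<in> sections A \<Longrightarrow> Y \<in> sections A \<Longrightarrow> Z \<in> sections A \<Longrightarrow> ev3 \<eta> X Y Z \<in> smooth_funs A"
    and "\<And>X Y Z. X \<in> sections A \<Longrightarrow> Y \<in> sections A \<Longrightarrow> Z \<in> sections A \<Longrightarrow> ev3 \<theta> X Y Z \<in> smooth_funs A"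
  shows "ext_d A (\<eta> - \<theta>) = ext_d A \<eta> - ext_d A \<theta>"
proof (intro ext)
  fix x vs
  show "ext_d A (\<eta> - \<theta>) x vs = (ext_d A \<eta> - ext_d A \<theta>) x vs"
  proof (cases "length vs = 4 \<and> set vs \<subseteq> fibre A x")
    case True
    then obtain a b c d where "vs = [a, b, c, d]"
      by (auto simp: numeral_eq_Suc length_Suc_conv)
    then show ?thesis
      using True d3_diff[OF assms(3,4)] extension(1) by (simp add: ext_d_extension koszul_4)
  next
    case False
    then have "ext_d A \<zeta> x vs = 0" if "supported 3 \<zeta>" for \<zeta>
      using supportedD[OF supported_ext_d[OF that], of vs x] by simp
    then show ?thesis using supported_combine(2)[OF assms(1,2)] assms(1,2) by simp
  qed
qed

end

section \<open>Poisson bivectors\<close>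

context smooth_bundle
begin

lemma ev1_sum:
  assumes "\<alpha> \<in> forms A 1" "\<And>i. i \<in> I \<Longrightarrow> X i \<in> sections A"
  shows "ev1 \<alpha> (\<Sum>i\<in>I. X i) = (\<Sum>i\<in>I. ev1 \<alpha> (X i))"
proof -
  have 0: "ev1 \<alpha> 0 = 0"
    using ev1_linear(1)[OF assms(1) sections_zero sections_zero] by simp
  show ?thesis
    using assms(2) by (induction I rule: infinite_finite_induct) (simp_all add: 0 assms(1))
qed

lemma smooth_sum [simp]:
  "(\<And>i. i \<in> I \<Longrightarrow> f i \<in> smooth_funs A) \<Longrightarrow> (\<Sum>i\<in>I. f i) \<in> smooth_funs A"
  by (induction I rule: infinite_finite_induct) auto

text \<open>The map \<open>\<pi>\<^sup>\<sharp>\<close> of the decomposable bivector \<open>\<pi> = X \<and> Y\<close>.\<close>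

definition wedge_sharp :: "('m \<Rightarrow> 'v) \<Rightarrow> ('m \<Rightarrow> 'v) \<Rightarrow> ('m, 'v) form \<Rightarrow> 'm \<Rightarrow> 'v" where
  "wedge_sharp X Y \<alpha> = fscale (ev1 \<alpha> X) Y - fscale (ev1 \<alpha> Y) X"

lemma wedge_sharp_section [simp]:
  "X \<in> sections A \<Longrightarrow> Y \<in> sections A \<Longrightarrow> \<alpha> \<in> forms A 1 \<Longrightarrow> wedge_sharp X Y \<alpha> \<in> sections A"
  by (simp add: wedge_sharp_def)

text \<open>Covectors separate the vectors of a fibre, so at most one vector has the defining property of
  \<^const>\<open>sharp\<close>.\<close>

lemma sharp_unique:
  assumes "v \<in> fibre A x" "\<And>b. b \<in> covectors (fibre A x) \<Longrightarrow> b [v] = P x a b"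
  shows "sharp A P x a = v"
  unfolding sharp_def
proof (rule the_equality)
  show "v \<in> fibre A x \<and> (\<forall>b\<in>covectors (fibre A x). b [v] = P x a b)" using assms by blast
  fix w assume "w \<in> fibre A x \<and> (\<forall>b\<in>covectors (fibre A x). b [w] = P x a b)"
  then show "w = v" using assms by (intro covectors_separate[of _ x]) auto
qed

lemma
  assumes P: "sum_of_wedges_on A U P n X Y" and "x \<in> U" "a \<in> covectors (fibre A x)"
  shows sharp_wedges: "sharp A P x a = (\<Sum>k<n. a [X k x] *\<^sub>R Y k x - a [Y k x] *\<^sub>R X k x)"
    and sharp_wedges_fibre: "sharp A P x a \<in> fibre A x"
    and sharp_wedges_pairing: "b \<in> covectors (fibre A x) \<Longrightarrow> b [sharp A P x a] = P x a b"
proof -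
  let ?v = "\<lambda>k. a [X k x] *\<^sub>R Y k x - a [Y k x] *\<^sub>R X k x"
  have f: "X k x \<in> fibre A x" "Y k x \<in> fibre A x" if "k < n" for k
    using P that by (auto simp: sum_of_wedges_on_def)
  then have g: "?v k \<in> fibre A x" if "k < n" for k
    using that by (simp add: subspace_diff[OF fibre_subspace] subspace_scale[OF fibre_subspace])
  have v: "(\<Sum>k<n. ?v k) \<in> fibre A x"
    using g by (intro subspace_sum[OF fibre_subspace]) auto
  have p: "b [\<Sum>k<n. ?v k] = P x a b" if b: "b \<in> covectors (fibre A x)" for b
  proof -
    have t: "b [?v k] = wedge2 (X k x) (Y k x) a b" if "k < n" for k
      using covector_linear[OF b f(2)[OF that] f(1)[OF that], of "a [X k x]" "- a [Y k x]"]
      by (simp add: wedge2_def)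
    have "b [\<Sum>k<n. ?v k] = (\<Sum>k<n. b [?v k])"
      using covector_sum[OF b fibre_subspace, of "{..<n}" ?v "\<lambda>_. 1"] g by simp
    also have "\<dots> = P x a b"
      using P assms(2,3) b t by (simp add: sum_of_wedges_on_def)
    finally show ?thesis .
  qed
  show 1: "sharp A P x a = (\<Sum>k<n. ?v k)"
    using v p by (rule sharp_unique)
  show "sharp A P x a \<in> fibre A x" "b \<in> covectors (fibre A x) \<Longrightarrow> b [sharp A P x a] = P x a b"
    unfolding 1 using v p by auto
qed

text \<open>On \<open>U\<close>, \<open>\<pi>\<^sup>\<sharp>\<alpha>\<close> is a combination of global sections with smooth coefficients.\<close>

lemma sharp_sec_wedges:
  assumes "sum_of_wedges_on A U P n X Y" "x \<in> U" "\<alpha> \<in> forms A 1"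
  shows "sharp_sec A P \<alpha> x = (\<Sum>k<n. wedge_sharp (X k) (Y k) \<alpha>) x"
  using sharp_wedges[OF assms(1,2) form_at[OF assms(3)]]
  by (simp add: sharp_sec_def sum_apply wedge_sharp_def ev1_def)

end

context algebroid
begin

lemma D_sum:
  assumes "X \<in> sections A" "\<And>i. i \<in> I \<Longrightarrow> f i \<in> smooth_funs A"
  shows "D X (\<Sum>i\<in>I. f i) = (\<Sum>i\<in>I. D X (f i))"
  using assms(2) by (induction I rule: infinite_finite_induct) (simp_all add: assms(1))

lemma D_sum_section:
  assumes "f \<in> smooth_funs A" "\<And>i. i \<in> I \<Longrightarrow> X i \<in> sections A"
  shows "D (\<Sum>i\<in>I. X i) f = (\<Sum>i\<in>I. D (X i) f)"
proof -
  have 0: "D 0 f = 0"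
    using D_section(1)[OF sections_zero assms(1) sections_zero] by simp
  show ?thesis
    using assms(2) by (induction I rule: infinite_finite_induct) (simp_all add: 0 assms(1))
qed

lemma br_sum:
  assumes "Y \<in> sections A" "\<And>i. i \<in> I \<Longrightarrow> X i \<in> sections A"
  shows "br Y (\<Sum>i\<in>I. X i) = (\<Sum>i\<in>I. br Y (X i))"
    and "br (\<Sum>i\<in>I. X i) Y = (\<Sum>i\<in>I. br (X i) Y)"
  using assms(2) by (induction I rule: infinite_finite_induct) (simp_all add: assms(1))

context
  fixes \<alpha> \<beta> \<gamma> :: "('m, 'v) form"
  assumes forms: "\<alpha> \<in> forms A 1" "\<beta> \<in> forms A 1" "\<gamma> \<in> forms A 1"
begin

text \<open>The defect of the Poisson identity for \<open>\<alpha>, \<beta>, \<gamma>\<close>, polarised: both \<open>s\<close> and \<open>t\<close> stand for \<open>\<pi>\<^sup>\<sharp>\<close>.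
  It is biadditive, so for a sum of wedge products it reduces to pairs of wedge products.\<close>

definition jac :: "(('m, 'v) form \<Rightarrow> 'm \<Rightarrow> 'v) \<Rightarrow> (('m, 'v) form \<Rightarrow> 'm \<Rightarrow> 'v) \<Rightarrow> 'm \<Rightarrow> real" where
  "jac s t = D (s \<alpha>) (ev1 \<gamma> (t \<beta>)) + D (s \<beta>) (ev1 \<alpha> (t \<gamma>)) + D (s \<gamma>) (ev1 \<beta> (t \<alpha>))
     - ev1 \<gamma> (br (s \<alpha>) (t \<beta>)) - ev1 \<alpha> (br (s \<beta>) (t \<gamma>)) - ev1 \<beta> (br (s \<gamma>) (t \<alpha>))"

text \<open>The defect for a pair of wedge products is not tensorial by itself; in the symmetric combination all
  derivatives of functions cancel, and the Schouten bracket of the two wedge products remains.\<close>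

lemma jac_schouten:
  assumes "X \<in> sections A" "Y \<in> sections A" "U \<in> sections A" "V \<in> sections A"
  shows "jac (wedge_sharp X Y) (wedge_sharp U V) x + jac (wedge_sharp U V) (wedge_sharp X Y) x =
    - schouten_wedge A X Y U V x (\<alpha> x) (\<beta> x) (\<gamma> x)"
proof -
  let ?w2 = "\<lambda>A B. ev1 \<beta> A x * ev1 \<gamma> B x - ev1 \<beta> B x * ev1 \<gamma> A x"
  let ?w3 = "\<lambda>A B C. ev1 \<alpha> A x * ?w2 B C - ev1 \<alpha> B x * ?w2 A C + ev1 \<alpha> C x * ?w2 A B"
  have S: "schouten_wedge A X Y U V x (\<alpha> x) (\<beta> x) (\<gamma> x) =
     ?w3 (br X U) Y V - ?w3 (br X V) Y U - ?w3 (br Y U) X V + ?w3 (br Y V) X U"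
    by (simp add: schouten_wedge_def wedge3_def wedge2_def ev1_def)
  show ?thesis
    unfolding S using assms forms br_skew[of U X] br_skew[of U Y] br_skew[of V X] br_skew[of V Y]
    by (simp add: jac_def wedge_sharp_def algebra_simps)
qed

lemma jac_sum:
  assumes "\<And>k \<alpha>. k \<in> K \<Longrightarrow> \<alpha> \<in> forms A 1 \<Longrightarrow> s k \<alpha> \<in> sections A"
    "\<And>l \<alpha>. l \<in> L \<Longrightarrow> \<alpha> \<in> forms A 1 \<Longrightarrow> t l \<alpha> \<in> sections A"
  shows "jac (\<lambda>\<alpha>. \<Sum>k\<in>K. s k \<alpha>) (\<lambda>\<alpha>. \<Sum>l\<in>L. t l \<alpha>) = (\<Sum>k\<in>K. \<Sum>l\<in>L. jac (s k) (t l))"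
  unfolding jac_def sum_subtractf sum.distrib
  using assms forms by (simp add: D_sum_section D_sum br_sum ev1_sum sum.swap[of _ L K])

text \<open>Near \<open>p\<close> the maps \<open>s\<close> and \<open>t\<close> may be two different expressions for \<open>r\<close>, since anchor and bracket
  are local.\<close>

lemma jac_local:
  assumes s: "s \<alpha> \<in> sections A" "s \<beta> \<in> sections A" "s \<gamma> \<in> sections A"
    and t: "t \<alpha> \<in> sections A" "t \<beta> \<in> sections A" "t \<gamma> \<in> sections A"
    and r: "r \<alpha> \<in> sections A" "r \<beta> \<in> sections A" "r \<gamma> \<in> sections A"
    and "open U" "p \<in> U"
    and eq: "\<And>q \<eta>. q \<in> U \<Longrightarrow> \<eta> \<in> forms A 1 \<Longrightarrow> s \<eta> q = r \<eta> q" "\<And>q \<eta>. q \<in> U \<Longrightarrow> \<eta> \<in> forms A 1 \<Longrightarrow> t \<eta> q = r \<eta> q"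
  shows "jac s t p = jac r r p"
proof -
  have 1: "D (s \<eta>) (ev1 \<theta> (t \<zeta>)) p = D (r \<eta>) (ev1 \<theta> (r \<zeta>)) p"
    if "\<eta> \<in> forms A 1" "\<theta> \<in> forms A 1" "\<zeta> \<in> forms A 1" "r \<eta> \<in> sections A" "t \<zeta> \<in> sections A" "r \<zeta> \<in> sections A" for \<eta> \<theta> \<zeta>
  proof -
    have "D (s \<eta>) (ev1 \<theta> (t \<zeta>)) p = D (r \<eta>) (ev1 \<theta> (t \<zeta>)) p"
      using eq(1) \<open>p \<in> U\<close> that by (simp add: anchor_sec_def)
    also have "\<dots> = D (r \<eta>) (ev1 \<theta> (r \<zeta>)) p"
      using eq(2) that by (intro D_local[OF _ _ _ \<open>open U\<close> \<open>p \<in> U\<close>]) (simp_all, simp add: ev1_def)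
    finally show ?thesis .
  qed
  have 2: "ev1 \<theta> (br (s \<eta>) (t \<zeta>)) p = ev1 \<theta> (br (r \<eta>) (r \<zeta>)) p"
    if "\<eta> \<in> forms A 1" "\<zeta> \<in> forms A 1" "r \<eta> \<in> sections A" "s \<eta> \<in> sections A" "t \<zeta> \<in> sections A" "r \<zeta> \<in> sections A" for \<eta> \<theta> \<zeta>
  proof -
    have "br (s \<eta>) (t \<zeta>) p = br (s \<eta>) (r \<zeta>) p"
      by (rule br_local(1)[OF that(4-6) \<open>open U\<close> \<open>p \<in> U\<close>]) (use eq that in simp)
    also have "\<dots> = br (r \<eta>) (r \<zeta>) p"
      by (rule br_local(2)[OF that(6,4,3) \<open>open U\<close> \<open>p \<in> U\<close>]) (use eq that in simp)
    finally show ?thesis by (simp add: ev1_def)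
  qed
  show ?thesis
    using forms s t r by (simp add: jac_def 1 2)
qed

end

end

locale poisson_algebroid = algebroid A
  for A :: "('m::{t2_space,second_countable_topology}, 'v::real_vector, 'z) lie_algebroid_data_scheme" +
  fixes P :: "('m, 'v) bivector"
  assumes poisson: "poisson_bivector A P"
begin

lemma local_wedges:
  obtains U n X Y where "open U" "x \<in> U" "sum_of_wedges_on A U P n X Y"
  using poisson unfolding poisson_bivector_def has_schouten_bracket_def by blast

lemma sharp_in_fibre [simp]: "a \<in> covectors (fibre A x) \<Longrightarrow> sharp A P x a \<in> fibre A x"
  using local_wedges[of x] sharp_wedges_fibre by metis

lemma sharp_pairing:
  "a \<in> covectors (fibre A x) \<Longrightarrow> b \<in> covectors (fibre A x) \<Longrightarrow> b [sharp A P x a] = P x a b"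
  using local_wedges[of x] sharp_wedges_pairing by metis

lemma P_bivector:
  assumes "a \<in> covectors (fibre A x)" "b \<in> covectors (fibre A x)"
  shows "P x b a = - P x a b"
    and "c \<in> covectors (fibre A x) \<Longrightarrow> P x (\<lambda>vs. s * a vs + t * b vs) c = s * P x a c + t * P x b c"
  using poisson assms unfolding poisson_bivector_def bivector_fields_def by blast+

abbreviation (input) sh :: "('m, 'v) form \<Rightarrow> 'm \<Rightarrow> 'v" where "sh \<equiv> sharp_sec A P"

lemma sh_section [simp]:
  assumes "\<alpha> \<in> forms A 1"
  shows "sh \<alpha> \<in> sections A"
proof (rule sections_local)
  show "sh \<alpha> x \<in> fibre A x" for x
    using form_at[OF assms] by (simp add: sharp_sec_def)
  fix p
  obtain U n X Y where U: "open U" "p \<in> U" "sum_of_wedges_on A U P n X Y" by (rule local_wedges)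
  have "(\<Sum>k<n. wedge_sharp (X k) (Y k) \<alpha>) \<in> sections A"
    using U(3) assms unfolding sum_of_wedges_on_def by (intro sections_sum wedge_sharp_section) auto
  then show "\<exists>T Z. open T \<and> p \<in> T \<and> Z \<in> sections A \<and> (\<forall>q\<in>T. sh \<alpha> q = Z q)"
    using U sharp_sec_wedges[OF U(3) _ assms] by blast
qed

lemma P_eq_ev1: "\<alpha> \<in> forms A 1 \<Longrightarrow> \<beta> \<in> forms A 1 \<Longrightarrow> P x (\<alpha> x) (\<beta> x) = ev1 \<beta> (sh \<alpha>) x"
  using sharp_pairing[OF form_at form_at] by (simp add: ev1_def sharp_sec_def)

lemma ev1_sh_skew: "\<alpha> \<in> forms A 1 \<Longrightarrow> \<beta> \<in> forms A 1 \<Longrightarrow> ev1 \<alpha> (sh \<beta>) = - ev1 \<beta> (sh \<alpha>)"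
  using P_bivector(1)[OF form_at form_at, of \<alpha> \<beta>] P_eq_ev1[of \<alpha> \<beta>] P_eq_ev1[of \<beta> \<alpha>] by (auto simp: fun_eq_iff)

text \<open>The two decompositions of the bivector in the definition of the Schouten bracket may differ.  The
  defect is computed with either of them in either position, which gives twice the defect as a sum
  of symmetrised pairs, that is, as minus the Schouten bracket.\<close>

lemma poisson_identity:
  assumes "\<alpha> \<in> forms A 1" "\<beta> \<in> forms A 1" "\<gamma> \<in> forms A 1"
  shows "D (sh \<alpha>) (ev1 \<gamma> (sh \<beta>)) + D (sh \<beta>) (ev1 \<alpha> (sh \<gamma>)) + D (sh \<gamma>) (ev1 \<beta> (sh \<alpha>)) =
    ev1 \<gamma> (br (sh \<alpha>) (sh \<beta>)) + ev1 \<alpha> (br (sh \<beta>) (sh \<gamma>)) + ev1 \<beta> (br (sh \<gamma>) (sh \<alpha>))"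
proof -
  let ?J = "jac \<alpha> \<beta> \<gamma>"
  have "?J sh sh p = 0" for p
  proof -
    obtain U n X1 X2 m Y1 Y2 where U: "open U" "p \<in> U"
        and w: "sum_of_wedges_on A U P n X1 X2" "sum_of_wedges_on A U P m Y1 Y2"
        and T: "\<forall>y\<in>U. \<forall>a\<in>covectors (fibre A y). \<forall>b\<in>covectors (fibre A y). \<forall>c\<in>covectors (fibre A y).
           0 = (\<Sum>k<n. \<Sum>l<m. schouten_wedge A (X1 k) (X2 k) (Y1 l) (Y2 l) y a b c)"
      using poisson unfolding poisson_bivector_def has_schouten_bracket_def by blast
    have X: "X1 k \<in> sections A" "X2 k \<in> sections A" if "k < n" for k
      using w(1) that by (auto simp: sum_of_wedges_on_def)
    have Y: "Y1 l \<in> sections A" "Y2 l \<in> sections A" if "l < m" for l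
      using w(2) that by (auto simp: sum_of_wedges_on_def)
    let ?s = "\<lambda>k. wedge_sharp (X1 k) (X2 k)" and ?t = "\<lambda>l. wedge_sharp (Y1 l) (Y2 l)"
    have S: "(\<Sum>k<n. ?s k \<eta>) \<in> sections A" and T': "(\<Sum>l<m. ?t l \<eta>) \<in> sections A"
      if "\<eta> \<in> forms A 1" for \<eta>
      using X Y that by (auto intro!: sections_sum wedge_sharp_section)
    have 1: "?J (\<lambda>\<alpha>. \<Sum>k<n. ?s k \<alpha>) (\<lambda>\<alpha>. \<Sum>l<m. ?t l \<alpha>) p = ?J sh sh p"
      by (rule jac_local[OF assms _ _ _ _ _ _ _ _ _ U])
        (simp_all only: assms S T' sh_section sharp_sec_wedges[OF w(1), symmetric] sharp_sec_wedges[OF w(2), symmetric])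
    have 2: "?J (\<lambda>\<alpha>. \<Sum>l<m. ?t l \<alpha>) (\<lambda>\<alpha>. \<Sum>k<n. ?s k \<alpha>) p = ?J sh sh p"
      by (rule jac_local[OF assms _ _ _ _ _ _ _ _ _ U])
        (simp_all only: assms S T' sh_section sharp_sec_wedges[OF w(1), symmetric] sharp_sec_wedges[OF w(2), symmetric])
    have e1: "?J (\<lambda>\<alpha>. \<Sum>k<n. ?s k \<alpha>) (\<lambda>\<alpha>. \<Sum>l<m. ?t l \<alpha>) = (\<Sum>k<n. \<Sum>l<m. ?J (?s k) (?t l))"
      by (rule jac_sum[OF assms]) (use X Y in auto)
    have e2: "?J (\<lambda>\<alpha>. \<Sum>l<m. ?t l \<alpha>) (\<lambda>\<alpha>. \<Sum>k<n. ?s k \<alpha>) = (\<Sum>l<m. \<Sum>k<n. ?J (?t l) (?s k))"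
      by (rule jac_sum[OF assms]) (use X Y in auto)
    have "?J sh sh p + ?J sh sh p =
        (\<Sum>k<n. \<Sum>l<m. ?J (?s k) (?t l) p) + (\<Sum>l<m. \<Sum>k<n. ?J (?t l) (?s k) p)"
      using 1[unfolded e1] 2[unfolded e2] by (simp add: sum_apply)
    also have "\<dots> = (\<Sum>k<n. \<Sum>l<m. ?J (?s k) (?t l) p + ?J (?t l) (?s k) p)"
      by (subst (2) sum.swap) (simp add: sum.distrib)
    also have "\<dots> = - (\<Sum>k<n. \<Sum>l<m. schouten_wedge A (X1 k) (X2 k) (Y1 l) (Y2 l) p (\<alpha> p) (\<beta> p) (\<gamma> p))"
      using X Y assms by (simp add: jac_schouten sum_negf)
    also have "\<dots> = 0" using T U(2) assms[THEN form_at] by simp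
    finally show ?thesis by simp
  qed
  then have "?J sh sh = 0" by (simp add: fun_eq_iff)
  then show ?thesis using assms by (simp add: jac_def algebra_simps)
qed

end

section \<open>The structure defined by a 2-form on a Poisson Lie algebroid\<close>

locale poisson_two_form = poisson_algebroid A P
  for A :: "('m::{t2_space,second_countable_topology}, 'v::real_vector, 'z) lie_algebroid_data_scheme"
    and P :: "('m, 'v) bivector" +
  fixes \<omega> :: "('m, 'v) form" and N :: "'m \<Rightarrow> 'v \<Rightarrow> 'v"
  assumes \<omega>: "\<omega> \<in> forms A 2"
    and N: "N = (\<lambda>x v. sharp A P x (flat \<omega> x v))"
begin

abbreviation (input) n :: "('m \<Rightarrow> 'v) \<Rightarrow> 'm \<Rightarrow> 'v" where "n \<equiv> on_sections N"

lemma flat_covector: "v \<in> fibre A x \<Longrightarrow> flat \<omega> x v \<in> covectors (fibre A x)"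
  using alt_form_2_linear(2)[OF form_at[OF \<omega>]] supportedD[OF forms_supported[OF \<omega>]]
  by (intro covectorI) (auto simp: flat_def)

lemma n_eq_sh: "n X = sh (ins X \<omega>)"
  by (simp add: on_sections_def N sharp_sec_def ins_def flat_def)

lemma ins_\<omega> [simp]: "X \<in> sections A \<Longrightarrow> ins X \<omega> \<in> forms A 1"
  by (rule ins_form_2[OF \<omega>])

lemma N_endo: "N \<in> endo_fields A"
proof -
  have "N x (a *\<^sub>R v + b *\<^sub>R w) = a *\<^sub>R N x v + b *\<^sub>R N x w" if "v \<in> fibre A x" "w \<in> fibre A x" for x v w a b
  proof -
    note c = flat_covector[OF that(1)] flat_covector[OF that(2)]
    have m: "a *\<^sub>R v + b *\<^sub>R w \<in> fibre A x" "a *\<^sub>R N x v + b *\<^sub>R N x w \<in> fibre A x"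
      using that c by (simp_all add: N subspace_add[OF fibre_subspace] subspace_scale[OF fibre_subspace])
    have "flat \<omega> x (a *\<^sub>R v + b *\<^sub>R w) vs = a * flat \<omega> x v vs + b * flat \<omega> x w vs" for vs
    proof (cases "length vs = 1 \<and> set vs \<subseteq> fibre A x")
      case True
      then obtain u where "vs = [u]" "u \<in> fibre A x" by (cases vs) (auto simp: One_nat_def)
      then show ?thesis
        using alt_form_2_linear(1)[OF form_at[OF \<omega>] that] by (simp add: flat_def)
    qed (simp add: alt_forms_cases[OF c(1)] alt_forms_cases[OF c(2)] alt_forms_cases[OF flat_covector[OF m(1)]])
    then have f: "flat \<omega> x (a *\<^sub>R v + b *\<^sub>R w) = (\<lambda>vs. a * flat \<omega> x v vs + b * flat \<omega> x w vs)" by blast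
    have "sharp A P x (flat \<omega> x (a *\<^sub>R v + b *\<^sub>R w)) = a *\<^sub>R N x v + b *\<^sub>R N x w"
    proof (rule sharp_unique[OF m(2)])
      fix d assume d: "d \<in> covectors (fibre A x)"
      show "d [a *\<^sub>R N x v + b *\<^sub>R N x w] = P x (flat \<omega> x (a *\<^sub>R v + b *\<^sub>R w)) d"
        using covector_linear[OF d, of "N x v" "N x w" a b] P_bivector(2)[OF c d] c d
        by (simp add: f N sharp_pairing)
    qed
    then show ?thesis by (simp add: N)
  qed
  moreover have "n X \<in> sections A" if "X \<in> sections A" for X
    using that by (simp add: n_eq_sh)
  moreover have "N x v \<in> fibre A x" if "v \<in> fibre A x" for x v
    using flat_covector[OF that] by (simp add: N)
  ultimately show ?thesis unfolding endo_fields_def by blast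
qed

lemmas n_section [simp] = endo_section[OF N_endo]
lemmas n_uminus [simp] = endo_uminus[OF N_endo]

text \<open>Both sides are \<open>- \<omega>(X, \<pi>\<^sup>\<sharp>\<gamma>)\<close>, by the skewness of \<open>\<pi>\<close> and of \<open>\<omega>\<close>.\<close>

lemma ev1_n: "\<gamma> \<in> forms A 1 \<Longrightarrow> X \<in> sections A \<Longrightarrow> ev1 \<gamma> (n X) = ev2 \<omega> (sh \<gamma>) X"
  using ev1_sh_skew[of \<gamma> "ins X \<omega>"] ev2_swap[OF \<omega>, of X "sh \<gamma>"] by (simp add: n_eq_sh)

lemma n_adjoint: "X \<in> sections A \<Longrightarrow> Y \<in> sections A \<Longrightarrow> ev2 \<omega> (n X) Y = ev2 \<omega> X (n Y)"
  using ev1_n[of "ins X \<omega>" Y] by (simp add: n_eq_sh)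

lemma n_cross: "X \<in> sections A \<Longrightarrow> Y \<in> sections A \<Longrightarrow> ev2 \<omega> (n Y) X = - ev2 \<omega> (n X) Y"
  using n_adjoint[of X Y] ev2_swap[OF \<omega>, of X "n Y"] by simp

lemma transp_eq: "\<alpha> \<in> forms A 1 \<Longrightarrow> transp A N \<alpha> = ins (sh \<alpha>) \<omega>"
  by (rule supported_ext_1)
    (simp_all add: supported_transp[OF N_endo] forms_supported ev1_transp[OF N_endo] ev1_n)

lemma i_endo_eq: "\<alpha> \<in> forms A 1 \<Longrightarrow> i_endo A N \<alpha> = ins (sh \<alpha>) \<omega>"
  by (rule supported_ext_1)
    (simp_all add: supported_i_endo[OF N_endo] forms_supported i_endo_ev[OF N_endo] ev1_n)

lemma compatible:
  assumes "a \<in> covectors (fibre A x)"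
  shows "N x (sharp A P x a) = sharp A P x (transp_at A N x a)"
proof -
  obtain \<gamma> where \<gamma>: "\<gamma> \<in> forms A 1" "\<gamma> x = a" using assms by (rule form_through)
  have "transp_at A N x a = flat \<omega> x (sharp A P x a)"
    using fun_cong[OF transp_eq[OF \<gamma>(1)], of x] \<gamma>(2)
    by (simp add: transp_def ins_def sharp_sec_def flat_def)
  then show ?thesis by (simp add: N)
qed

definition \<omega>1 where "\<omega>1 = twist A \<omega> N"
definition \<omega>2 where "\<omega>2 = twist A \<omega>1 N"

lemma \<omega>1: "\<omega>1 \<in> forms A 2"
  and ev2_\<omega>1: "X \<in> sections A \<Longrightarrow> Y \<in> sections A \<Longrightarrow> ev2 \<omega>1 X Y = ev2 \<omega> (n X) Y"
  unfolding \<omega>1_def by (rule twist_form[OF N_endo \<omega> n_adjoint]; assumption)+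

lemma \<omega>2: "\<omega>2 \<in> forms A 2"
  and ev2_\<omega>2: "X \<in> sections A \<Longrightarrow> Y \<in> sections A \<Longrightarrow> ev2 \<omega>2 X Y = ev2 \<omega> (n X) (n Y)"
proof -
  have "ev2 \<omega>1 (n X) Y = ev2 \<omega>1 X (n Y)" if "X \<in> sections A" "Y \<in> sections A" for X Y
    using that n_adjoint[of "n X" Y] by (simp add: ev2_\<omega>1)
  then have *: "twist A \<omega>1 N \<in> forms A 2"
    "\<And>X Y. X \<in> sections A \<Longrightarrow> Y \<in> sections A \<Longrightarrow> ev2 (twist A \<omega>1 N) X Y = ev2 \<omega>1 (n X) Y"
    by (intro twist_form[OF N_endo \<omega>1]; simp)+
  show "\<omega>2 \<in> forms A 2" using *(1) by (simp add: \<omega>2_def)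
  show "ev2 \<omega>2 X Y = ev2 \<omega> (n X) (n Y)" if "X \<in> sections A" "Y \<in> sections A"
    using *(2)[OF that] that n_adjoint[of "n X" Y] by (simp add: \<omega>2_def ev2_\<omega>1)
qed

text \<open>Pair both sides with a 1-form \<open>\<gamma>\<close> and put \<open>Z = \<pi>\<^sup>\<sharp>\<gamma>\<close>.  The Poisson identity for \<open>\<omega>\<^sup>\<flat>X\<close>, \<open>\<omega>\<^sup>\<flat>Y\<close>, \<open>\<gamma>\<close>
  expresses \<open>\<gamma>([nX, nY])\<close> by \<open>\<omega>\<close>, and the rest is an expansion of the three differentials.\<close>

lemma torsion_formula:
  assumes X: "X \<in> sections A" and Y: "Y \<in> sections A"
  shows "torsion A N X Y = sh (ins2 (n X) Y (- ext_d A \<omega>) - ins2 (n Y) X (- ext_d A \<omega>)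
    + ins2 X Y (ext_d A \<omega>1))" (is "_ = sh ?\<theta>")
proof (rule sections_eqI)
  have \<theta>: "?\<theta> \<in> forms A 1"
    using X Y by (intro forms_add forms_diff ins2_form_3 forms_uminus ext_d_forms_3 \<omega> \<omega>1) auto
  have be: "bracket_endo A N X Y \<in> sections A" using X Y by (simp add: bracket_endo_def)
  show "torsion A N X Y \<in> sections A" using X Y be by (simp add: torsion_def)
  show "sh ?\<theta> \<in> sections A" using \<theta> by simp
  fix \<gamma> assume \<gamma>: "\<gamma> \<in> forms A 1"
  define Z where "Z = sh \<gamma>"
  have Z: "Z \<in> sections A" using \<gamma> by (simp add: Z_def)
  note sec = X Y Z
  have "ev1 \<gamma> (sh ?\<theta>) = - ev1 ?\<theta> Z"
    unfolding Z_def by (rule ev1_sh_skew[OF \<gamma> \<theta>])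
  also have "\<dots> = d2 \<omega> Y (n X) Z - d2 \<omega> X (n Y) Z - d2 \<omega>1 Y X Z"
    using sec \<omega> \<omega>1 by (simp add: ev3_ext_d)
  finally have 1: "ev1 \<gamma> (sh ?\<theta>) = d2 \<omega> Y (n X) Z - d2 \<omega> X (n Y) Z - d2 \<omega>1 Y X Z" .
  have 2: "ev1 \<gamma> (torsion A N X Y) = ev1 \<gamma> (br (n X) (n Y)) - ev2 \<omega> Z (bracket_endo A N X Y)"
    using sec be \<gamma> by (simp add: torsion_def ev1_n Z_def)
  have 3: "D (n X) (ev2 \<omega> Z Y) + D (n Y) (ev2 \<omega> X Z) + D Z (ev2 \<omega> Y (n X)) =
      ev1 \<gamma> (br (n X) (n Y)) + ev2 \<omega> X (br (n Y) Z) + ev2 \<omega> Y (br Z (n X))"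
    using poisson_identity[of "ins X \<omega>" "ins Y \<omega>" \<gamma>] sec \<gamma>
    by (simp add: n_eq_sh[symmetric] ev1_n Z_def[symmetric])
  \<comment> \<open>one normal form for each value of \<open>\<omega>\<close> and each bracket, so that equal terms are recognised\<close>
  have swaps: "ev2 \<omega> Z Y = - ev2 \<omega> Y Z" "ev2 \<omega> Y (n X) = - ev2 \<omega> (n X) Y"
    "ev2 \<omega> X (n Y) = ev2 \<omega> (n X) Y" "ev2 \<omega> (n Y) X = - ev2 \<omega> (n X) Y"
    "ev2 \<omega> (br Y Z) (n X) = ev2 \<omega> (n (br Y Z)) X" "ev2 \<omega> (br X Z) (n Y) = ev2 \<omega> (n (br X Z)) Y"
    "ev2 \<omega> X (br (n Y) Z) = - ev2 \<omega> (br (n Y) Z) X" "ev2 \<omega> Y (br (n X) Z) = - ev2 \<omega> (br (n X) Z) Y"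
    "ev2 \<omega> Z (br (n X) Y) = - ev2 \<omega> (br (n X) Y) Z" "ev2 \<omega> Z (br X (n Y)) = - ev2 \<omega> (br X (n Y)) Z"
    "ev2 \<omega> Z (n (br X Y)) = - ev2 \<omega> (n (br X Y)) Z"
    using sec by (auto intro!: ev2_swap[OF \<omega>] n_cross n_adjoint n_adjoint[symmetric])
  have skews: "br Z (n X) = - br (n X) Z" "br Y (n X) = - br (n X) Y" "br Y X = - br X Y"
    using sec by (auto intro!: br_skew)
  have 4: "ev1 \<gamma> (br (n X) (n Y)) = - D (n X) (ev2 \<omega> Y Z) + D (n Y) (ev2 \<omega> X Z) - D Z (ev2 \<omega> (n X) Y)
      + ev2 \<omega> (br (n Y) Z) X - ev2 \<omega> (br (n X) Z) Y"
    using 3 sec \<omega> by (simp add: swaps skews algebra_simps)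
  show "ev1 \<gamma> (torsion A N X Y) = ev1 \<gamma> (sh ?\<theta>)"
    unfolding 1 2 4 using sec \<omega>
    by (simp add: bracket_endo_def d2_def ev2_\<omega>1 swaps skews algebra_simps)
qed

text \<open>The point is \<open>\<H> + i\<^sub>N d\<omega>\<^sub>1 = d\<omega>\<^sub>2\<close>.  On sections its two sides differ by a multiple of the difference of
  the two sides of the Poisson identity for \<open>\<omega>\<^sup>\<flat>X\<close>, \<open>\<omega>\<^sup>\<flat>Y\<close>, \<open>\<omega>\<^sup>\<flat>Z\<close>.\<close>

lemma background_cocycle:
  "d_endo A N (ext_d A \<omega>1) = ext_d A (cyclic_twist A (- ext_d A \<omega>) N)"
proof -
  let ?c = "cyclic_twist A (- ext_d A \<omega>) N" and ?i = "i_endo A N (ext_d A \<omega>1)"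
  have i_supp: "supported 3 ?i"
    by (intro supported_i_endo[OF N_endo] forms_supported ext_d_forms_3 \<omega>1)
  have "?c = ext_d A \<omega>2 - ?i"
  proof (rule supported_ext_3)
    show "supported 3 ?c" by (rule supported_cyclic_twist[OF N_endo])
    show "supported 3 (ext_d A \<omega>2 - ?i)"
      by (rule supported_combine(2)[OF forms_supported[OF ext_d_forms_3[OF \<omega>2]] i_supp])
    fix X Y Z assume sec: "X \<in> sections A" "Y \<in> sections A" "Z \<in> sections A"
    have p: "D (n X) (ev2 \<omega> Z (n Y)) + D (n Y) (ev2 \<omega> X (n Z)) + D (n Z) (ev2 \<omega> Y (n X)) =
      ev2 \<omega> Z (br (n X) (n Y)) + ev2 \<omega> X (br (n Y) (n Z)) + ev2 \<omega> Y (br (n Z) (n X))"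
      using poisson_identity[of "ins X \<omega>" "ins Y \<omega>" "ins Z \<omega>"] sec by (simp add: n_eq_sh[symmetric])
    have swaps: "ev2 \<omega> Z (n Y) = - ev2 \<omega> (n Y) Z" "ev2 \<omega> Y (n X) = - ev2 \<omega> (n X) Y"
      "ev2 \<omega> Z (n X) = - ev2 \<omega> (n X) Z"
      "ev2 \<omega> X (n Z) = ev2 \<omega> (n X) Z" "ev2 \<omega> X (n Y) = ev2 \<omega> (n X) Y" "ev2 \<omega> Y (n Z) = ev2 \<omega> (n Y) Z"
      "ev2 \<omega> (n Z) X = - ev2 \<omega> (n X) Z" "ev2 \<omega> (n Y) X = - ev2 \<omega> (n X) Y" "ev2 \<omega> (n Z) Y = - ev2 \<omega> (n Y) Z"
      "ev2 \<omega> (n Z) (n X) = - ev2 \<omega> (n X) (n Z)"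
      "ev2 \<omega> (n (n X)) Y = ev2 \<omega> (n X) (n Y)" "ev2 \<omega> (n (n X)) Z = ev2 \<omega> (n X) (n Z)"
      "ev2 \<omega> (n (n Y)) Z = ev2 \<omega> (n Y) (n Z)"
      "ev2 \<omega> Z (br (n X) (n Y)) = - ev2 \<omega> (br (n X) (n Y)) Z"
      "ev2 \<omega> X (br (n Y) (n Z)) = - ev2 \<omega> (br (n Y) (n Z)) X"
      "ev2 \<omega> Y (br (n X) (n Z)) = - ev2 \<omega> (br (n X) (n Z)) Y"
      using sec by (auto intro!: ev2_swap[OF \<omega>] n_cross n_adjoint n_adjoint[symmetric])
    have adj: "ev2 \<omega> (n (br U V)) W = ev2 \<omega> (br U V) (n W)"
      if "U \<in> sections A" "V \<in> sections A" "W \<in> sections A" for U V W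
      using that by (simp add: n_adjoint)
    have skews: "br (n Z) (n X) = - br (n X) (n Z)" "br (n Z) X = - br X (n Z)"
      "br (n Y) X = - br X (n Y)" "br (n Z) Y = - br Y (n Z)"
      using sec by (auto intro!: br_skew)
    have p': "D (n X) (ev2 \<omega> (n Y) Z) = D (n Y) (ev2 \<omega> (n X) Z) - D (n Z) (ev2 \<omega> (n X) Y)
        + ev2 \<omega> (br (n X) (n Y)) Z + ev2 \<omega> (br (n Y) (n Z)) X - ev2 \<omega> (br (n X) (n Z)) Y"
      using p sec \<omega> by (simp add: swaps skews algebra_simps)
    show "ev3 ?c X Y Z = ev3 (ext_d A \<omega>2 - ?i) X Y Z"
      using sec \<omega> \<omega>1 \<omega>2
      by (simp add: cyclic_twist_ev[OF N_endo] i_endo_ev[OF N_endo] ev3_ext_d)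
        (simp add: d2_def ev2_\<omega>1 ev2_\<omega>2 swaps skews adj p' algebra_simps)
  qed
  moreover have "ev3 ?i X Y Z \<in> smooth_funs A" if "X \<in> sections A" "Y \<in> sections A" "Z \<in> sections A" for X Y Z
    using that ext_d_forms_3[OF \<omega>1] by (simp add: i_endo_ev[OF N_endo])
  ultimately have "ext_d A ?c = ext_d A (ext_d A \<omega>2) - ext_d A ?i"
    using i_supp ext_d_forms_3[OF \<omega>2] by (simp add: ext_d_diff_3 forms_supported)
  moreover have "i_endo A N 0 = 0" by (simp add: i_endo_def fun_eq_iff)
  ultimately show ?thesis
    by (simp add: d_endo_def ext_d_ext_d \<omega>1 \<omega>2)
qed

lemma ev1_pairing:
  assumes "\<alpha> \<in> forms A 1" "\<beta> \<in> forms A 1" "Z \<in> sections A"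
  shows "ev1 (ext_d A (pairing P \<alpha> \<beta>)) Z = D Z (ev1 \<beta> (sh \<alpha>))"
proof -
  have "(\<lambda>y. pairing P \<alpha> \<beta> y []) = ev1 \<beta> (sh \<alpha>)"
    using P_eq_ev1[OF assms(1,2)] by (auto simp: pairing_def fun_form_def)
  then show ?thesis using assms by (simp add: ev1_ext_d)
qed

lemma ev1_ext_d_ins:
  "Z \<in> sections A \<Longrightarrow> ev1 (ext_d A (ins X \<beta>)) Z = D Z (ev1 \<beta> X)"
  by (subst ev1_ext_d) (simp_all add: ins_def ev1_def)

lemma ev1_bracket_bivector:
  assumes "\<alpha> \<in> forms A 1" "\<beta> \<in> forms A 1" "Z \<in> sections A"
  shows "ev1 (bracket_bivector A P \<alpha> \<beta>) Z = d1 \<beta> (sh \<alpha>) Z - d1 \<alpha> (sh \<beta>) Z - D Z (ev1 \<alpha> (sh \<beta>))"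
  using assms by (simp add: bracket_bivector_def lie_deriv_def ev1_pairing ev1_ext_d_ins ev2_ext_d)

lemma ev1_d_endo_function:
  assumes "supported 0 \<eta>" "Z \<in> sections A"
  shows "ev1 (d_endo A N \<eta>) Z = D (n Z) (\<lambda>y. \<eta> y [])"
proof -
  have "(\<lambda>y. i_endo A N \<eta> y []) = 0" by (simp add: i_endo_def fun_eq_iff)
  then show ?thesis
    using assms(2) by (simp add: d_endo_def i_endo_ev[OF N_endo] ev1_ext_d)
qed

lemma ev1_lie_endo:
  assumes "\<beta> \<in> forms A 1" "X \<in> sections A" "Z \<in> sections A"
  shows "ev1 (lie_endo A N X \<beta>) Z =
    d1 \<beta> (n X) Z + d1 \<beta> X (n Z) - d1 (ins (sh \<beta>) \<omega>) X Z + D (n Z) (ev1 \<beta> X)"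
proof -
  have "supported 0 (ins X \<beta>)"
    using supported_ins[of 0 \<beta> X] forms_supported[OF assms(1)] assms(2) by (simp add: One_nat_def)
  from ev1_d_endo_function[OF this assms(3)]
  have "ev1 (d_endo A N (ins X \<beta>)) Z = D (n Z) (ev1 \<beta> X)"
    by (simp add: ins_def ev1_def)
  then show ?thesis
    using assms by (simp add: lie_endo_def d_endo_def[of A N \<beta>] i_endo_ev[OF N_endo] ev2_ext_d i_endo_eq)
qed

text \<open>Evaluate on \<open>Z\<close> and put \<open>X = \<pi>\<^sup>\<sharp>\<alpha>\<close>, \<open>Y = \<pi>\<^sup>\<sharp>\<beta>\<close>.  The terms with \<open>nX\<close> and \<open>nY\<close> cancel and what is left
  is twice the same expression, in which the Poisson identity for \<open>\<alpha>\<close>, \<open>\<beta>\<close>, \<open>\<omega>\<^sup>\<flat>Z\<close> replaces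
  \<open>\<beta>([X, nZ])\<close> by values of \<open>\<omega>\<close>, up to terms that cancel.\<close>

lemma concomitant_formula:
  assumes \<alpha>: "\<alpha> \<in> forms A 1" and \<beta>: "\<beta> \<in> forms A 1"
  shows "concomitant A P N \<alpha> \<beta> = (\<lambda>x vs. - 2 * ins2 (sh \<alpha>) (sh \<beta>) (- ext_d A \<omega>) x vs)"
proof (rule supported_ext_1)
  have p0: "supported 0 (pairing P \<eta> \<theta>)" for \<eta> \<theta>
    by (simp add: supported_def pairing_def fun_form_def)
  have de: "supported (Suc k) (d_endo A N \<eta>)" if "supported k \<eta>" for k \<eta>
    unfolding d_endo_def using that
    by (intro supported_combine supported_i_endo[OF N_endo] supported_ext_d)
  have in0: "supported 0 (ins X \<eta>)" if "\<eta> \<in> forms A 1" "X \<in> sections A" for X \<eta>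
    using supported_ins[of 0 \<eta> X] forms_supported[OF that(1)] that(2) by (simp add: One_nat_def)
  have le: "supported 1 (lie_endo A N X \<eta>)" if "\<eta> \<in> forms A 1" "X \<in> sections A" for X \<eta>
    unfolding lie_endo_def One_nat_def
    using that forms_supported[OF that(1)] in0[OF that]
    by (intro supported_combine supported_ins de) (simp_all add: One_nat_def)
  have ld: "supported 1 (lie_deriv A X \<eta>)" if "\<eta> \<in> forms A 1" "X \<in> sections A" for X \<eta>
    unfolding lie_deriv_def One_nat_def
    using that forms_supported[OF that(1)] in0[OF that]
    by (intro supported_combine supported_ins supported_ext_d) (simp_all add: One_nat_def)
  have bb: "supported 1 (bracket_bivector A P \<eta> \<theta>)" if "\<eta> \<in> forms A 1" "\<theta> \<in> forms A 1" for \<eta> \<theta>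
    unfolding bracket_bivector_def using that p0 supported_ext_d[OF p0]
    by (intro supported_combine ld) (simp_all add: One_nat_def)
  have d0: "supported 1 (d_endo A N (pairing P \<alpha> \<beta>))"
    using de[OF p0] by (simp add: One_nat_def)
  show "supported 1 (concomitant A P N \<alpha> \<beta>)"
    unfolding concomitant_def using \<alpha> \<beta> d0
    by (intro supported_combine le bb supported_transp[OF N_endo]) (simp_all add: transp_eq)
  have H: "ins2 (sh \<alpha>) (sh \<beta>) (- ext_d A \<omega>) \<in> forms A 1"
    using \<alpha> \<beta> by (intro ins2_form_3 forms_uminus ext_d_forms_3 \<omega>) auto
  show "supported 1 (\<lambda>x vs. - 2 * ins2 (sh \<alpha>) (sh \<beta>) (- ext_d A \<omega>) x vs)"
    using forms_supported[OF H] by (simp add: supported_def)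
  fix Z assume Z: "Z \<in> sections A"
  define X Y where "X = sh \<alpha>" and "Y = sh \<beta>"
  have sec: "X \<in> sections A" "Y \<in> sections A" "Z \<in> sections A" using \<alpha> \<beta> Z by (simp_all add: X_def Y_def)
  have nX: "sh (ins X \<omega>) = n X" "sh (ins Y \<omega>) = n Y" by (simp_all add: n_eq_sh)
  have skew: "ev1 \<alpha> Y = - ev1 \<beta> X" unfolding X_def Y_def by (rule ev1_sh_skew[OF \<alpha> \<beta>])
  have e: "ev1 \<alpha> (n V) = ev2 \<omega> X V" "ev1 \<beta> (n V) = ev2 \<omega> Y V" if "V \<in> sections A" for V
    using ev1_n \<alpha> \<beta> that by (simp_all add: X_def Y_def)
  have p: "ev1 \<beta> (br X (n Z)) = ev2 \<omega> Z (br X Y) + ev1 \<alpha> (br Y (n Z))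
      - D X (ev2 \<omega> Z Y) - D Y (ev2 \<omega> X Z) - D (n Z) (ev1 \<beta> X)"
    using poisson_identity[of \<alpha> \<beta> "ins Z \<omega>"] \<alpha> \<beta> sec br_skew[of "n Z" X]
    by (simp add: n_eq_sh[symmetric] X_def[symmetric] Y_def[symmetric] e algebra_simps)
  have swaps: "ev2 \<omega> Z Y = - ev2 \<omega> Y Z" "ev2 \<omega> Y X = - ev2 \<omega> X Y"
    "ev2 \<omega> Z (br X Y) = - ev2 \<omega> (br X Y) Z"
    "ev2 \<omega> X (br Y Z) = - ev2 \<omega> (br Y Z) X" "ev2 \<omega> Y (br X Z) = - ev2 \<omega> (br X Z) Y"
    using sec by (auto intro!: ev2_swap[OF \<omega>])
  have r: "ev1 (\<lambda>x vs. - 2 * ins2 X Y (- ext_d A \<omega>) x vs) Z = - d2 \<omega> X Y Z - d2 \<omega> X Y Z"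
    using ev3_ext_d[OF \<omega> sec(2,1,3)] d2_swap(1)[OF \<omega> sec]
    by (simp add: ev1_def ev3_def ins2_def ins_def fun_eq_iff)
  have p1: "ev1 (d_endo A N (pairing P \<alpha> \<beta>)) Z = D (n Z) (ev1 \<beta> X)"
  proof -
    have "(\<lambda>y. pairing P \<alpha> \<beta> y []) = ev1 \<beta> X"
      using P_eq_ev1[OF \<alpha> \<beta>] by (auto simp: pairing_def fun_form_def X_def)
    then show ?thesis using ev1_d_endo_function[OF p0 Z] by simp
  qed
  have "ev1 (concomitant A P N \<alpha> \<beta>) Z = - d2 \<omega> X Y Z - d2 \<omega> X Y Z"
    using sec \<alpha> \<beta> \<omega>
    by (simp add: concomitant_def transp_eq ev1_transp[OF N_endo] ev1_lie_endo ev1_bracket_bivector p1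
          X_def[symmetric] Y_def[symmetric] nX)
      (simp add: d1_def d2_def e skew p swaps algebra_simps)
  then show "ev1 (concomitant A P N \<alpha> \<beta>) Z = ev1 (\<lambda>x vs. - 2 * ins2 (sh \<alpha>) (sh \<beta>) (- ext_d A \<omega>) x vs) Z"
    using r by (simp add: X_def Y_def)
qed

lemma ext_d_H: "ext_d A (- ext_d A \<omega>) = 0"
proof -
  have z: "supported 3 (0 :: ('m, 'v) form)" "ev3 (0 :: ('m, 'v) form) X Y Z = 0" for X Y Z
    by (simp_all add: supported_def ev3_def fun_eq_iff)
  have "ext_d A (0 - 0) = ext_d A 0 - ext_d A (0 :: ('m, 'v) form)"
    by (rule ext_d_diff_3) (simp_all add: z)
  moreover have "ext_d A (0 - ext_d A \<omega>) = ext_d A 0 - ext_d A (ext_d A \<omega>)"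
    by (rule ext_d_diff_3) (simp_all add: z forms_supported ext_d_forms_3 \<omega>)
  ultimately show ?thesis by (simp add: ext_d_ext_d \<omega>)
qed

lemma quasi_nijenhuis_structure: "poisson_quasi_nijenhuis_background A P N (ext_d A (twist A \<omega> N)) (- ext_d A \<omega>)"
  unfolding poisson_quasi_nijenhuis_background_def \<omega>1_def[symmetric]
proof (intro conjI ballI allI)
  show "P \<in> bivector_fields A" using poisson by (simp add: poisson_bivector_def)
qed (simp_all add: N_endo ext_d_forms_3 forms_uminus \<omega> \<omega>1 compatible ext_d_ext_d ext_d_H poisson
      concomitant_formula torsion_formula background_cocycle)

end

theorem theorem4p1:
  fixes A :: "('m::{t2_space,second_countable_topology}, 'v::real_vector) lie_algebroid_data"
    and P :: "('m, 'v) bivector" and \<omega> :: "('m, 'v) form" and N :: "'m \<Rightarrow> 'v \<Rightarrow> 'v"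
  assumes "lie_algebroid A"
    and "poisson_bivector A P"
    and "\<omega> \<in> forms A 2"
    and "N = (\<lambda>x v. sharp A P x (flat \<omega> x v))"
  shows "poisson_quasi_nijenhuis_background A P N (ext_d A (twist A \<omega> N)) (- ext_d A \<omega>)"
proof -
  interpret poisson_two_form A P \<omega> N
    using assms by unfold_locales
  show ?thesis by (rule quasi_nijenhuis_structure)
qed

end
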